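(* Let $\mathcal F=\{d_s\}_{s\in\mathbb R}$ be a family of metrics on $X$ and $\mathcal M=\{m_s\}_{s\in\mathbb R}$ a family of measures on $X$ as in the context (so $\mathcal F$ satisfies the local continuity condition and $\mathcal M$ the local comparability condition stated there). Let $\boldsymbol m=m_s\otimes\mathrm ds$, i.e. $\int F\,\mathrm d\boldsymbol m=\int_{\mathbb R}\int_XF(s,x)\,\mathrm dm_s(x)\,\mathrm ds$ for Borel $F:\mathbb R\times X\to[0,\infty]$, and suppose $(\mathbb R\times_{\mathcal F}X,\boldsymbol m)$ satisfies the wTCD$_p(0,N)$-condition for some $p\in(0,1)$ and $N\ge1$. Then there is a measure $m$ on $X$ such that $m_s=m$ for a.e. $s\in\mathbb R$.
   Context: Setting. $X$ is a locally compact topological space, $I=\mathbb R$, $h\equiv1$, and $\mathcal F=\{d_s\}_{s\in\mathbb R}$ is a family of metrics on $X$ whose induced length metrics generate the topology of $X$, satisfying the local continuity condition: for all compact $J\subset\mathbb R$, $K\subset X$ there are $r>0$ and a modulus of continuity $\omega$ with $\big|\log\frac{d_s(x,y)}{d_{s'}(x,y)}\big|\le\omega(|s-s'|)$ for $s,s'\in J$ and distinct $x,y\in K$ with $\inf_{s\in J}d_s(x,y)<r$. Absolute continuity of curves in $X$ is then independent of the metric in $\mathcal F$. $\mathcal M=\{m_s\}_{s\in\mathbb R}$ is a family of measures on $X$ such that (a) $s\mapsto m_s(E)$ is Borel for each Borel $E\subset X$; (b) $\limsup_{r\to0}\frac{m_s(B_{d_s}(x,2r))}{m_s(B_{d_s}(x,r))}<\infty$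 for $m_s$-a.e. $x$, for each $s$; (c) (local comparability) for all compact $J\subset\mathbb R$, $K\subset X$ there is $C>0$ with $m_{s'}|_K\le C\,m_s|_K$ for all $s,s'\in J$. The product $Y=\mathbb R\times_{\mathcal F}X$. For absolutely continuous $\beta:[a,b]\to X$ put $v_\beta(s,t)=\limsup_{\delta\to0}\frac1\delta\int_t^{t+\delta}|\beta_u'|_{d_s}\,\mathrm du$, where $|\beta_u'|_{d_s}$ is the metric speed. An absolutely continuous $\gamma=(\alpha,\beta):[a,b]\to\mathbb R\times X$ with $\alpha'>0$ a.e. is future directed causal if $v_\beta(\alpha_t,t)\le\alpha'(t)$ a.e., and future directed timelike if $v_\beta(\alpha_t,t)<\alpha'(t)$ a.e.; denote these families $\mathcal C^+$ and $\mathcal I^+$. The length of $\gamma\in\mathcal C^+$ is $L(\gamma)=\int_a^b\sqrt{\alpha'(t)^2-v_\beta(\alpha_t,t)^2}\,\mathrm dt$. Write $x\le y$ if some $\gamma\in\mathcal C^+$ joins $x$ to $y$ ($\le$ is a preorder, so $x\le x$ always), and $\tau(x,y)=\sup\{L(\gamma):\gamma\in\mathcal C^+\text{ from }x\text{ to }y\}$ ($\sup\varnothing=0$). Curvature condition. $\mathcal P(Y)$ denotes probability measures on $Y$; $\mathcal P_c^{ac}(Y,\boldsymbol m)$ those compactly supported and absolutely continuous with respect to $\boldsymbol m$. $\Pi_\le(\mu,\nu)$ is the set of couplings of $\mu,\nu$ concentrated on $\{(x,y):x\le y\}$, and $\ell_p(\mu,\nu)=\sup\{(\int\tau(x,y)^p\,\mathrm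 d\pi)^{1/p}:\pi\in\Pi_\le(\mu,\nu)\}$ ($\sup\varnothing=0$). $\mathrm{OpT}(Y)$ is the set of $\gamma\in\mathcal I^+$ on $[0,1]$ with $\tau(\gamma_t,\gamma_s)=(s-t)L(\gamma)$ for $0\le t\le s\le1$. With $e_t(\gamma)=\gamma_t$, $\mathrm{OpT}_p(\mu,\nu)$ is the set of probability measures $\eta$ on $C([0,1],Y)$ concentrated on $\mathrm{OpT}(Y)$ with $e_{0*}\eta=\mu$, $e_{1*}\eta=\nu$ and $\ell_p(\mu,\nu)^p=\int L(\gamma)^p\,\mathrm d\eta(\gamma)$. The entropy is $\mathrm{Ent}_{\boldsymbol m}(\mu)=\int\rho\log\rho\,\mathrm d\boldsymbol m$ if $\mu=\rho\boldsymbol m$ with $(\rho\log\rho)_+\in L^1(\boldsymbol m)$, and $+\infty$ otherwise. For a Radon measure $\boldsymbol m$ on $Y$, $(Y,\boldsymbol m)$ satisfies wTCD$_p(0,N)$ if for all $\mu,\nu\in\mathcal P_c^{ac}(Y,\boldsymbol m)$ with $\mathrm{OpT}_p(\mu,\nu)\ne\varnothing$ there is $\eta\in\mathrm{OpT}_p(\mu,\nu)$ such that $u(t)=\exp(-\mathrm{Ent}_{\boldsymbol m}(e_{t*}\eta)/N)$ satisfies $u(t)\ge(1-t)u(0)+t\,u(1)$ for $t\in[0,1]$. *)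

theory Defs
  imports "HOL-Probability.Probability"
begin

text \<open>Metrics on a type are functions satisfying \<^locale>\<open>Metric_space\<close> with carrier
  \<^term>\<open>UNIV\<close>; the topology of \<open>X\<close> is the one of the type class. Length and the
  induced length metric may take the value \<open>\<infinity>\<close>.\<close>

definition curve_length :: "('a \<Rightarrow> 'a \<Rightarrow> real) \<Rightarrow> real \<Rightarrow> real \<Rightarrow> (real \<Rightarrow> 'a) \<Rightarrow> ennreal" where
  "curve_length \<delta> a b c =
     (SUP (n, t) \<in> {(n::nat, t::nat \<Rightarrow> real). mono t \<and> range t \<subseteq> {a..b}}.
        \<Sum>i<n. ennreal (\<delta> (c (t i)) (c (t (Suc i)))))"

definition length_metric :: "('a \<Rightarrow> 'a \<Rightarrow> real) \<Rightarrow> 'a \<Rightarrow> 'a \<Rightarrow> ennreal" where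
  "length_metric \<delta> x y =
     (INF c \<in> {c. continuous_map (top_of_set {0..1}) (Metric_space.mtopology UNIV \<delta>) c
                 \<and> c 0 = x \<and> c 1 = y}. curve_length \<delta> 0 1 c)"

definition generates_topology :: "('a::topological_space \<Rightarrow> 'a \<Rightarrow> ennreal) \<Rightarrow> bool" where
  "generates_topology \<rho> \<longleftrightarrow>
     (\<forall>U. open U \<longleftrightarrow> (\<forall>x\<in>U. \<exists>e>0::real. {y. \<rho> x y < ennreal e} \<subseteq> U))"

definition modulus_of_continuity :: "(real \<Rightarrow> real) \<Rightarrow> bool" where
  "modulus_of_continuity \<omega> \<longleftrightarrow>
     \<omega> 0 = 0 \<and> mono_on {0..} \<omega> \<and> (\<omega> \<longlongrightarrow> 0) (at_right 0)"

definition locally_continuous_metrics ::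
    "(real \<Rightarrow> 'a::topological_space \<Rightarrow> 'a \<Rightarrow> real) \<Rightarrow> bool" where
  "locally_continuous_metrics d \<longleftrightarrow>
     (\<forall>J K. compact J \<longrightarrow> compact K \<longrightarrow>
        (\<exists>r>0. \<exists>\<omega>. modulus_of_continuity \<omega> \<and>
           (\<forall>s\<in>J. \<forall>s'\<in>J. \<forall>x\<in>K. \<forall>y\<in>K. x \<noteq> y \<longrightarrow> (INF s\<in>J. d s x y) < r \<longrightarrow>
              \<bar>ln (d s x y / d s' x y)\<bar> \<le> \<omega> \<bar>s - s'\<bar>)))"

definition metric_family :: "(real \<Rightarrow> 'a::topological_space \<Rightarrow> 'a \<Rightarrow> real) \<Rightarrow> bool" where
  "metric_family d \<longleftrightarrow>
     (\<forall>s. Metric_space UNIV (d s)) \<and>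
     (\<forall>s. generates_topology (length_metric (d s))) \<and>
     locally_continuous_metrics d"

text \<open>In \<open>ennreal\<close> one has \<open>c / 0 = \<infinity>\<close> for \<open>c > 0\<close>, while \<open>0 / 0\<close> and \<open>\<infinity> / \<infinity>\<close>
  are \<open>0\<close>. So the second condition says that near almost every point
  \<open>m\<^sub>s(B(x,2r)) \<le> C m\<^sub>s(B(x,r))\<close> for all small \<open>r\<close>.\<close>

definition measure_family ::
    "(real \<Rightarrow> 'a::topological_space \<Rightarrow> 'a \<Rightarrow> real) \<Rightarrow> (real \<Rightarrow> 'a measure) \<Rightarrow> bool" where
  "measure_family d M \<longleftrightarrow>
     (\<forall>s. sets (M s) = sets borel) \<and>
     (\<forall>E\<in>sets borel. (\<lambda>s. emeasure (M s) E) \<in> borel_measurable borel) \<and>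
     (\<forall>s. AE x in M s.
        Limsup (at_right 0) (\<lambda>r. emeasure (M s) (Metric_space.mball UNIV (d s) x (2 * r))
                                / emeasure (M s) (Metric_space.mball UNIV (d s) x r)) < \<infinity>) \<and>
     (\<forall>J K. compact J \<longrightarrow> compact K \<longrightarrow>
        (\<exists>C>0::real. \<forall>s\<in>J. \<forall>s'\<in>J. \<forall>E\<in>sets borel. E \<subseteq> K \<longrightarrow>
           emeasure (M s') E \<le> ennreal C * emeasure (M s) E))"

definition integrated_measure ::
    "(real \<Rightarrow> 'a::topological_space measure) \<Rightarrow> (real \<times> 'a) measure \<Rightarrow> bool" where
  "integrated_measure M m \<longleftrightarrow>
     sets m = sets borel \<and>
     (\<forall>F \<in> borel_measurable borel. (\<integral>\<^sup>+y. F y \<partial>m) = (\<integral>\<^sup>+s. (\<integral>\<^sup>+x. F (s, x) \<partial>M s) \<partial>lborel))"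

text \<open>Radon measures in the sense usual on locally compact Hausdorff spaces.\<close>

definition radon_measure :: "'b::topological_space measure \<Rightarrow> bool" where
  "radon_measure m \<longleftrightarrow>
     sets m = sets borel \<and>
     (\<forall>K. compact K \<longrightarrow> emeasure m K < \<infinity>) \<and>
     (\<forall>E\<in>sets borel. emeasure m E = (INF U \<in> {U. open U \<and> E \<subseteq> U}. emeasure m U)) \<and>
     (\<forall>U. open U \<longrightarrow> emeasure m U = (SUP K \<in> {K. compact K \<and> K \<subseteq> U}. emeasure m K))"

definition ac_curve :: "('a \<Rightarrow> 'a \<Rightarrow> real) \<Rightarrow> real \<Rightarrow> real \<Rightarrow> (real \<Rightarrow> 'a) \<Rightarrow> bool" where
  "ac_curve \<delta> a b c \<longleftrightarrow>
     (\<exists>g. set_integrable lebesgue {a..b} g \<and>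
        (\<forall>t u. a \<le> t \<and> t \<le> u \<and> u \<le> b \<longrightarrow> \<delta> (c t) (c u) \<le> (LINT w:{t..u}|lebesgue. g w)))"

text \<open>Only relevant where the limit exists, which is almost everywhere on \<open>[a, b]\<close> for an
  absolutely continuous curve.\<close>

definition metric_speed ::
    "('a \<Rightarrow> 'a \<Rightarrow> real) \<Rightarrow> real \<Rightarrow> real \<Rightarrow> (real \<Rightarrow> 'a) \<Rightarrow> real \<Rightarrow> real" where
  "metric_speed \<delta> a b c u = Lim (at u within {a..b}) (\<lambda>w. \<delta> (c w) (c u) / \<bar>w - u\<bar>)"

text \<open>The interval integral is oriented, so the quotient is a mean value for negative \<open>h\<close>, too.\<close>

definition vel ::
    "(real \<Rightarrow> 'a \<Rightarrow> 'a \<Rightarrow> real) \<Rightarrow> real \<Rightarrow> real \<Rightarrow> (real \<Rightarrow> 'a) \<Rightarrow> real \<Rightarrow> real \<Rightarrow> ereal" where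
  "vel d a b \<beta> s t =
     Limsup (at 0) (\<lambda>h. ereal (1 / h *
       (LINT u=ereal t..ereal (t + h)|lebesgue. metric_speed (d s) a b \<beta> u)))"

text \<open>Absolute continuity in \<open>X\<close> does not depend on the metric of the family; it is stated for
  all of them. Degenerate intervals \<open>a = b\<close> are allowed, which makes \<open>causal_le\<close> reflexive.\<close>

definition ac_product_curve ::
    "(real \<Rightarrow> 'a \<Rightarrow> 'a \<Rightarrow> real) \<Rightarrow> real \<Rightarrow> real \<Rightarrow> (real \<Rightarrow> real \<times> 'a) \<Rightarrow> bool" where
  "ac_product_curve d a b \<gamma> \<longleftrightarrow>
     a \<le> b \<and> ac_curve dist a b (fst \<circ> \<gamma>) \<and> (\<forall>s. ac_curve (d s) a b (snd \<circ> \<gamma>))"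

definition causal_curve ::
    "(real \<Rightarrow> 'a \<Rightarrow> 'a \<Rightarrow> real) \<Rightarrow> real \<Rightarrow> real \<Rightarrow> (real \<Rightarrow> real \<times> 'a) \<Rightarrow> bool" where
  "causal_curve d a b \<gamma> \<longleftrightarrow>
     ac_product_curve d a b \<gamma> \<and>
     (AE t in lborel. t \<in> {a..b} \<longrightarrow>
        deriv (fst \<circ> \<gamma>) t > 0 \<and>
        vel d a b (snd \<circ> \<gamma>) (fst (\<gamma> t)) t \<le> ereal (deriv (fst \<circ> \<gamma>) t))"

definition timelike_curve ::
    "(real \<Rightarrow> 'a \<Rightarrow> 'a \<Rightarrow> real) \<Rightarrow> real \<Rightarrow> real \<Rightarrow> (real \<Rightarrow> real \<times> 'a) \<Rightarrow> bool" where
  "timelike_curve d a b \<gamma> \<longleftrightarrow>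
     ac_product_curve d a b \<gamma> \<and>
     (AE t in lborel. t \<in> {a..b} \<longrightarrow>
        deriv (fst \<circ> \<gamma>) t > 0 \<and>
        vel d a b (snd \<circ> \<gamma>) (fst (\<gamma> t)) t < ereal (deriv (fst \<circ> \<gamma>) t))"

definition causal_length ::
    "(real \<Rightarrow> 'a \<Rightarrow> 'a \<Rightarrow> real) \<Rightarrow> real \<Rightarrow> real \<Rightarrow> (real \<Rightarrow> real \<times> 'a) \<Rightarrow> ennreal" where
  "causal_length d a b \<gamma> =
     (\<integral>\<^sup>+t\<in>{a..b}. ennreal (sqrt ((deriv (fst \<circ> \<gamma>) t)\<^sup>2
        - (real_of_ereal (vel d a b (snd \<circ> \<gamma>) (fst (\<gamma> t)) t))\<^sup>2)) \<partial>lebesgue)"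

definition causal_le ::
    "(real \<Rightarrow> 'a \<Rightarrow> 'a \<Rightarrow> real) \<Rightarrow> real \<times> 'a \<Rightarrow> real \<times> 'a \<Rightarrow> bool" where
  "causal_le d x y \<longleftrightarrow> (\<exists>a b \<gamma>. causal_curve d a b \<gamma> \<and> \<gamma> a = x \<and> \<gamma> b = y)"

text \<open>In \<open>ennreal\<close> the supremum of the empty set is \<open>0\<close>.\<close>

definition time_sep ::
    "(real \<Rightarrow> 'a \<Rightarrow> 'a \<Rightarrow> real) \<Rightarrow> real \<times> 'a \<Rightarrow> real \<times> 'a \<Rightarrow> ennreal" where
  "time_sep d x y = Sup {causal_length d a b \<gamma> | a b \<gamma>. causal_curve d a b \<gamma> \<and> \<gamma> a = x \<and> \<gamma> b = y}"

definition ennpow :: "ennreal \<Rightarrow> real \<Rightarrow> ennreal" where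
  "ennpow x p = (if x = \<infinity> then \<infinity> else ennreal (enn2real x powr p))"

definition prob_measures :: "'b::topological_space measure set" where
  "prob_measures = {\<mu>. sets \<mu> = sets borel \<and> prob_space \<mu>}"

definition ac_prob_measures :: "'b::topological_space measure \<Rightarrow> 'b measure set" where
  "ac_prob_measures m =
     {\<mu> \<in> prob_measures. (\<exists>K. compact K \<and> (AE y in \<mu>. y \<in> K)) \<and> absolutely_continuous m \<mu>}"

definition causal_couplings ::
    "(real \<Rightarrow> 'a::topological_space \<Rightarrow> 'a \<Rightarrow> real) \<Rightarrow> (real \<times> 'a) measure \<Rightarrow> (real \<times> 'a) measure \<Rightarrow>
     ((real \<times> 'a) \<times> (real \<times> 'a)) measure set" where
  "causal_couplings d \<mu> \<nu> =
     {\<pi> \<in> prob_measures. distr \<pi> borel fst = \<mu> \<and> distr \<pi> borel snd = \<nu> \<and>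
        (AE (x, y) in \<pi>. causal_le d x y)}"

definition lorentz_wasserstein ::
    "(real \<Rightarrow> 'a::topological_space \<Rightarrow> 'a \<Rightarrow> real) \<Rightarrow> real \<Rightarrow>
     (real \<times> 'a) measure \<Rightarrow> (real \<times> 'a) measure \<Rightarrow> ennreal" where
  "lorentz_wasserstein d p \<mu> \<nu> =
     (SUP \<pi> \<in> causal_couplings d \<mu> \<nu>.
        ennpow (\<integral>\<^sup>+z. ennpow (time_sep d (fst z) (snd z)) p \<partial>\<pi>) (1 / p))"

text \<open>The space \<open>C([0,1], Y)\<close>, with curves made extensional outside \<open>[0,1]\<close>, the compact-open
  topology (that is, uniform convergence), and its Borel sets.\<close>

definition unit_curves :: "(real \<Rightarrow> 'b::topological_space) set" where
  "unit_curves = {\<gamma> \<in> extensional {0..1}. continuous_on {0..1} \<gamma>}"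

definition unit_curves_topology :: "(real \<Rightarrow> 'b::topological_space) topology" where
  "unit_curves_topology =
     topology_generated_by
       {{\<gamma> \<in> unit_curves. \<gamma> ` K \<subseteq> U} | K U. compact K \<and> K \<subseteq> {0..1} \<and> open U}"

definition unit_curves_borel :: "(real \<Rightarrow> 'b::topological_space) measure" where
  "unit_curves_borel = sigma unit_curves {A. openin unit_curves_topology A}"

definition opt_curves ::
    "(real \<Rightarrow> 'a::topological_space \<Rightarrow> 'a \<Rightarrow> real) \<Rightarrow> (real \<Rightarrow> real \<times> 'a) set" where
  "opt_curves d =
     {\<gamma> \<in> unit_curves. timelike_curve d 0 1 \<gamma> \<and>
        (\<forall>t s. 0 \<le> t \<and> t \<le> s \<and> s \<le> 1 \<longrightarrow>
           time_sep d (\<gamma> t) (\<gamma> s) = ennreal (s - t) * causal_length d 0 1 \<gamma>)}"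

definition opt_plans ::
    "(real \<Rightarrow> 'a::topological_space \<Rightarrow> 'a \<Rightarrow> real) \<Rightarrow> real \<Rightarrow>
     (real \<times> 'a) measure \<Rightarrow> (real \<times> 'a) measure \<Rightarrow> (real \<Rightarrow> real \<times> 'a) measure set" where
  "opt_plans d p \<mu> \<nu> =
     {\<eta>. sets \<eta> = sets unit_curves_borel \<and> prob_space \<eta> \<and> (AE \<gamma> in \<eta>. \<gamma> \<in> opt_curves d) \<and>
        distr \<eta> borel (\<lambda>\<gamma>. \<gamma> 0) = \<mu> \<and> distr \<eta> borel (\<lambda>\<gamma>. \<gamma> 1) = \<nu> \<and>
        ennpow (lorentz_wasserstein d p \<mu> \<nu>) p = (\<integral>\<^sup>+\<gamma>. ennpow (causal_length d 0 1 \<gamma>) p \<partial>\<eta>)}"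

text \<open>\<^term>\<open>RN_deriv m \<mu>\<close> is a density of \<open>\<mu>\<close> whenever one exists, so \<open>density m \<rho> = \<mu>\<close> below
  says that there is one. \<^const>\<open>ennreal\<close> truncates negative numbers to \<open>0\<close>, so the two integrals
  are those of the positive and the negative part of \<open>\<rho> log \<rho>\<close>; the value \<open>-\<infinity>\<close> is possible.\<close>

definition Ent :: "'b measure \<Rightarrow> 'b measure \<Rightarrow> ereal" where
  "Ent m \<mu> =
     (let \<rho> = (\<lambda>y. enn2real (RN_deriv m \<mu> y));
          pos = (\<integral>\<^sup>+y. ennreal (\<rho> y * ln (\<rho> y)) \<partial>m);
          neg = (\<integral>\<^sup>+y. ennreal (- (\<rho> y * ln (\<rho> y))) \<partial>m)
      in if density m (\<lambda>y. ennreal (\<rho> y)) = \<mu> \<and> pos < \<infinity>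
         then enn2ereal pos - enn2ereal neg else \<infinity>)"

definition ereal_exp :: "ereal \<Rightarrow> ennreal" where
  "ereal_exp x = (case x of ereal r \<Rightarrow> ennreal (exp r) | PInfty \<Rightarrow> \<infinity> | MInfty \<Rightarrow> 0)"

definition wTCD ::
    "(real \<Rightarrow> 'a::topological_space \<Rightarrow> 'a \<Rightarrow> real) \<Rightarrow> real \<Rightarrow> real \<Rightarrow> (real \<times> 'a) measure \<Rightarrow> bool" where
  "wTCD d p N m \<longleftrightarrow>
     (\<forall>\<mu> \<in> ac_prob_measures m. \<forall>\<nu> \<in> ac_prob_measures m. opt_plans d p \<mu> \<nu> \<noteq> {} \<longrightarrow>
        (\<exists>\<eta> \<in> opt_plans d p \<mu> \<nu>.
           let u = (\<lambda>t. ereal_exp (- Ent m (distr \<eta> borel (\<lambda>\<gamma>. \<gamma> t)) / ereal N))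
           in \<forall>t\<in>{0..1}. u t \<ge> ennreal (1 - t) * u 0 + ennreal t * u 1))"

end

theory Submission
  imports Defs
begin

text \<open>The measure \<open>m\<close> on \<open>\<real> \<times> X\<close> turns out to be invariant under the translations \<open>(s, x) \<mapsto> (s + r, x)\<close>.
Since \<open>m\<close> disintegrates as \<open>M s \<otimes> ds\<close>, this makes \<open>s \<mapsto> M s E\<close> almost everywhere constant for each
Borel set \<open>E\<close>, and countably many sets \<open>E\<close> suffice to identify almost all slices.

Invariance is a Brunn--Minkowski argument. No causal curve is longer than the time it takes
(\<open>time_sep_le\<close>), and the vertical curves \<open>t \<mapsto> (s + T t, x)\<close> attain this bound. As \<open>r \<mapsto> r\<^sup>p\<close> is
concave, Jensen's inequality shows that translating a compactly supported measure \<open>\<mu>\<close> by \<open>T\<close> in time is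
an optimal transport. It is the only one: equality in Jensen's inequality forces every transported point
to travel exactly the time \<open>T\<close>, so that the curves have length equal to their duration, and such curves
have spatial velocity \<open>0\<close> and are vertical (\<open>opt_curve_rigid\<close>). Hence whichever plan the curvature
condition supplies, its intermediate measures are the translates of \<open>\<mu>\<close> (\<open>optimal_plan_marginal\<close>).

Now take for the initial measure the uniform distribution on a bounded set \<open>A\<close>, for which
\<open>exp (- Ent / N)\<close> is \<open>m(A)\<^bsup>1/N\<^esup>\<close>. By Jensen's inequality the value at a translate is at most
\<open>m(A + r)\<^bsup>1/N\<^esup>\<close>. If the total translation is \<open>T\<close> and \<open>t = r / T\<close>, the curvature condition yields
\<open>(1 - r / T) m(A)\<^bsup>1/N\<^esup> \<le> m(A + r)\<^bsup>1/N\<^esup>\<close>, where the contribution of the final measure is simply dropped.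
Letting \<open>T \<longlonglongrightarrow> \<infinity>\<close> gives \<open>m(A) \<le> m(A + r)\<close>. With the uniform distribution as final measure the
same holds for negative \<open>r\<close>, and together the two inequalities give equality (\<open>emeasure_shift\<close>).

Two analytic points need work. The velocity of a curve is defined through its metric speed, so the
rigidity statement rests on the existence almost everywhere of the metric derivative
(\<open>metric_derivative\<close>), which is derived from Lebesgue's differentiation theorem and the
Radon--Nikodym theorem. And \<open>X\<close> need not be separable: that \<open>m\<close> is a Radon measure is used
once more to find a \<open>\<sigma>\<close>-compact set that carries almost all slices (\<open>sigma_compact_carrier\<close>).\<close>

section \<open>Lebesgue differentiation on the line\<close>

text \<open>The integral over the segment between two points regardless of their order, so that averages to the
  left and to the right of a point are handled together.\<close>

definition seg_integral :: "(real \<Rightarrow> real) \<Rightarrow> real \<Rightarrow> real \<Rightarrow> real" where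
  "seg_integral f x y = (LINT w:{min x y..max x y}|lborel. f w)"

lemma cball_eq_segment:
  "cball ((x + y) / 2) (\<bar>y - x\<bar> / 2) = {min x y..max x y :: real}"
  by (auto simp: cball_def dist_real_def abs_if min_def max_def field_simps split: if_splits)

lemma emeasure_UN_le_count_space:
  assumes [measurable]: "\<And>i. i \<in> I \<Longrightarrow> A i \<in> sets M" and [simp]: "countable I"
  shows "emeasure M (\<Union>i\<in>I. A i) \<le> (\<integral>\<^sup>+i. emeasure M (A i) \<partial>count_space I)"
proof -
  note sets.countable_UN'[unfolded subset_eq, measurable]
  have le: "indicator (\<Union>i\<in>I. A i) x \<le> (\<integral>\<^sup>+i. indicator (A i) x \<partial>count_space I)" for x
  proof (cases "x \<in> (\<Union>i\<in>I. A i)")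
    case True
    then obtain j where j: "j \<in> I" "x \<in> A j" by auto
    have "(1::ennreal) = (\<integral>\<^sup>+i. indicator {j} i \<partial>count_space I)"
      using j by simp
    also have "\<dots> \<le> (\<integral>\<^sup>+i. indicator (A i) x \<partial>count_space I)"
      using j by (intro nn_integral_mono) (auto simp: indicator_def)
    finally show ?thesis using True by simp
  qed simp
  have "emeasure M (\<Union>i\<in>I. A i) = (\<integral>\<^sup>+x. indicator (\<Union>i\<in>I. A i) x \<partial>M)"
    by simp
  also have "\<dots> \<le> (\<integral>\<^sup>+x. \<integral>\<^sup>+i. indicator (A i) x \<partial>count_space I \<partial>M)"
    by (intro nn_integral_mono le)
  also have "\<dots> = (\<integral>\<^sup>+i. \<integral>\<^sup>+x. indicator (A i) x \<partial>M \<partial>count_space I)"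
    by (simp add: nn_integral_count_space_nn_integral)
  finally show ?thesis
    by (simp cong: nn_integral_cong_simp)
qed

text \<open>The measure with density \<open>(f - p)\<^sup>+\<close> gives no mass to \<open>{f \<le> p}\<close> and hence little mass to some open
  neighbourhood \<open>U\<close> of this set. A bad point is an endpoint of a segment inside \<open>U\<close> on which \<open>f\<close> has average
  above \<open>q\<close>; the mass of that segment is at least \<open>q - p\<close> times its length. By Vitali's covering lemma,
  disjoint segments of this kind, enlarged five times, cover all bad points. Restricting to a bounded
  interval keeps the measure finite when \<open>p < 0\<close>.\<close>

lemma negligible_averages_above:
  fixes f :: "real \<Rightarrow> real"
  assumes f: "integrable lborel f" and pq: "p < q"
  shows "negligible {x. f x \<le> p \<and> (\<exists>\<^sub>F y in at x. q * \<bar>y - x\<bar> < seg_integral f x y)}"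
    (is "negligible ?E")
proof -
  have [measurable]: "f \<in> borel_measurable borel" using f by auto
  have fs: "set_integrable lborel {a..b} f" for a b
    unfolding set_integrable_def using f by (intro integrable_mult_indicator) auto
  have "negligible (?E \<inter> {- real n<..<real n})" for n
    unfolding negligible_outer_le
  proof (intro allI impI)
    fix e :: real assume e: "e > 0"
    define h where "h x = ennreal ((f x - p) * indicator {- real n..real n} x)" for x
    define \<nu> where "\<nu> = density lborel h"
    have [measurable]: "h \<in> borel_measurable borel" unfolding h_def by measurable
    have sn[simp]: "sets \<nu> = sets borel" unfolding \<nu>_def by simp
    have "set_integrable lborel {- real n..real n} (\<lambda>x. f x - p)"
      by (intro set_integral_diff(1) fs) (auto simp: set_integrable_def)
    then have I: "integrable lborel (\<lambda>x. (f x - p) * indicator {- real n..real n} x)"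
      by (simp add: set_integrable_def mult.commute)
    have "(\<integral>\<^sup>+x. h x \<partial>lborel) \<le> (\<integral>\<^sup>+x. ennreal (norm ((f x - p) * indicator {- real n..real n} x)) \<partial>lborel)"
      unfolding h_def by (intro nn_integral_mono ennreal_leI) simp
    also have "\<dots> < \<infinity>" using I by (simp add: integrable_iff_bounded)
    finally have "(\<integral>\<^sup>+x. h x \<partial>lborel) < \<infinity>" .
    then have fin: "emeasure \<nu> (space \<nu>) \<noteq> \<infinity>"
      unfolding \<nu>_def by (subst emeasure_density) auto
    let ?Z = "{x. f x \<le> p}"
    have "{x\<in>space borel. f x \<le> p} \<in> sets borel" by measurable
    then have Zs: "?Z \<in> sets borel" by simp
    have "emeasure \<nu> ?Z = (\<integral>\<^sup>+x. 0 \<partial>(lborel :: real measure))"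
    proof -
      have "emeasure \<nu> ?Z = (\<integral>\<^sup>+x. h x * indicator ?Z x \<partial>lborel)"
        unfolding \<nu>_def using Zs by (intro emeasure_density) auto
      also have "\<dots> = (\<integral>\<^sup>+x. 0 \<partial>(lborel :: real measure))"
        by (intro nn_integral_cong) (auto simp: h_def indicator_def ennreal_neg)
      finally show ?thesis .
    qed
    moreover have "emeasure \<nu> ?Z = (INF U \<in> {U. ?Z \<subseteq> U \<and> open U}. emeasure \<nu> U)"
      by (rule outer_regular[OF sn fin Zs])
    ultimately have "(INF U \<in> {U. ?Z \<subseteq> U \<and> open U}. emeasure \<nu> U) < ennreal (e * (q - p) / 5)"
      using e pq by simp
    then obtain U where U: "?Z \<subseteq> U" "open U" "emeasure \<nu> U < ennreal (e * (q - p) / 5)"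
      unfolding INF_less_iff by blast
    let ?W = "U \<inter> {- real n<..<real n}" and ?En = "?E \<inter> {- real n<..<real n}"
    have W: "open ?W" using U by auto
    have "\<exists>y. y \<noteq> x \<and> \<bar>y - x\<bar> < 1 \<and> {min x y..max x y} \<subseteq> ?W \<and> q * \<bar>y - x\<bar> < seg_integral f x y"
      if x: "x \<in> ?En" for x
    proof -
      from x U have "x \<in> ?W" by auto
      then obtain \<delta> where \<delta>: "\<delta> > 0" "ball x \<delta> \<subseteq> ?W" using W open_contains_ball by blast
      have "eventually (\<lambda>y. y \<noteq> x \<and> dist y x < min 1 \<delta>) (at x)"
        unfolding eventually_at using \<delta> by (intro exI[of _ "min 1 \<delta>"]) auto
      moreover have "\<exists>\<^sub>F y in at x. q * \<bar>y - x\<bar> < seg_integral f x y" using x by simp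
      ultimately obtain y where y: "q * \<bar>y - x\<bar> < seg_integral f x y" "y \<noteq> x" "dist y x < min 1 \<delta>"
        using frequently_ex[OF frequently_eventually_conj] by blast
      have "{min x y..max x y} \<subseteq> ball x \<delta>" using y(3) by (auto simp: dist_real_def)
      with y \<delta> show ?thesis by (intro exI[of _ y]) (auto simp: dist_real_def)
    qed
    then have "\<forall>x\<in>?En. \<exists>y. y \<noteq> x \<and> \<bar>y - x\<bar> < 1 \<and> {min x y..max x y} \<subseteq> ?W \<and> q * \<bar>y - x\<bar> < seg_integral f x y"
      by blast
    \<comment> \<open>the other endpoint of the chosen segment at a bad point\<close>
    from bchoice[OF this] obtain Y where YY: "\<forall>x\<in>?En. Y x \<noteq> x \<and> \<bar>Y x - x\<bar> < 1 \<and> {min x (Y x)..max x (Y x)} \<subseteq> ?W \<and> q * \<bar>Y x - x\<bar> < seg_integral f x (Y x)"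
      by blast
    have Y: "Y x \<noteq> x" "\<bar>Y x - x\<bar> < 1" "{min x (Y x)..max x (Y x)} \<subseteq> ?W"
      "q * \<bar>Y x - x\<bar> < seg_integral f x (Y x)" if "x \<in> ?En" for x
      using YY that by blast+
    let ?a = "\<lambda>x. (x + Y x) / 2" and ?r = "\<lambda>x. \<bar>Y x - x\<bar> / 2"
    \<comment> \<open>the closed ball with the segment from \<open>i\<close> to \<open>Y i\<close> as a diameter is that segment itself\<close>
    have cov: "?En \<subseteq> (\<Union>i\<in>?En. cball (?a i) (?r i))"
      unfolding cball_eq_segment by auto
    have r: "0 < ?r i \<and> ?r i \<le> 1" if "i \<in> ?En" for i
      using Y(1,2)[OF that] by simp
    obtain C where C: "countable C" "C \<subseteq> ?En"
      "pairwise (\<lambda>i j. disjnt (cball (?a i) (?r i)) (cball (?a j) (?r j))) C"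
      "?En \<subseteq> (\<Union>i\<in>C. cball (?a i) (5 * ?r i))"
      by (rule Vitali_covering_lemma_cballs[OF cov r])
    let ?B = "\<lambda>i. cball (?a i) (?r i)"
    have big: "ennreal (2 * ?r i * (q - p)) \<le> emeasure \<nu> (?B i)" if "i \<in> C" for i
    proof -
      let ?I = "{min i (Y i)..max i (Y i)}"
      have i: "i \<in> ?En" using that C by auto
      let ?F = "\<lambda>x. (f x - p) * indicator ?I x"
      have F: "set_integrable lborel ?I (\<lambda>x. f x - p)"
        by (intro set_integral_diff(1) fs) (auto simp: set_integrable_def)
      then have F': "integrable lborel ?F" by (simp add: set_integrable_def mult.commute)
      have "(LINT x|lborel. ?F x) = (LINT x:?I|lborel. f x - p)"
        by (simp add: set_lebesgue_integral_def mult.commute)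
      also have "\<dots> = seg_integral f i (Y i) - (LINT x:?I|lborel. p)"
        unfolding seg_integral_def by (intro set_integral_diff(2) fs) (auto simp: set_integrable_def)
      also have "(LINT x:?I|lborel. p) = p * \<bar>Y i - i\<bar>"
        by (simp add: set_lebesgue_integral_def max_def min_def)
      finally have "(q - p) * \<bar>Y i - i\<bar> \<le> (LINT x|lborel. ?F x)"
        using Y(4)[OF i] by (simp add: left_diff_distrib)
      also have "\<dots> \<le> (LINT x|lborel. max 0 (?F x))"
        using F' by (intro integral_mono) auto
      finally have "ennreal ((q - p) * \<bar>Y i - i\<bar>) \<le> ennreal (LINT x|lborel. max 0 (?F x))"
        by (rule ennreal_leI)
      also have "\<dots> = (\<integral>\<^sup>+x. ennreal (max 0 (?F x)) \<partial>lborel)"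
        using F' by (intro nn_integral_eq_integral[symmetric]) auto
      also have "\<dots> = (\<integral>\<^sup>+x. h x * indicator ?I x \<partial>lborel)"
      proof (intro nn_integral_cong)
        fix x :: real
        have "x \<in> {- real n..real n}" if "x \<in> ?I" using Y(3)[OF i] that by force
        then show "ennreal (max 0 (?F x)) = h x * indicator ?I x"
          by (cases "x \<in> ?I") (simp_all add: h_def max_def ennreal_neg)
      qed
      also have "\<dots> = emeasure \<nu> ?I"
        unfolding \<nu>_def by (intro emeasure_density[symmetric]) auto
      finally show ?thesis by (simp add: cball_eq_segment mult.commute)
    qed
    have "emeasure lborel (\<Union>i\<in>C. cball (?a i) (5 * ?r i)) \<le> (\<integral>\<^sup>+i. emeasure lborel (cball (?a i) (5 * ?r i)) \<partial>count_space C)"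
      by (rule emeasure_UN_le_count_space[OF _ C(1)]) simp
    also have "\<dots> = (\<integral>\<^sup>+i. ennreal (5 / (q - p)) * ennreal (2 * ?r i * (q - p)) \<partial>count_space C)"
      using pq by (intro nn_integral_cong) (auto simp: cball_eq_atLeastAtMost ennreal_mult[symmetric])
    also have "\<dots> \<le> (\<integral>\<^sup>+i. ennreal (5 / (q - p)) * emeasure \<nu> (?B i) \<partial>count_space C)"
      by (intro nn_integral_mono mult_left_mono big) auto
    also have "\<dots> = ennreal (5 / (q - p)) * (\<integral>\<^sup>+i. emeasure \<nu> (?B i) \<partial>count_space C)"
      by (intro nn_integral_cmult) auto
    also have "(\<integral>\<^sup>+i. emeasure \<nu> (?B i) \<partial>count_space C) = emeasure \<nu> (\<Union>i\<in>C. ?B i)"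
      using C by (intro emeasure_UN_countable[symmetric]) (auto simp: disjoint_family_on_def pairwise_def disjnt_def)
    also have "\<dots> \<le> emeasure \<nu> U"
    proof (intro emeasure_mono UN_least)
      fix i assume "i \<in> C"
      then have "i \<in> ?En" using C(2) by blast
      from Y(3)[OF this] show "?B i \<subseteq> U" unfolding cball_eq_segment by blast
    qed (use U in simp)
    also have "\<dots> \<le> ennreal (e * (q - p) / 5)" using U by simp
    finally have fin: "emeasure lborel (\<Union>i\<in>C. cball (?a i) (5 * ?r i)) \<le> ennreal e"
      using e pq by (simp add: mult_left_mono ennreal_mult[symmetric])
    let ?T = "\<Union>i\<in>C. cball (?a i) (5 * ?r i)"
    have T: "?T \<in> sets borel" using C(1) by (intro sets.countable_UN') auto
    show "\<exists>T. ?En \<subseteq> T \<and> T \<in> lmeasurable \<and> measure lebesgue T \<le> e"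
    proof (intro exI[of _ ?T] conjI)
      show "?T \<in> lmeasurable" using fin T by (intro fmeasurableI) (auto intro: le_less_trans)
      show "measure lebesgue ?T \<le> e" using fin T e by (simp add: measure_def enn2real_leI)
    qed (use C in simp)
  qed
  then have "negligible (\<Union>n. ?E \<inter> {- real n<..<real n})"
    by (intro negligible_countable_Union) auto
  moreover have "(\<Union>n. ?E \<inter> {- real n<..<real n}) = ?E"
  proof (intro set_eqI iffI)
    fix x assume "x \<in> ?E"
    moreover obtain n :: nat where "\<bar>x\<bar> < real n" using reals_Archimedean2 by blast
    then have "x \<in> {- real n<..<real n}" by auto
    ultimately show "x \<in> (\<Union>n. ?E \<inter> {- real n<..<real n})" by blast
  qed blast
  ultimately show ?thesis by simp
qed

lemma seg_integral_uminus: "seg_integral (\<lambda>x. - f x) x y = - seg_integral f x y"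
  by (simp add: seg_integral_def set_lebesgue_integral_def)

text \<open>The upper bound for the limit superior follows from \<open>negligible_averages_above\<close> with rational \<open>p < q\<close> between
  \<open>f x\<close> and a given larger value; the lower bound is the upper bound for \<open>- f\<close>.\<close>

theorem lebesgue_differentiation:
  fixes f :: "real \<Rightarrow> real"
  assumes f: "integrable lborel f"
  shows "AE x in lborel. ((\<lambda>y. seg_integral f x y / \<bar>y - x\<bar>) \<longlongrightarrow> f x) (at x)"
proof -
  have one_sided: "AE x in lborel. \<forall>a > g x. \<forall>\<^sub>F y in at x. seg_integral g x y / \<bar>y - x\<bar> < a"
    if g: "integrable lborel g" for g
  proof -
    let ?E = "\<lambda>p q. {x. g x \<le> p \<and> (\<exists>\<^sub>F y in at x. q * \<bar>y - x\<bar> < seg_integral g x y)}"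
    have "AE x in lborel. p < q \<longrightarrow> x \<notin> ?E p q" for p q :: real
    proof (cases "p < q")
      case True
      then have "?E p q \<in> null_sets lebesgue"
        using negligible_averages_above[OF g True] by (simp add: negligible_iff_null_sets)
      from AE_not_in[OF this] show ?thesis by (simp add: AE_completion_iff)
    qed simp
    then have "AE x in lborel. \<forall>p\<in>\<rat>. \<forall>q\<in>\<rat>. p < q \<longrightarrow> x \<notin> ?E p q"
      by (intro AE_ball_countable'[OF _ countable_rat]) auto
    then show ?thesis
    proof eventually_elim
      case (elim x)
      show ?case
      proof (intro allI impI)
        fix a assume "g x < a"
        then obtain q where q: "q \<in> \<rat>" "g x < q" "q < a" using Rats_dense_in_real by blast
        then obtain p where p: "p \<in> \<rat>" "g x < p" "p < q" using Rats_dense_in_real by blast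
        have "\<not> (\<exists>\<^sub>F y in at x. q * \<bar>y - x\<bar> < seg_integral g x y)"
          using elim p q by auto
        then have "\<forall>\<^sub>F y in at x. seg_integral g x y \<le> q * \<bar>y - x\<bar>"
          by (simp add: not_frequently not_less)
        moreover have "\<forall>\<^sub>F y in at x. y \<noteq> x" by (simp add: eventually_at_filter)
        ultimately show "\<forall>\<^sub>F y in at x. seg_integral g x y / \<bar>y - x\<bar> < a"
        proof eventually_elim
          case (elim y)
          then have "seg_integral g x y / \<bar>y - x\<bar> \<le> q" by (simp add: divide_le_eq)
          with q show ?case by simp
        qed
      qed
    qed
  qed
  have "integrable lborel (\<lambda>x. - f x)" using f by simp
  from one_sided[OF f] one_sided[OF this] show ?thesis
  proof eventually_elim
    case (elim x)
    show ?case
    proof (rule order_tendstoI)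
      fix a assume "a < f x"
      then have "\<forall>\<^sub>F y in at x. seg_integral (\<lambda>x. - f x) x y / \<bar>y - x\<bar> < - a" using elim(2) by auto
      then show "\<forall>\<^sub>F y in at x. a < seg_integral f x y / \<bar>y - x\<bar>"
        by eventually_elim (simp add: seg_integral_uminus)
    next
      fix a assume "f x < a"
      then show "\<forall>\<^sub>F y in at x. seg_integral f x y / \<bar>y - x\<bar> < a" using elim(1) by auto
    qed
  qed
qed

section \<open>Densities of absolutely continuous functions\<close>

lemma set_integrable_lborel:
  assumes "integrable lborel f" "A \<in> sets borel"
  shows "set_integrable lborel A (f :: real \<Rightarrow> real)"
  unfolding set_integrable_def using assms by (intro integrable_mult_indicator) auto

lemma seg_integral_commute: "seg_integral f x y = seg_integral f y x"
  by (simp add: seg_integral_def min.commute max.commute)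

lemma seg_integral_eq: "x \<le> y \<Longrightarrow> seg_integral f x y = (LINT w:{x..y}|lborel. f w)"
  by (simp add: seg_integral_def)

lemma seg_integral_same [simp]: "seg_integral f t t = 0"
  unfolding seg_integral_def set_lebesgue_integral_def
  by (rule integral_eq_zero_AE, rule eventually_mono[OF AE_lborel_singleton[of t]]) (auto simp: indicator_def)

lemma integrable_indicator_mult:
  assumes "integrable lborel (f :: real \<Rightarrow> real)" "A \<in> sets borel"
  shows "integrable lborel (\<lambda>x. indicator A x * f x)"
  using set_integrable_lborel[OF assms] by (simp add: set_integrable_def)

lemma seg_integral_eq_measure:
  assumes g: "integrable lborel g" "\<And>x. 0 \<le> g x" and tu: "t \<le> u"
  shows "seg_integral g t u = measure (density lborel (\<lambda>x. ennreal (g x))) {t<..u}"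
proof -
  have "seg_integral g t u = (LINT w|lborel. indicator {t..u} w * g w)"
    using tu by (simp add: seg_integral_eq set_lebesgue_integral_def)
  also have "\<dots> = (LINT w|lborel. indicator {t<..u} w * g w)"
  proof (rule integral_cong_AE)
    show "AE w in lborel. indicator {t..u} w * g w = indicator {t<..u} w * g w"
      using AE_lborel_singleton[of t] by eventually_elim (auto simp: indicator_def)
  qed (use g in auto)
  finally have eq: "seg_integral g t u = (LINT w|lborel. indicator {t<..u} w * g w)" .
  have nn: "0 \<le> (LINT w|lborel. indicator {t<..u} w * g w)"
    by (rule integral_nonneg_AE) (simp add: g(2))
  have "integrable lborel (\<lambda>w. indicator {t<..u} w * g w)"
    using set_integrable_lborel[OF g(1), of "{t<..u}"] by (simp add: set_integrable_def)
  then have "ennreal (LINT w|lborel. indicator {t<..u} w * g w) = (\<integral>\<^sup>+w. ennreal (indicator {t<..u} w * g w) \<partial>lborel)"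
    by (rule nn_integral_eq_integral[symmetric]) (simp add: g(2))
  also have "\<dots> = (\<integral>\<^sup>+w. ennreal (g w) * indicator {t<..u} w \<partial>lborel)"
    by (intro nn_integral_cong) (simp add: indicator_def)
  also have "\<dots> = emeasure (density lborel (\<lambda>x. ennreal (g x))) {t<..u}"
    using g(1) by (intro emeasure_density[symmetric]) auto
  finally show ?thesis
    unfolding eq measure_def using nn by (metis enn2real_ennreal)
qed

lemma finite_borel_measure_density:
  assumes g: "integrable lborel g"
  shows "finite_borel_measure (density lborel (\<lambda>x. ennreal (g x)))"
proof -
  have "emeasure (density lborel (\<lambda>x. ennreal (g x))) UNIV \<le> (\<integral>\<^sup>+x. ennreal (norm (g x)) \<partial>lborel)"
    using g by (subst emeasure_density) (auto intro!: nn_integral_mono ennreal_leI)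
  also have "\<dots> < \<infinity>" using g by (simp add: integrable_iff_bounded)
  finally show ?thesis
    by (intro finite_borel_measure.intro finite_measureI) (auto simp: finite_borel_measure_axioms_def)
qed

lemma seg_integral_eq_cdf:
  assumes g: "integrable lborel g" "\<And>x. 0 \<le> g x" and tu: "t \<le> u"
  shows "seg_integral g t u = cdf (density lborel (\<lambda>x. ennreal (g x))) u - cdf (density lborel (\<lambda>x. ennreal (g x))) t"
proof -
  interpret finite_borel_measure "density lborel (\<lambda>x. ennreal (g x))"
    using g by (intro finite_borel_measure_density)
  show ?thesis
    using tu cdf_diff_eq[of t u] by (cases "t = u") (auto simp: seg_integral_eq_measure[OF g tu])
qed

lemma seg_integral_mono:
  assumes "integrable lborel f" "integrable lborel g" "AE x in lborel. f x \<le> g x"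
  shows "seg_integral f t u \<le> seg_integral g t u"
  unfolding seg_integral_def set_lebesgue_integral_def real_scaleR_def
proof (intro integral_mono_AE integrable_indicator_mult assms)
  show "AE x in lborel. indicator {min t u..max t u} x * f x \<le> indicator {min t u..max t u} x * g x"
    using assms(3) by eventually_elim (simp add: indicator_def)
qed auto

lemma seg_integral_mono_set:
  assumes "integrable lborel g" "\<And>x. 0 \<le> g x" "{min s r..max s r} \<subseteq> {min t u..max t u}"
  shows "seg_integral g s r \<le> seg_integral g t u"
  unfolding seg_integral_def set_lebesgue_integral_def real_scaleR_def
proof (intro integral_mono integrable_indicator_mult assms)
  fix x show "indicator {min s r..max s r} x * g x \<le> indicator {min t u..max t u} x * g x"
    using assms(2,3) by (auto simp: indicator_def)
qed auto

lemma abs_seg_integral_le: "integrable lborel f \<Longrightarrow> \<bar>seg_integral f t u\<bar> \<le> seg_integral (\<lambda>x. \<bar>f x\<bar>) t u"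
  using set_integral_norm_bound[OF set_integrable_lborel, of f "{min t u..max t u}"]
  by (simp add: seg_integral_def)

lemma seg_integral_right_small:
  assumes g: "integrable lborel g" "\<And>x. 0 \<le> g x" and "e > 0"
  shows "\<forall>\<^sub>F q in at_right t. seg_integral g t q < e"
proof -
  let ?D = "density lborel (\<lambda>x. ennreal (g x))"
  interpret finite_borel_measure ?D using g by (intro finite_borel_measure_density)
  have "((\<lambda>q. cdf ?D q - cdf ?D t) \<longlongrightarrow> cdf ?D t - cdf ?D t) (at_right t)"
    using cdf_is_right_cont[of t] by (intro tendsto_intros) (simp add: continuous_within)
  then have "\<forall>\<^sub>F q in at_right t. cdf ?D q - cdf ?D t < e"
    using \<open>e > 0\<close> by (intro order_tendstoD) auto
  moreover have "\<forall>\<^sub>F q in at_right t. t < q" by (simp add: eventually_at_filter)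
  ultimately show ?thesis
    by eventually_elim (simp add: seg_integral_eq_cdf[OF g])
qed

definition sum_measure :: "'a measure \<Rightarrow> 'a measure \<Rightarrow> 'a measure" where
  "sum_measure M N = measure_of (space M) (sets M) (\<lambda>A. emeasure M A + emeasure N A)"

lemma sets_sum_measure [simp]: "sets (sum_measure M N) = sets M"
  by (simp add: sum_measure_def)

lemma emeasure_sum_measure:
  assumes "sets N = sets M" "A \<in> sets M"
  shows "emeasure (sum_measure M N) A = emeasure M A + emeasure N A"
proof (rule emeasure_measure_of[OF sum_measure_def])
  show "countably_additive (sets (sum_measure M N)) (\<lambda>A. emeasure M A + emeasure N A)"
  proof (rule countably_additiveI)
    fix A :: "nat \<Rightarrow> _" assume A: "range A \<subseteq> sets (sum_measure M N)" "disjoint_family A"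
    then show "(\<Sum>i. emeasure M (A i) + emeasure N (A i)) = emeasure M (\<Union> (range A)) + emeasure N (\<Union> (range A))"
      using assms(1) by (simp add: suminf_add[symmetric] suminf_emeasure)
  qed
qed (use assms sets.sets_into_space in \<open>auto simp: positive_def\<close>)

text \<open>The two Stieltjes measures add up to the measure with density \<open>g\<close> on half-open intervals and thus on
  all Borel sets. So each of them is dominated by it. The sum is used because an equation between
  measures, unlike an inequality, extends at once from an intersection-stable generator.\<close>

lemma absolutely_continuous_interval_measure:
  assumes g: "integrable lborel g" "\<And>x. 0 \<le> g x"
    and F: "mono F" "\<And>a. continuous (at_right a) F"
    and H: "mono H" "\<And>a. continuous (at_right a) H"
    and sum: "\<And>t u. t \<le> u \<Longrightarrow> (F u - F t) + (H u - H t) = seg_integral g t u"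
  shows "absolutely_continuous lborel (interval_measure F)"
    and "emeasure (interval_measure F) UNIV < \<infinity>"
proof -
  let ?D = "density lborel (\<lambda>x. ennreal (g x))"
  interpret finite_borel_measure ?D using g by (intro finite_borel_measure_density)
  have eF: "emeasure (interval_measure F) {a<..b} = F b - F a" if "a \<le> b" for a b
    using F that by (intro emeasure_interval_measure_Ioc) (auto simp: mono_def)
  have eH: "emeasure (interval_measure H) {a<..b} = H b - H a" if "a \<le> b" for a b
    using H that by (intro emeasure_interval_measure_Ioc) (auto simp: mono_def)
  have "sum_measure (interval_measure F) (interval_measure H) = ?D"
  proof (rule measure_eqI_generator_eq[where \<Omega> = UNIV])
    fix X assume "X \<in> range (\<lambda>(a, b). {a<..b::real})"
    then obtain a b where X: "X = {a<..b}" by auto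
    show "emeasure (sum_measure (interval_measure F) (interval_measure H)) X = emeasure ?D X"
    proof (cases "a \<le> b")
      case True
      then have "0 \<le> F b - F a" "0 \<le> H b - H a" using F H by (auto simp: mono_def)
      then show ?thesis using True sum[OF True]
        by (simp add: X emeasure_sum_measure eF eH emeasure_eq_measure seg_integral_eq_measure[OF g True] flip: ennreal_plus)
    qed (simp add: X)
  next
    show "(\<Union>i. {- real (i::nat)<..real i}) = UNIV"
      by (rule UN_Ioc_eq_UNIV)
  next
    fix i :: nat
    have "emeasure (sum_measure (interval_measure F) (interval_measure H)) {- real i<..real i} = ennreal (F (real i) - F (- real i)) + ennreal (H (real i) - H (- real i))"
      by (simp add: emeasure_sum_measure eF eH)
    then show "emeasure (sum_measure (interval_measure F) (interval_measure H)) {- real i<..real i} \<noteq> \<infinity>" by simp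
  qed (auto simp: borel_sigma_sets_Ioc Int_stable_def)
  then have D: "emeasure (interval_measure F) A \<le> emeasure ?D A" if "A \<in> sets borel" for A
    using emeasure_sum_measure[of "interval_measure H" "interval_measure F" A] that by simp
  have "absolutely_continuous lborel ?D" using g(1) by (intro absolutely_continuousI_density) auto
  show "absolutely_continuous lborel (interval_measure F)"
    unfolding absolutely_continuous_def
  proof
    fix A :: "real set" assume A: "A \<in> null_sets lborel"
    with \<open>absolutely_continuous lborel ?D\<close> have "A \<in> null_sets ?D" by (auto simp: absolutely_continuous_def)
    with D[of A] A have "emeasure (interval_measure F) A = 0" by (simp add: null_sets_def)
    then show "A \<in> null_sets (interval_measure F)" using A by (simp add: null_sets_def)
  qed
  show "emeasure (interval_measure F) UNIV < \<infinity>"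
    by (rule le_less_trans[OF D]) (simp_all add: emeasure_eq_measure)
qed

text \<open>If \<open>G\<close> is a primitive of \<open>g\<close>, then \<open>G + \<phi>\<close> and \<open>G - \<phi>\<close> are both increasing and their Stieltjes measures
  add up to \<open>2 g dx\<close>. The Radon--Nikodym density of the first, minus \<open>g\<close>, is the density of \<open>\<phi>\<close>.\<close>

lemma ac_function_density:
  fixes \<phi> g :: "real \<Rightarrow> real"
  assumes g: "integrable lborel g" "\<And>x. 0 \<le> g x"
    and \<phi>: "\<And>t u. t \<le> u \<Longrightarrow> \<bar>\<phi> u - \<phi> t\<bar> \<le> seg_integral g t u"
  shows "\<exists>f. integrable lborel f \<and> (\<forall>t u. t \<le> u \<longrightarrow> \<phi> u - \<phi> t = seg_integral f t u)"
proof -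
  let ?D = "density lborel (\<lambda>x. ennreal (g x))"
  interpret finite_borel_measure ?D using g by (intro finite_borel_measure_density)
  define F where "F x = cdf ?D x + \<phi> x" for x
  define H where "H x = cdf ?D x - \<phi> x" for x
  have c: "continuous (at_right a) \<phi>" for a
    unfolding continuous_within
  proof (rule LIM_zero_cancel, rule Lim_null_comparison)
    show "\<forall>\<^sub>F x in at_right a. norm (\<phi> x - \<phi> a) \<le> cdf ?D x - cdf ?D a"
      unfolding eventually_at_filter using \<phi>[of a] by (auto intro!: always_eventually simp: seg_integral_eq_cdf[OF g])
    have "((\<lambda>q. cdf ?D q - cdf ?D a) \<longlongrightarrow> cdf ?D a - cdf ?D a) (at_right a)"
      using cdf_is_right_cont[of a] by (intro tendsto_intros) (simp add: continuous_within)
    then show "((\<lambda>q. cdf ?D q - cdf ?D a) \<longlongrightarrow> 0) (at_right a)" by simp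
  qed
  have incr: "\<bar>\<phi> y - \<phi> x\<bar> \<le> cdf ?D y - cdf ?D x" if "x \<le> y" for x y
    using \<phi>[OF that] seg_integral_eq_cdf[OF g that] by simp
  have "F x \<le> F y" "H x \<le> H y" if "x \<le> y" for x y
    using incr[OF that] by (simp_all add: F_def H_def abs_le_iff)
  then have mF: "mono F" and mH: "mono H" by (auto intro: monoI)
  have cF: "continuous (at_right a) F" for a
    unfolding F_def by (rule continuous_add[OF cdf_is_right_cont c])
  have cH: "continuous (at_right a) H" for a
    unfolding H_def by (rule continuous_diff[OF cdf_is_right_cont c])
  note F = mF cF and H = mH cH
  have g2: "integrable lborel (\<lambda>x. 2 * g x)" "\<And>x. 0 \<le> 2 * g x" using g by auto
  have sum2: "(F u - F t) + (H u - H t) = seg_integral (\<lambda>x. 2 * g x) t u" if "t \<le> u" for t u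
  proof -
    have "seg_integral (\<lambda>x. 2 * g x) t u = 2 * seg_integral g t u" by (simp add: seg_integral_def)
    then show ?thesis using that by (simp add: F_def H_def seg_integral_eq_cdf[OF g])
  qed
  have ac: "absolutely_continuous lborel (interval_measure F)" "emeasure (interval_measure F) UNIV < \<infinity>"
    by (rule absolutely_continuous_interval_measure[where g = "\<lambda>x. 2 * g x" and F = F and H = H];
        fact g2 F H sum2)+
  obtain f1 where f1: "f1 \<in> borel_measurable lborel" "density lborel f1 = interval_measure F"
  proof -
    have "\<exists>f\<in>borel_measurable lborel. density lborel f = interval_measure F"
    proof (rule sigma_finite_measure.Radon_Nikodym)
      show "sigma_finite_measure (lborel :: real measure)" by (rule sigma_finite_lborel)
      show "sets (interval_measure F) = sets lborel" by (simp only: sets_interval_measure sets_lborel)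
    qed (rule ac(1))
    then show ?thesis using that by blast
  qed
  have fin: "(\<integral>\<^sup>+x. f1 x \<partial>lborel) < \<infinity>"
  proof -
    have "emeasure (density lborel f1) UNIV < \<infinity>" using ac(2) f1(2) by simp
    then show ?thesis using f1(1) by (simp add: emeasure_density)
  qed
  then have ae: "AE x in lborel. f1 x \<noteq> \<infinity>" using f1 by (intro nn_integral_noteq_infinite) auto
  define h where "h x = enn2real (f1 x)" for x
  have h: "AE x in lborel. ennreal (h x) = f1 x" using ae by eventually_elim (simp add: h_def less_top)
  have [measurable]: "h \<in> borel_measurable lborel" using f1 unfolding h_def by measurable
  have "(\<integral>\<^sup>+x. ennreal (h x) \<partial>lborel) = (\<integral>\<^sup>+x. f1 x \<partial>lborel)" using h by (intro nn_integral_cong_AE) auto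
  with fin have hi: "integrable lborel h"
    by (intro integrableI_nonneg) (auto simp: h_def)
  have hD: "density lborel (\<lambda>x. ennreal (h x)) = interval_measure F"
    unfolding f1(2)[symmetric] using f1 h by (intro density_cong) auto
  have Fh: "F u - F t = seg_integral h t u" if "t \<le> u" for t u
  proof -
    have "seg_integral h t u = measure (interval_measure F) {t<..u}"
      unfolding hD[symmetric] by (rule seg_integral_eq_measure[OF hi _ that]) (simp add: h_def)
    also have "\<dots> = F u - F t" using F that by (intro measure_interval_measure_Ioc) (auto simp: mono_def)
    finally show ?thesis ..
  qed
  have diff: "seg_integral (\<lambda>x. h x - g x) t u = seg_integral h t u - seg_integral g t u" for t u
    unfolding seg_integral_def by (intro set_integral_diff(2) set_integrable_lborel hi g) auto
  have "\<phi> u - \<phi> t = seg_integral (\<lambda>x. h x - g x) t u" if "t \<le> u" for t u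
    unfolding diff Fh[OF that, symmetric] seg_integral_eq_cdf[OF g that] F_def by simp
  moreover have "integrable lborel (\<lambda>x. h x - g x)" using hi g(1) by (rule Bochner_Integration.integrable_diff)
  ultimately show ?thesis by blast
qed

section \<open>Metric speed of absolutely continuous curves\<close>

lemma ac_function_derivative:
  fixes \<phi> g :: "real \<Rightarrow> real"
  assumes g: "integrable lborel g" "\<And>x. 0 \<le> g x"
    and \<phi>: "\<And>t u. t \<le> u \<Longrightarrow> \<bar>\<phi> u - \<phi> t\<bar> \<le> seg_integral g t u"
  shows "\<exists>f. integrable lborel f \<and> (\<forall>t u. t \<le> u \<longrightarrow> \<phi> u - \<phi> t = seg_integral f t u) \<and>
    (AE x in lborel. (\<phi> has_real_derivative f x) (at x)) \<and> (AE x in lborel. \<bar>f x\<bar> \<le> g x)"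
proof -
  from ac_function_density[OF assms] obtain f where f: "integrable lborel f"
    and ftc: "\<And>t u. t \<le> u \<Longrightarrow> \<phi> u - \<phi> t = seg_integral f t u" by blast
  have quot: "(\<phi> y - \<phi> x) / (y - x) = seg_integral f x y / \<bar>y - x\<bar>" if "y \<noteq> x" for x y
  proof (cases "x \<le> y")
    case False
    then have "\<phi> y - \<phi> x = - seg_integral f x y" "\<bar>y - x\<bar> = - (y - x)"
      using ftc[of y x] by (auto simp: seg_integral_commute[of f y x])
    then show ?thesis by (simp add: minus_divide_right)
  qed (simp add: ftc)
  have *: "AE x in lborel. (\<phi> has_real_derivative f x) (at x)"
    using lebesgue_differentiation[OF f]
  proof eventually_elim
    case (elim x)
    have "((\<lambda>y. (\<phi> y - \<phi> x) / (y - x)) \<longlongrightarrow> f x) (at x)"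
      using elim by (rule Lim_transform_eventually) (auto simp: eventually_at_filter quot)
    then show ?case by (simp add: has_field_derivative_iff)
  qed
  moreover have "AE x in lborel. \<bar>f x\<bar> \<le> g x"
    using * lebesgue_differentiation[OF g(1)]
  proof eventually_elim
    case (elim x)
    have "((\<lambda>y. \<bar>(\<phi> y - \<phi> x) / (y - x)\<bar>) \<longlongrightarrow> \<bar>f x\<bar>) (at x)"
      using elim(1) by (intro tendsto_rabs) (simp add: has_field_derivative_iff)
    then show ?case
    proof (rule tendsto_le[OF _ elim(2), rotated])
      show "\<forall>\<^sub>F y in at x. \<bar>(\<phi> y - \<phi> x) / (y - x)\<bar> \<le> seg_integral g x y / \<bar>y - x\<bar>"
        unfolding eventually_at_filter
      proof (intro always_eventually allI impI)
        fix y assume "y \<noteq> x"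
        have "\<bar>\<phi> y - \<phi> x\<bar> \<le> seg_integral g x y"
          using \<phi>[of x y] \<phi>[of y x] by (cases "x \<le> y") (auto simp: seg_integral_commute[of g y x] abs_minus_commute)
        then show "\<bar>(\<phi> y - \<phi> x) / (y - x)\<bar> \<le> seg_integral g x y / \<bar>y - x\<bar>"
          by (simp add: abs_divide divide_right_mono)
      qed
    qed simp
  qed
  ultimately show ?thesis using f ftc by blast
qed

text \<open>A Lebesgue measurable bound agrees almost everywhere with a Borel function; with its absolute value,
  cut off outside \<open>[a, b]\<close>, all later integrals are over \<^const>\<open>lborel\<close>.\<close>

lemma ac_curve_dominated:
  assumes "ac_curve \<delta> a b c"
  shows "\<exists>g. integrable lborel g \<and> (\<forall>x. 0 \<le> g x) \<and>
    (\<forall>t u. a \<le> t \<and> t \<le> u \<and> u \<le> b \<longrightarrow> \<delta> (c t) (c u) \<le> seg_integral g t u)"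
proof -
  obtain g where g: "set_integrable lebesgue {a..b} g"
    and dom: "\<And>t u. a \<le> t \<Longrightarrow> t \<le> u \<Longrightarrow> u \<le> b \<Longrightarrow> \<delta> (c t) (c u) \<le> (LINT w:{t..u}|lebesgue. g w)"
    using assms unfolding ac_curve_def by blast
  define G where "G w = \<bar>indicator {a..b} w * g w\<bar>" for w
  have G: "integrable lebesgue G"
    using g unfolding G_def set_integrable_def by (auto intro!: integrable_abs)
  then obtain g1 where g1: "g1 \<in> borel_measurable lborel" "AE x in lborel. G x = g1 x"
    using completion_ex_borel_measurable_real[of G lborel] by auto
  define g0 where "g0 x = \<bar>g1 x\<bar>" for x
  have [measurable]: "g1 \<in> borel_measurable borel" "g0 \<in> borel_measurable borel" using g1 unfolding g0_def by auto
  have ae: "AE x in lebesgue. G x = g0 x"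
    using AE_completion[OF g1(2)] by eventually_elim (simp add: g0_def G_def)
  have "integrable lebesgue g0"
    using G ae by (subst integrable_cong_AE[of g0 lebesgue G]) (auto intro: measurable_completion)
  then have g0: "integrable lborel g0" by (simp add: integrable_completion)
  have "\<delta> (c t) (c u) \<le> seg_integral g0 t u" if tu: "a \<le> t" "t \<le> u" "u \<le> b" for t u
  proof -
    have "\<delta> (c t) (c u) \<le> (LINT w|lebesgue. indicator {t..u} w * g w)"
      using dom[OF tu] by (simp add: set_lebesgue_integral_def)
    also have "\<dots> \<le> (LINT w|lebesgue. indicator {t..u} w * G w)"
    proof (rule integral_mono)
      have "set_integrable lebesgue {t..u} g"
        using g tu by (auto intro: set_integrable_subset)
      then show "integrable lebesgue (\<lambda>w. indicator {t..u} w * g w)" by (simp add: set_integrable_def)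
      show "integrable lebesgue (\<lambda>w. indicator {t..u} w * G w)"
        using integrable_mult_indicator[of "{t..u}" lebesgue G] G by simp
    qed (use tu in \<open>auto simp: G_def indicator_def\<close>)
    also have "\<dots> = (LINT w|lebesgue. indicator {t..u} w * g0 w)"
    proof (rule integral_cong_AE)
      show "(\<lambda>w. indicator {t..u} w * G w) \<in> borel_measurable lebesgue"
        using integrable_mult_indicator[of "{t..u}" lebesgue G] G by auto
      show "(\<lambda>w. indicator {t..u} w * g0 w) \<in> borel_measurable lebesgue"
        by (rule measurable_completion) measurable
      show "AE w in lebesgue. indicator {t..u} w * G w = indicator {t..u} w * g0 w"
        using ae by eventually_elim simp
    qed
    also have "\<dots> = (LINT w|lborel. indicator {t..u} w * g0 w)"
      by (intro integral_completion) auto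
    also have "\<dots> = seg_integral g0 t u"
      using tu by (simp add: seg_integral_eq set_lebesgue_integral_def)
    finally show ?thesis .
  qed
  with g0 show ?thesis by (intro exI[of _ g0]) (auto simp: g0_def)
qed

abbreviation (input) clamp_to :: "real \<Rightarrow> real \<Rightarrow> real \<Rightarrow> real" where
  "clamp_to a b t \<equiv> max a (min b t)"

text \<open>The version of \<open>ac_function_derivative\<close> on an interval, obtained by extending \<open>\<phi>\<close> by constants to the left of \<open>a\<close> and
  to the right of \<open>b\<close>.\<close>

lemma clamped_function_derivative:
  fixes \<phi> :: "real \<Rightarrow> real"
  assumes g: "integrable lborel g" "\<And>x. 0 \<le> g x" and ab: "a \<le> b"
    and \<phi>: "\<And>t u. a \<le> t \<Longrightarrow> t \<le> u \<Longrightarrow> u \<le> b \<Longrightarrow> \<bar>\<phi> u - \<phi> t\<bar> \<le> seg_integral g t u"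
  shows "\<exists>f. integrable lborel f \<and> (\<forall>t u. a \<le> t \<and> t \<le> u \<and> u \<le> b \<longrightarrow> \<phi> u - \<phi> t = seg_integral f t u) \<and>
    (AE x in lborel. x \<in> {a<..<b} \<longrightarrow> (\<phi> has_real_derivative f x) (at x)) \<and> (AE x in lborel. \<bar>f x\<bar> \<le> g x)"
proof -
  let ?\<psi> = "\<lambda>t. \<phi> (clamp_to a b t)"
  have "\<bar>?\<psi> u - ?\<psi> t\<bar> \<le> seg_integral g t u" if "t \<le> u" for t u
  proof (cases "u < a \<or> b < t")
    case True
    then have "?\<psi> u = ?\<psi> t" using that ab by (auto simp: min_def max_def)
    then show ?thesis
      using g(2) by (simp add: seg_integral_def set_lebesgue_integral_def integral_nonneg_AE)
  next
    case False
    have "\<bar>?\<psi> u - ?\<psi> t\<bar> \<le> seg_integral g (clamp_to a b t) (clamp_to a b u)"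
      using that ab by (intro \<phi>) auto
    also have "\<dots> \<le> seg_integral g t u"
      using that ab False by (intro seg_integral_mono_set g) auto
    finally show ?thesis .
  qed
  from ac_function_derivative[OF g this] obtain f where f: "integrable lborel f"
    and ftc: "\<And>t u. t \<le> u \<Longrightarrow> ?\<psi> u - ?\<psi> t = seg_integral f t u"
    and d: "AE x in lborel. (?\<psi> has_real_derivative f x) (at x)" and b: "AE x in lborel. \<bar>f x\<bar> \<le> g x"
    by blast
  have "AE x in lborel. x \<in> {a<..<b} \<longrightarrow> (\<phi> has_real_derivative f x) (at x)"
    using d
  proof eventually_elim
    case (elim x)
    show ?case
    proof
      assume x: "x \<in> {a<..<b}"
      show "(\<phi> has_real_derivative f x) (at x)"
        by (rule has_field_derivative_transform_within_open[OF elim, of "{a<..<b}"]) (use x in auto)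
    qed
  qed
  moreover have "\<phi> u - \<phi> t = seg_integral f t u" if "a \<le> t" "t \<le> u" "u \<le> b" for t u
    using ftc[of t u] that by simp
  ultimately show ?thesis using f b by blast
qed

text \<open>For a dense sequence \<open>q\<close> of parameters let \<open>v\<close> be the supremum of the absolute derivatives of the real
  functions \<open>t \<mapsto> \<delta> (c t) (c (q n))\<close>. Each of them is \<open>1\<close>-Lipschitz in \<open>c t\<close>, so difference quotients of
  \<open>c\<close> are asymptotically at least \<open>v\<close>. Conversely \<open>\<delta> (c t) (c u)\<close> is the supremum of the increments of these
  functions and therefore at most the integral of \<open>v\<close>; at Lebesgue points of \<open>v\<close> this is the
  opposite bound.\<close>

theorem metric_derivative:
  assumes M: "Metric_space UNIV \<delta>" and ac: "ac_curve \<delta> a b c" and ab: "a < b"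
  obtains v where "integrable lborel v" "\<And>x. 0 \<le> v x"
    "AE t in lborel. t \<in> {a<..<b} \<longrightarrow> ((\<lambda>w. \<delta> (c w) (c t) / \<bar>w - t\<bar>) \<longlongrightarrow> v t) (at t)"
    "\<And>t u. a \<le> t \<Longrightarrow> t \<le> u \<Longrightarrow> u \<le> b \<Longrightarrow> \<delta> (c t) (c u) \<le> seg_integral v t u"
proof -
  interpret Metric_space UNIV \<delta> by fact
  obtain g where g: "integrable lborel g" "\<And>x. 0 \<le> g x"
    and dom: "\<And>t u. a \<le> t \<Longrightarrow> t \<le> u \<Longrightarrow> u \<le> b \<Longrightarrow> \<delta> (c t) (c u) \<le> seg_integral g t u"
    using ac_curve_dominated[OF ac] by blast
  let ?Q = "insert a ({a..b} \<inter> \<rat>)"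
  define q where "q = from_nat_into ?Q"
  have q: "range q = ?Q" unfolding q_def by (intro range_from_nat_into) (auto intro: countable_rat)
  have qab: "q n \<in> {a..b}" for n
  proof -
    have "q n \<in> ?Q" unfolding q[symmetric] by simp
    then show ?thesis using ab by auto
  qed
  have tri: "\<bar>\<delta> x z - \<delta> y z\<bar> \<le> \<delta> x y" for x y z
    using triangle[of x y z, OF UNIV_I UNIV_I UNIV_I] triangle[of y x z, OF UNIV_I UNIV_I UNIV_I] commute[of x y]
    by linarith
  define P where "P n f \<longleftrightarrow> integrable lborel f \<and>
    (\<forall>t u. a \<le> t \<and> t \<le> u \<and> u \<le> b \<longrightarrow> \<delta> (c u) (c (q n)) - \<delta> (c t) (c (q n)) = seg_integral f t u) \<and>
    (AE x in lborel. x \<in> {a<..<b} \<longrightarrow> ((\<lambda>t. \<delta> (c t) (c (q n))) has_real_derivative f x) (at x)) \<and>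
    (AE x in lborel. \<bar>f x\<bar> \<le> g x)" for n f
  have "\<exists>f. P n f" for n
    unfolding P_def
  proof (rule clamped_function_derivative[OF g])
    fix t u assume tu: "a \<le> t" "t \<le> u" "u \<le> b"
    show "\<bar>\<delta> (c u) (c (q n)) - \<delta> (c t) (c (q n))\<bar> \<le> seg_integral g t u"
      using dom[OF tu] tri[of "c u" "c (q n)" "c t"] by (simp add: commute[of "c u" "c t"])
  qed (use ab in auto)
  then obtain f where P: "\<And>n. P n (f n)" by metis
  have f: "\<And>n. integrable lborel (f n)"
    and ftc: "\<And>n t u. a \<le> t \<Longrightarrow> t \<le> u \<Longrightarrow> u \<le> b \<Longrightarrow> \<delta> (c u) (c (q n)) - \<delta> (c t) (c (q n)) = seg_integral (f n) t u"
    and deriv: "\<And>n. AE x in lborel. x \<in> {a<..<b} \<longrightarrow> ((\<lambda>t. \<delta> (c t) (c (q n))) has_real_derivative f n x) (at x)"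
    and fg: "\<And>n. AE x in lborel. \<bar>f n x\<bar> \<le> g x"
    using P unfolding P_def by blast+
  \<comment> \<open>cutting off at \<open>g\<close> changes nothing almost everywhere and makes the supremum finite everywhere\<close>
  define v where "v x = (SUP n. min \<bar>f n x\<bar> (g x))" for x
  have bdd: "bdd_above (range (\<lambda>n. min \<bar>f n x\<bar> (g x)))" for x by (rule bdd_aboveI[of _ "g x"]) auto
  have vg: "v x \<le> g x" for x unfolding v_def by (intro cSUP_least) auto
  have fv: "min \<bar>f n x\<bar> (g x) \<le> v x" for n x unfolding v_def by (intro cSUP_upper bdd) auto
  have v0: "0 \<le> v x" for x using fv[of 0 x] g(2)[of x] by simp
  have [measurable]: "f n \<in> borel_measurable borel" "g \<in> borel_measurable borel" for n using f[of n] g by auto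
  have [measurable]: "v \<in> borel_measurable borel"
    unfolding v_def by (intro borel_measurable_cSUP bdd) auto
  have v: "integrable lborel v"
    by (rule Bochner_Integration.integrable_bound[OF g(1)]) (use vg v0 g in auto)
  have lip: "\<bar>\<delta> (c u) (c (q n)) - \<delta> (c t) (c (q n))\<bar> \<le> seg_integral v t u" if tu: "a \<le> t" "t \<le> u" "u \<le> b" for n t u
  proof -
    have "\<bar>seg_integral (f n) t u\<bar> \<le> seg_integral (\<lambda>x. \<bar>f n x\<bar>) t u" using f by (rule abs_seg_integral_le)
    also have "\<dots> \<le> seg_integral v t u"
    proof (rule seg_integral_mono)
      show "AE x in lborel. \<bar>f n x\<bar> \<le> v x"
        using fg[of n]
      proof eventually_elim
        case (elim x)
        then show ?case using fv[of n x] by (simp add: min_def)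
      qed
    qed (use f v in auto)
    finally show ?thesis by (simp add: ftc[OF tu])
  qed
  have ineq: "\<delta> (c t) (c u) \<le> seg_integral v t u" if tu: "a \<le> t" "t \<le> u" "u \<le> b" for t u
  proof (cases "t = u")
    case True
    then show ?thesis
      using v0 by (simp add: seg_integral_def set_lebesgue_integral_def integral_nonneg_AE)
  next
    case False
    \<comment> \<open>the second point of the pair is compared with \<open>c r\<close> for a rational \<open>r\<close> slightly to the right of \<open>t\<close>\<close>
    show ?thesis
    proof (rule field_le_epsilon)
      fix e :: real assume e: "e > 0"
      have "\<forall>\<^sub>F s in at_right t. seg_integral g t s < e / 2"
        using e by (intro seg_integral_right_small g) auto
      moreover have "\<forall>\<^sub>F s in at_right t. t < s \<and> s < u"
        using False tu by (intro eventually_at_rightI[of t u]) auto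
      ultimately have "\<forall>\<^sub>F s in at_right t. seg_integral g t s < e / 2 \<and> t < s \<and> s < u"
        by eventually_elim simp
      then obtain s where s: "seg_integral g t s < e / 2" "t < s" "s < u"
        using eventually_happens'[OF trivial_limit_at_right_real] by blast
      obtain r where r: "r \<in> \<rat>" "t < r" "r < s" using Rats_dense_in_real[OF s(2)] by blast
      then have "r \<in> range q" using q tu s by auto
      then obtain n where n: "r = q n" by blast
      have "\<delta> (c t) (c r) \<le> seg_integral g t r" using r s tu by (intro dom) auto
      also have "\<dots> \<le> seg_integral g t s" using r by (intro seg_integral_mono_set g) auto
      finally have "\<delta> (c t) (c r) < e / 2" using s by simp
      moreover have "\<delta> (c t) (c u) \<le> \<delta> (c u) (c r) + \<delta> (c t) (c r)"
        using triangle[of "c t" "c r" "c u"] by (simp add: commute[of "c u" "c r"])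
      moreover have "\<bar>\<delta> (c u) (c r) - \<delta> (c t) (c r)\<bar> \<le> seg_integral v t u"
        using lip[OF tu, of n] n by simp
      ultimately show "\<delta> (c t) (c u) \<le> seg_integral v t u + e" by linarith
    qed
  qed
  have "AE x in lborel. \<forall>n. x \<in> {a<..<b} \<longrightarrow> ((\<lambda>t. \<delta> (c t) (c (q n))) has_real_derivative f n x) (at x)"
    unfolding AE_all_countable using deriv by blast
  moreover have "AE x in lborel. \<forall>n. \<bar>f n x\<bar> \<le> g x" unfolding AE_all_countable using fg by blast
  ultimately have "AE t in lborel. t \<in> {a<..<b} \<longrightarrow> ((\<lambda>w. \<delta> (c w) (c t) / \<bar>w - t\<bar>) \<longlongrightarrow> v t) (at t)"
    using lebesgue_differentiation[OF v]
  proof eventually_elim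
    case (elim t)
    show ?case
    proof
      assume t: "t \<in> {a<..<b}"
      have nb: "\<forall>\<^sub>F w in at t. w \<in> {a<..<b} \<and> w \<noteq> t"
      proof (rule eventually_conj)
        show "\<forall>\<^sub>F w in at t. w \<in> {a<..<b}" using t by (intro eventually_at_in_open') auto
      qed (simp add: eventually_at_filter)
      show "((\<lambda>w. \<delta> (c w) (c t) / \<bar>w - t\<bar>) \<longlongrightarrow> v t) (at t)"
      proof (rule order_tendstoI)
        fix x assume "v t < x"
        then have "\<forall>\<^sub>F w in at t. seg_integral v t w / \<bar>w - t\<bar> < x" using elim(3) by (intro order_tendstoD)
        with nb show "\<forall>\<^sub>F w in at t. \<delta> (c w) (c t) / \<bar>w - t\<bar> < x"
        proof eventually_elim
          case (elim w)
          have "\<delta> (c w) (c t) \<le> seg_integral v t w"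
            using ineq[of t w] ineq[of w t] elim t
            by (cases "t \<le> w") (auto simp: commute[of "c w" "c t"] seg_integral_commute[of v w t])
          then have "\<delta> (c w) (c t) / \<bar>w - t\<bar> \<le> seg_integral v t w / \<bar>w - t\<bar>" by (intro divide_right_mono) auto
          with elim show ?case by simp
        qed
      next
        fix x assume "x < v t"
        then obtain n where n: "x < min \<bar>f n t\<bar> (g t)" unfolding v_def using less_cSUP_iff[OF _ bdd] by auto
        have "((\<lambda>w. \<bar>(\<delta> (c w) (c (q n)) - \<delta> (c t) (c (q n))) / (w - t)\<bar>) \<longlongrightarrow> \<bar>f n t\<bar>) (at t)"
          using elim(1) t by (intro tendsto_rabs) (simp add: has_field_derivative_iff)
        then have "\<forall>\<^sub>F w in at t. x < \<bar>(\<delta> (c w) (c (q n)) - \<delta> (c t) (c (q n))) / (w - t)\<bar>"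
          using n by (intro order_tendstoD) auto
        then show "\<forall>\<^sub>F w in at t. x < \<delta> (c w) (c t) / \<bar>w - t\<bar>"
        proof eventually_elim
          case (elim w)
          have "\<bar>(\<delta> (c w) (c (q n)) - \<delta> (c t) (c (q n))) / (w - t)\<bar> \<le> \<delta> (c w) (c t) / \<bar>w - t\<bar>"
            using tri[of "c w" "c (q n)" "c t"] by (simp add: abs_divide divide_right_mono)
          with elim show ?case by simp
        qed
      qed
    qed
  qed
  from that[OF v v0 this ineq] show ?thesis .
qed

section \<open>Length of causal curves\<close>

text \<open>The nonnegative integral of an arbitrary function is its lower integral; here the supremum over
  simple functions is realised by one measurable minorant.\<close>

lemma nn_integral_attained:
  "\<exists>g\<in>borel_measurable M. (\<forall>x. g x \<le> f x) \<and> integral\<^sup>N M g = integral\<^sup>N M f"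
proof -
  let ?S = "{g. simple_function M g \<and> g \<le> f}"
  have "(\<lambda>x. 0) \<in> ?S" by (auto simp: le_fun_def)
  then have "?S \<noteq> {}" by blast
  from ennreal_Sup_countable_SUP[of "integral\<^sup>S M ` ?S"] this
  obtain F :: "nat \<Rightarrow> ennreal" where F: "range F \<subseteq> integral\<^sup>S M ` ?S" "Sup (integral\<^sup>S M ` ?S) = (SUP i. F i)"
    by auto
  then have "\<forall>i. \<exists>g. g \<in> ?S \<and> F i = integral\<^sup>S M g" by blast
  then obtain g where g: "\<And>i. g i \<in> ?S" "\<And>i. F i = integral\<^sup>S M (g i)" by metis
  define G where "G x = (SUP i. g i x)" for x
  have sf: "simple_function M (g i)" for i using g(1)[of i] by simp
  have [measurable]: "g i \<in> borel_measurable M" for i by (rule borel_measurable_simple_function[OF sf])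
  have G: "G \<in> borel_measurable M" unfolding G_def by measurable
  have le: "G x \<le> f x" for x unfolding G_def using g(1) by (intro SUP_least) (auto simp: le_fun_def)
  have "integral\<^sup>N M f = (SUP i. F i)" using F(2) by (simp add: nn_integral_def)
  also have "\<dots> \<le> integral\<^sup>N M G"
  proof (rule SUP_least)
    fix i
    have "F i = integral\<^sup>N M (g i)" using g(2) nn_integral_eq_simple_integral[OF sf] by simp
    also have "\<dots> \<le> integral\<^sup>N M G" unfolding G_def by (intro nn_integral_mono SUP_upper) simp
    finally show "F i \<le> integral\<^sup>N M G" .
  qed
  finally have "integral\<^sup>N M G = integral\<^sup>N M f"
    using le by (intro antisym[OF nn_integral_mono]) auto
  with G le show ?thesis by blast
qed

text \<open>Measurability of \<open>f\<close> is not at hand in the applications: \<open>f\<close> is the length integrand of a causal curve or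
  the length as a function of the curve, both built on the limit superior of uncountably many quotients.\<close>

lemma nn_integral_eq_imp_AE_eq:
  assumes h: "h \<in> borel_measurable M" and le: "AE x in M. f x \<le> h x"
    and fin: "integral\<^sup>N M h < \<infinity>" and eq: "integral\<^sup>N M h \<le> integral\<^sup>N M f"
  shows "AE x in M. f x = h x"
proof -
  obtain g where g: "g \<in> borel_measurable M" "\<And>x. g x \<le> f x" "integral\<^sup>N M g = integral\<^sup>N M f"
    using nn_integral_attained[of M f] by blast
  have gh: "AE x in M. g x \<le> h x" using le by eventually_elim (use g(2) order_trans in blast)
  have "integral\<^sup>N M g \<le> integral\<^sup>N M h" using gh by (rule nn_integral_mono_AE)
  then have "integral\<^sup>N M g = integral\<^sup>N M h" using eq g(3) by simp
  moreover have "(\<integral>\<^sup>+x. h x - g x \<partial>M) = integral\<^sup>N M h - integral\<^sup>N M g"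
    using h g fin gh calculation by (intro nn_integral_diff) auto
  ultimately have "(\<integral>\<^sup>+x. h x - g x \<partial>M) = 0" using fin by simp
  then have "AE x in M. h x - g x = 0" using h g by (subst (asm) nn_integral_0_iff_AE) auto
  with gh le show ?thesis
  proof eventually_elim
    case (elim x)
    then have "h x \<le> g x" by (simp add: ennreal_minus_eq_0)
    also have "g x \<le> f x" by (rule g(2))
    finally show ?case using elim(2) by simp
  qed
qed

lemma lebesgue_measurable_AE_eq:
  assumes f: "f \<in> borel_measurable lebesgue" and ae: "AE x in lebesgue. f x = (g x :: real)"
  shows "g \<in> borel_measurable (lebesgue :: real measure)"
proof (rule measurableI)
  fix A :: "real set" assume A: "A \<in> sets borel"
  have "AE x in lebesgue. x \<in> f -` A \<longleftrightarrow> x \<in> g -` A" using ae by eventually_elim simp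
  then have "g -` A \<in> sets lebesgue"
  proof (rule completion.in_sets_AE)
    show "f -` A \<in> sets lebesgue" using measurable_sets[OF f A] by simp
  qed simp
  then show "g -` A \<inter> space lebesgue \<in> sets lebesgue" by simp
qed simp

lemma metric_speed_eq:
  assumes "((\<lambda>w. \<delta> (c w) (c t) / \<bar>w - t\<bar>) \<longlongrightarrow> v) (at t)" "t \<in> {a<..<b}"
  shows "metric_speed \<delta> a b c t = v"
proof -
  have "at t within {a..b} = at t" using assms(2) by (simp add: at_within_Icc_at)
  then show ?thesis unfolding metric_speed_def using assms(1) by (simp add: tendsto_Lim)
qed

text \<open>The difference quotient in the definition of \<^const>\<open>vel\<close> in terms of the metric derivative, which agrees
  with \<^const>\<open>metric_speed\<close> almost everywhere. For \<open>h < 0\<close> the two signs cancel.\<close>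

lemma interval_integral_metric_speed:
  assumes v: "integrable lborel v"
    and lim: "AE t in lborel. t \<in> {a<..<b} \<longrightarrow> ((\<lambda>w. \<delta> (c w) (c t) / \<bar>w - t\<bar>) \<longlongrightarrow> v t) (at t)"
    and t: "t \<in> {a<..<b}" "t + h \<in> {a<..<b}"
  shows "1 / h * (LINT u=ereal t..ereal (t + h)|lebesgue. metric_speed \<delta> a b c u) = seg_integral v t (t + h) / \<bar>h\<bar>"
proof -
  have main: "(LINT u:einterval (ereal x) (ereal y)|lebesgue. metric_speed \<delta> a b c u) = seg_integral v x y"
    if xy: "x \<le> y" "x \<in> {a<..<b}" "y \<in> {a<..<b}" for x y
  proof -
    have [measurable]: "v \<in> borel_measurable borel" using v by auto
    have ei: "einterval (ereal x) (ereal y) = {x<..<y}" by (auto simp: einterval_def)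
    have 0: "AE u in lebesgue. indicator {x..y} u * v u = indicator {x<..<y} u * metric_speed \<delta> a b c u"
      using AE_completion[OF lim] AE_completion[OF AE_lborel_singleton[of x]] AE_completion[OF AE_lborel_singleton[of y]]
    proof eventually_elim
      case (elim u)
      then show ?case using xy metric_speed_eq[of \<delta> c u "v u" a b] by (auto simp: indicator_def)
    qed
    have m1: "(\<lambda>u. indicator {x..y} u * v u) \<in> borel_measurable lebesgue"
      by (intro measurable_completion) measurable
    have "(LINT u:einterval (ereal x) (ereal y)|lebesgue. metric_speed \<delta> a b c u) =
      (LINT u|lebesgue. indicator {x<..<y} u * metric_speed \<delta> a b c u)"
      by (simp add: set_lebesgue_integral_def ei)
    also have "\<dots> = (LINT u|lebesgue. indicator {x..y} u * v u)"
      by (rule integral_cong_AE[symmetric, OF m1 lebesgue_measurable_AE_eq[OF m1 0] 0])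
    also have "\<dots> = (LINT u|lborel. indicator {x..y} u * v u)"
      by (rule integral_completion) measurable
    also have "\<dots> = seg_integral v x y" using xy by (simp add: seg_integral_eq set_lebesgue_integral_def)
    finally show ?thesis .
  qed
  show ?thesis
  proof (cases "0 \<le> h")
    case True
    then show ?thesis using main[of t "t + h"] t by (simp add: interval_lebesgue_integral_def)
  next
    case False
    then show ?thesis using main[of "t + h" t] t
      by (simp add: interval_lebesgue_integral_def seg_integral_commute[of v "t + h" t])
  qed
qed

lemma ac_curve_real_derivative:
  fixes \<alpha> :: "real \<Rightarrow> real"
  assumes "ac_curve dist a b \<alpha>" "a \<le> b"
  shows "\<exists>f. integrable lborel f \<and> (\<forall>t u. a \<le> t \<and> t \<le> u \<and> u \<le> b \<longrightarrow> \<alpha> u - \<alpha> t = seg_integral f t u) \<and>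
    (AE x in lborel. x \<in> {a<..<b} \<longrightarrow> (\<alpha> has_real_derivative f x) (at x))"
proof -
  from ac_curve_dominated[OF assms(1)] obtain g where
    G: "integrable lborel g \<and> (\<forall>x. 0 \<le> g x) \<and> (\<forall>t u. a \<le> t \<and> t \<le> u \<and> u \<le> b \<longrightarrow> dist (\<alpha> t) (\<alpha> u) \<le> seg_integral g t u)"
    by (rule exE)
  then have g: "integrable lborel g" "\<And>x. 0 \<le> g x" by simp_all
  have dom: "dist (\<alpha> t) (\<alpha> u) \<le> seg_integral g t u" if "a \<le> t" "t \<le> u" "u \<le> b" for t u
    using G that by simp
  have "\<bar>\<alpha> u - \<alpha> t\<bar> \<le> seg_integral g t u" if "a \<le> t" "t \<le> u" "u \<le> b" for t u
    using dom[OF that] by (simp add: dist_real_def abs_minus_commute)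
  from clamped_function_derivative[OF g assms(2) this] show ?thesis by blast
qed

lemma seg_integral_eq_nn_integral:
  assumes f: "integrable lborel f" and nn: "AE x in lborel. x \<in> {a<..<b} \<longrightarrow> 0 \<le> f x" and ab: "a \<le> b"
  shows "(\<integral>\<^sup>+x. ennreal (f x) * indicator {a..b} x \<partial>lborel) = ennreal (seg_integral f a b)"
    and "0 \<le> seg_integral f a b"
proof -
  have nn': "AE x in lborel. 0 \<le> indicator {a..b} x * f x"
    using nn AE_lborel_singleton[of a] AE_lborel_singleton[of b]
    by eventually_elim (auto simp: indicator_def)
  have "(\<integral>\<^sup>+x. ennreal (f x) * indicator {a..b} x \<partial>lborel) = (\<integral>\<^sup>+x. ennreal (indicator {a..b} x * f x) \<partial>lborel)"
    by (intro nn_integral_cong) (simp add: indicator_def)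
  also have "\<dots> = ennreal (LINT x|lborel. indicator {a..b} x * f x)"
    by (intro nn_integral_eq_integral integrable_indicator_mult f nn') auto
  finally show "(\<integral>\<^sup>+x. ennreal (f x) * indicator {a..b} x \<partial>lborel) = ennreal (seg_integral f a b)"
    using ab by (simp add: seg_integral_eq set_lebesgue_integral_def)
  show "0 \<le> seg_integral f a b"
    using integral_nonneg_AE[OF nn'] ab by (simp add: seg_integral_eq set_lebesgue_integral_def)
qed

lemma causal_curve_time_density:
  assumes "causal_curve d a b \<gamma>"
  shows "\<exists>f. integrable lborel f \<and>
    (AE t in lborel. t \<in> {a<..<b} \<longrightarrow> deriv (fst \<circ> \<gamma>) t = f t \<and> 0 < f t) \<and>
    (\<integral>\<^sup>+t. ennreal (f t) * indicator {a..b} t \<partial>lborel) = ennreal (fst (\<gamma> b) - fst (\<gamma> a)) \<and>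
    fst (\<gamma> a) \<le> fst (\<gamma> b)"
proof -
  have ab: "a \<le> b" and ac: "ac_curve dist a b (fst \<circ> \<gamma>)"
    and pos: "AE t in lborel. t \<in> {a..b} \<longrightarrow> deriv (fst \<circ> \<gamma>) t > 0"
    using assms by (auto simp: causal_curve_def ac_product_curve_def elim: eventually_mono)
  obtain f where f: "integrable lborel f"
    and ftc: "\<And>t u. a \<le> t \<Longrightarrow> t \<le> u \<Longrightarrow> u \<le> b \<Longrightarrow> (fst \<circ> \<gamma>) u - (fst \<circ> \<gamma>) t = seg_integral f t u"
    and d: "AE x in lborel. x \<in> {a<..<b} \<longrightarrow> ((fst \<circ> \<gamma>) has_real_derivative f x) (at x)"
    using ac_curve_real_derivative[OF ac ab] by blast
  have *: "AE t in lborel. t \<in> {a<..<b} \<longrightarrow> deriv (fst \<circ> \<gamma>) t = f t \<and> 0 < f t"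
    using d pos
  proof eventually_elim
    case (elim t)
    then show ?case using DERIV_imp_deriv[of "fst \<circ> \<gamma>" "f t" t] by auto
  qed
  then have "AE t in lborel. t \<in> {a<..<b} \<longrightarrow> 0 \<le> f t" by eventually_elim auto
  note seg_integral_eq_nn_integral[OF f this ab]
  then show ?thesis using f * ftc[of a b] ab by (intro exI[of _ f]) auto
qed

text \<open>A root of \<open>f\<^sup>2 - r\<^sup>2\<close> never exceeds \<open>f \<ge> 0\<close>. So the length integrand is at most \<open>\<alpha>'\<close> for
  every value of the velocity.\<close>

lemma causal_length_le_density:
  assumes f: "AE t in lborel. t \<in> {a<..<b} \<longrightarrow> deriv (fst \<circ> \<gamma>) t = f t \<and> 0 < f t"
  shows "AE t in lborel. ennreal (sqrt ((deriv (fst \<circ> \<gamma>) t)\<^sup>2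
        - (real_of_ereal (vel d a b (snd \<circ> \<gamma>) (fst (\<gamma> t)) t))\<^sup>2)) * indicator {a..b} t \<le> ennreal (f t) * indicator {a..b} t"
  using f AE_lborel_singleton[of a] AE_lborel_singleton[of b]
proof eventually_elim
  case (elim t)
  show ?case
  proof (cases "t \<in> {a<..<b}")
    case True
    then have ft: "deriv (fst \<circ> \<gamma>) t = f t" "0 < f t" using elim by auto
    have "sqrt ((f t)\<^sup>2 - r\<^sup>2) \<le> f t" for r using ft(2) by (intro real_le_lsqrt) auto
    then show ?thesis unfolding ft(1) by (intro mult_right_mono ennreal_leI) auto
  next
    case False
    then have "t \<notin> {a..b}" using elim by auto
    then show ?thesis by simp
  qed
qed

lemma causal_length_le:
  assumes "causal_curve d a b \<gamma>"
  shows "causal_length d a b \<gamma> \<le> ennreal (fst (\<gamma> b) - fst (\<gamma> a))" and "fst (\<gamma> a) \<le> fst (\<gamma> b)"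
proof -
  obtain f where f: "integrable lborel f" "AE t in lborel. t \<in> {a<..<b} \<longrightarrow> deriv (fst \<circ> \<gamma>) t = f t \<and> 0 < f t"
    "(\<integral>\<^sup>+t. ennreal (f t) * indicator {a..b} t \<partial>lborel) = ennreal (fst (\<gamma> b) - fst (\<gamma> a))"
    "fst (\<gamma> a) \<le> fst (\<gamma> b)"
    using causal_curve_time_density[OF assms] by blast
  show "fst (\<gamma> a) \<le> fst (\<gamma> b)" by (rule f(4))
  show "causal_length d a b \<gamma> \<le> ennreal (fst (\<gamma> b) - fst (\<gamma> a))"
    unfolding causal_length_def f(3)[symmetric] nn_integral_completion
    by (rule nn_integral_mono_AE[OF causal_length_le_density[OF f(2)]])
qed

text \<open>Elapsed time bounds the length of every causal curve, in analogy with proper time in special relativity.\<close>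

lemma time_sep_le: "time_sep d x y \<le> ennreal (fst y - fst x)"
  unfolding time_sep_def by (rule Sup_least) (auto intro: causal_length_le(1))

lemma causal_le_fst: "causal_le d x y \<Longrightarrow> fst x \<le> fst y"
  unfolding causal_le_def using causal_length_le(2) by fastforce

text \<open>If the length integrand has the same integral as its upper bound \<open>\<alpha>'\<close>, then they agree almost
  everywhere and the real part of the velocity vanishes. Causality excludes the value \<open>\<infinity>\<close>, while \<open>- \<infinity>\<close>
  also has real part \<open>0\<close>, whence the inequality in the conclusion.\<close>

lemma causal_length_eq_imp_vel_le_0:
  assumes c: "causal_curve d a b \<gamma>" and L: "causal_length d a b \<gamma> = ennreal (fst (\<gamma> b) - fst (\<gamma> a))"
  shows "AE t in lborel. t \<in> {a<..<b} \<longrightarrow> vel d a b (snd \<circ> \<gamma>) (fst (\<gamma> t)) t \<le> 0"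
proof -
  let ?v = "\<lambda>t. vel d a b (snd \<circ> \<gamma>) (fst (\<gamma> t)) t"
  obtain f where f: "integrable lborel f" "AE t in lborel. t \<in> {a<..<b} \<longrightarrow> deriv (fst \<circ> \<gamma>) t = f t \<and> 0 < f t"
    "(\<integral>\<^sup>+t. ennreal (f t) * indicator {a..b} t \<partial>lborel) = ennreal (fst (\<gamma> b) - fst (\<gamma> a))"
    using causal_curve_time_density[OF c] by blast
  have [measurable]: "f \<in> borel_measurable borel" using f by auto
  have "AE t in lborel. ennreal (sqrt ((deriv (fst \<circ> \<gamma>) t)\<^sup>2 - (real_of_ereal (?v t))\<^sup>2)) * indicator {a..b} t
     = ennreal (f t) * indicator {a..b} t"
    by (rule nn_integral_eq_imp_AE_eq[OF _ causal_length_le_density[OF f(2)]])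
      (use L f(3) in \<open>auto simp: causal_length_def nn_integral_completion\<close>)
  moreover have "AE t in lborel. t \<in> {a..b} \<longrightarrow> ?v t \<le> ereal (deriv (fst \<circ> \<gamma>) t)"
    using c by (auto simp: causal_curve_def elim: eventually_mono)
  ultimately show ?thesis using f(2)
  proof eventually_elim
    case (elim t)
    show ?case
    proof
      assume t: "t \<in> {a<..<b}"
      then have ft: "deriv (fst \<circ> \<gamma>) t = f t" "0 < f t" using elim by auto
      have "ennreal (sqrt ((f t)\<^sup>2 - (real_of_ereal (?v t))\<^sup>2)) = ennreal (f t)"
        using elim(1) t ft by simp
      then have "sqrt ((f t)\<^sup>2 - (real_of_ereal (?v t))\<^sup>2) = f t"
        using ft(2) by (cases "0 \<le> sqrt ((f t)\<^sup>2 - (real_of_ereal (?v t))\<^sup>2)") (auto simp: ennreal_neg)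
      then have "(f t)\<^sup>2 - (real_of_ereal (?v t))\<^sup>2 = (f t)\<^sup>2"
        using ft(2) by (metis real_sqrt_gt_0_iff real_sqrt_pow2 less_imp_le)
      then have "real_of_ereal (?v t) = 0" by simp
      moreover have "?v t \<le> ereal (f t)" using elim(2) t ft(1) by auto
      ultimately show "?v t \<le> 0" by (cases "?v t") auto
    qed
  qed
qed

section \<open>Vertical curves and their rigidity\<close>

text \<open>The average of the metric speed over an interval bounds the distance of its endpoints, divided by
  the length of the interval.\<close>

lemma vel_le_0_imp_small_distance:
  assumes v: "integrable lborel v"
    and lim: "AE t in lborel. t \<in> {a<..<b} \<longrightarrow> ((\<lambda>w. d s (c w) (c t) / \<bar>w - t\<bar>) \<longlongrightarrow> v t) (at t)"
    and dist: "\<And>t u. a \<le> t \<Longrightarrow> t \<le> u \<Longrightarrow> u \<le> b \<Longrightarrow> d s (c t) (c u) \<le> seg_integral v t u"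
    and sym: "\<And>x y. d s x y = d s y x"
    and t: "t \<in> {a<..<b}" and vel: "vel d a b c s t \<le> 0" and e: "0 < e"
  shows "\<forall>\<^sub>F w in at t. d s (c w) (c t) < e * \<bar>w - t\<bar>"
proof -
  have "vel d a b c s t < ereal e" using vel e by (metis ereal_less(2) le_less_trans)
  then have "\<forall>\<^sub>F h in at 0. ereal (1 / h * (LINT u=ereal t..ereal (t + h)|lebesgue. metric_speed (d s) a b c u)) < ereal e"
    unfolding vel_def by (rule Limsup_lessD)
  then have "\<forall>\<^sub>F w in at t. ereal (1 / (w - t) * (LINT u=ereal t..ereal (t + (w - t))|lebesgue. metric_speed (d s) a b c u)) < ereal e"
    by (subst eventually_at_to_0) (simp add: add.commute)
  moreover have "\<forall>\<^sub>F w in at t. w \<in> {a<..<b}" using t by (intro eventually_at_in_open') auto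
  moreover have "\<forall>\<^sub>F w in at t. w \<noteq> t" by (simp add: eventually_at_filter)
  ultimately show ?thesis
  proof eventually_elim
    case (elim w)
    have "seg_integral v t w / \<bar>w - t\<bar> < e"
      using elim interval_integral_metric_speed[where \<delta> = "d s" and c = c and v = v and a = a and b = b, OF v lim t, of "w - t"]
      by simp
    then have "seg_integral v t w < e * \<bar>w - t\<bar>" using elim(3) by (simp add: divide_less_eq)
    moreover have "d s (c w) (c t) \<le> seg_integral v t w"
      using dist[of t w] dist[of w t] elim t sym[of "c t" "c w"]
      by (cases "t \<le> w") (auto simp: seg_integral_commute[of v w t])
    ultimately show ?case by simp
  qed
qed

text \<open>The velocity at time \<open>t\<close> is measured by the metric \<open>d (fst (\<gamma> t))\<close>, which varies along the curve. On the
  compact image of the curve, local continuity bounds a fixed metric \<open>d s0\<close> by a constant multiple of each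
  of these at small distances. So the metric derivative with respect to \<open>d s0\<close> vanishes
  almost everywhere, and its integral bounds the \<open>d s0\<close>-distance.\<close>

lemma zero_velocity_imp_constant:
  fixes \<gamma> :: "real \<Rightarrow> real \<times> 'a::topological_space"
  assumes mf: "metric_family d" and ac: "ac_product_curve d a b \<gamma>" and ab: "a < b"
    and cont: "continuous_on {a..b} \<gamma>"
    and vel: "AE t in lborel. t \<in> {a<..<b} \<longrightarrow> vel d a b (snd \<circ> \<gamma>) (fst (\<gamma> t)) t \<le> 0"
    and t: "t \<in> {a..b}"
  shows "snd (\<gamma> t) = snd (\<gamma> a)"
proof -
  let ?\<beta> = "snd \<circ> \<gamma>"
  have M: "Metric_space UNIV (d s)" for s using mf by (simp add: metric_family_def)
  have ms: "ac_curve (d s) a b ?\<beta>" for s using ac by (simp add: ac_product_curve_def)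
  let ?J = "(fst \<circ> \<gamma>) ` {a..b}" and ?K = "?\<beta> ` {a..b}"
  have J: "compact ?J" and K: "compact ?K"
    using cont by (auto intro!: compact_continuous_image continuous_on_compose continuous_intros)
  obtain r \<omega> where r: "r > 0" and \<omega>: "modulus_of_continuity \<omega>" and
    cmp: "\<And>s s' x y. \<lbrakk>s \<in> ?J; s' \<in> ?J; x \<in> ?K; y \<in> ?K; x \<noteq> y; (INF s\<in>?J. d s x y) < r\<rbrakk> \<Longrightarrow>
      \<bar>ln (d s x y / d s' x y)\<bar> \<le> \<omega> \<bar>s - s'\<bar>"
    using mf J K unfolding metric_family_def locally_continuous_metrics_def by meson
  obtain B where B: "\<And>s. s \<in> ?J \<Longrightarrow> \<bar>s\<bar> \<le> B"
    using compact_imp_bounded[OF J] by (auto simp: bounded_iff)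
  define s0 where "s0 = fst (\<gamma> a)"
  have s0: "s0 \<in> ?J" using ab by (auto simp: s0_def)
  \<comment> \<open>\<open>2 * B\<close> bounds the time differences along the curve, and \<open>\<omega>\<close> is increasing\<close>
  define C where "C = exp (\<omega> (2 * B))"
  have C: "C > 0" by (simp add: C_def)
  have compare: "d s0 x y \<le> C * d s x y" if s: "s \<in> ?J" and xy: "x \<in> ?K" "y \<in> ?K" and small: "d s x y < r" for s x y
  proof (cases "x = y")
    case True
    then show ?thesis using Metric_space.mdist_zero[OF M] by simp
  next
    case False
    have nn: "0 \<le> d s x y" for s using Metric_space.nonneg[OF M] .
    have pos: "0 < d s x y" for s using False Metric_space.mdist_pos_eq[OF M] by simp
    have "(INF s\<in>?J. d s x y) \<le> d s x y"
      using s nn by (intro cINF_lower bdd_belowI[of _ 0]) auto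
    then have "\<bar>ln (d s0 x y / d s x y)\<bar> \<le> \<omega> \<bar>s0 - s\<bar>" using cmp[OF s0 s xy False] small by simp
    also have "\<dots> \<le> \<omega> (2 * B)"
    proof (rule mono_onD[of "{0..}" \<omega>])
      show "mono_on {0..} \<omega>" using \<omega> by (simp add: modulus_of_continuity_def)
      show "\<bar>s0 - s\<bar> \<le> 2 * B" using B[OF s0] B[OF s] by simp
    qed (use B[OF s0] in auto)
    finally have "ln (d s0 x y / d s x y) \<le> \<omega> (2 * B)" by simp
    moreover have "d s0 x y / d s x y = exp (ln (d s0 x y / d s x y))" using pos by simp
    ultimately have "d s0 x y / d s x y \<le> C" unfolding C_def by (metis exp_le_cancel_iff)
    then show ?thesis using pos by (simp add: divide_le_eq)
  qed
  obtain v where v: "integrable lborel v" "\<And>x. 0 \<le> v x"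
    and lim: "AE t in lborel. t \<in> {a<..<b} \<longrightarrow> ((\<lambda>w. d s0 (?\<beta> w) (?\<beta> t) / \<bar>w - t\<bar>) \<longlongrightarrow> v t) (at t)"
    and le: "\<And>t u. a \<le> t \<Longrightarrow> t \<le> u \<Longrightarrow> u \<le> b \<Longrightarrow> d s0 (?\<beta> t) (?\<beta> u) \<le> seg_integral v t u"
    by (rule metric_derivative[OF M[of s0] ms ab]) (rule that)
  have "AE t in lborel. t \<in> {a<..<b} \<longrightarrow> v t = 0"
    using lim vel
  proof eventually_elim
    case (elim t)
    show ?case
    proof
      assume t: "t \<in> {a<..<b}"
      let ?s = "fst (\<gamma> t)"
      have s: "?s \<in> ?J" using t by auto
      obtain v' where v': "integrable lborel v'" and "\<And>u. 0 \<le> v' u" and v'2: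
        "AE u in lborel. u \<in> {a<..<b} \<longrightarrow> ((\<lambda>w. d ?s (?\<beta> w) (?\<beta> u) / \<bar>w - u\<bar>) \<longlongrightarrow> v' u) (at u)" and v'3:
        "\<And>t u. a \<le> t \<Longrightarrow> t \<le> u \<Longrightarrow> u \<le> b \<Longrightarrow> d ?s (?\<beta> t) (?\<beta> u) \<le> seg_integral v' t u"
        by (rule metric_derivative[OF M[of ?s] ms ab]) (rule that)
      have small: "\<forall>\<^sub>F w in at t. d ?s (?\<beta> w) (?\<beta> t) < e * \<bar>w - t\<bar>" if "e > 0" for e
        using vel_le_0_imp_small_distance[where d = d and s = ?s and c = ?\<beta> and v = v' and a = a and b = b, OF v' v'2 v'3 Metric_space.commute[OF M] t _ that] elim(2) t by simp
      have "v t \<le> e" if e: "e > 0" for e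
      proof (rule tendsto_upperbound)
        show "((\<lambda>w. d s0 (?\<beta> w) (?\<beta> t) / \<bar>w - t\<bar>) \<longlongrightarrow> v t) (at t)" using elim(1) t by blast
        have "\<forall>\<^sub>F w in at t. w \<in> {a<..<b}" using t by (intro eventually_at_in_open') auto
        moreover have "\<forall>\<^sub>F w in at t. w \<noteq> t" by (simp add: eventually_at_filter)
        moreover have "\<forall>\<^sub>F w in at t. \<bar>w - t\<bar> < 1"
          unfolding eventually_at by (intro exI[of _ 1]) (auto simp: dist_real_def)
        ultimately show "\<forall>\<^sub>F w in at t. d s0 (?\<beta> w) (?\<beta> t) / \<bar>w - t\<bar> \<le> e"
          using small[OF r] small[OF divide_pos_pos[OF e C]]
        proof eventually_elim
          case (elim w)
          have "r * \<bar>w - t\<bar> \<le> r * 1" using elim(3) r by (intro mult_left_mono) auto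
          then have "d ?s (?\<beta> w) (?\<beta> t) < r" using elim(4) by simp
          then have "d s0 (?\<beta> w) (?\<beta> t) \<le> C * d ?s (?\<beta> w) (?\<beta> t)"
            using elim(1) t by (intro compare[OF s]) auto
          also have "\<dots> \<le> C * (e / C * \<bar>w - t\<bar>)" using elim(5) C e by (intro mult_left_mono) auto
          also have "\<dots> = e * \<bar>w - t\<bar>" using C by simp
          finally show ?case using elim(2) by (simp add: divide_le_eq)
        qed
      qed simp
      then have "v t \<le> 0" by - (rule field_le_epsilon, simp)
      with v(2)[of t] show "v t = 0" by simp
    qed
  qed
  then have "AE w in lborel. indicator {a..t} w * v w = 0"
    using AE_lborel_singleton[of a] AE_lborel_singleton[of b]
    by eventually_elim (use t in \<open>auto simp: indicator_def\<close>)
  then have "seg_integral v a t = 0"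
    using t unfolding seg_integral_def set_lebesgue_integral_def by (intro integral_eq_zero_AE) (simp add: max_absorb2 min_absorb1)
  then have "d s0 (?\<beta> a) (?\<beta> t) \<le> 0" using le[of a t] t by simp
  then show ?thesis using Metric_space.mdist_pos_eq[OF M, of "?\<beta> a" "?\<beta> t" s0] by (auto simp: not_less[symmetric])
qed

lemma vel_constant:
  assumes M: "Metric_space UNIV (d s)" and t: "t \<in> {a<..<b}" and c: "\<And>u. u \<in> {a..b} \<Longrightarrow> c u = x"
  shows "vel d a b c s t = 0"
proof -
  have lim: "((\<lambda>w. d s (c w) (c t) / \<bar>w - t\<bar>) \<longlongrightarrow> 0) (at t)" if t: "t \<in> {a<..<b}" for t
  proof (rule tendsto_eventually)
    have "\<forall>\<^sub>F w in at t. w \<in> {a<..<b}" using t by (intro eventually_at_in_open') auto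
    then show "\<forall>\<^sub>F w in at t. d s (c w) (c t) / \<bar>w - t\<bar> = 0"
      by eventually_elim (use c t Metric_space.mdist_zero[OF M] in auto)
  qed
  have "\<forall>\<^sub>F h in at 0. t + h \<in> {a<..<b}"
    unfolding eventually_at using t by (intro exI[of _ "min (t - a) (b - t)"]) (auto simp: dist_real_def)
  then have "\<forall>\<^sub>F h in at 0. ereal (1 / h * (LINT u=ereal t..ereal (t + h)|lebesgue. metric_speed (d s) a b c u)) = 0"
  proof eventually_elim
    case (elim h)
    have "1 / h * (LINT u=ereal t..ereal (t + h)|lebesgue. metric_speed (d s) a b c u) = seg_integral (\<lambda>_. 0) t (t + h) / \<bar>h\<bar>"
      using lim t elim by (intro interval_integral_metric_speed) auto
    also have "\<dots> = 0" by (simp add: seg_integral_def)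
    finally show ?case by simp
  qed
  then have "vel d a b c s t = Limsup (at (0::real)) (\<lambda>_. 0 :: ereal)"
    unfolding vel_def by (rule Limsup_eq)
  then show ?thesis by (simp add: Limsup_const)
qed

lemma vertical_curve:
  assumes M: "\<And>s. Metric_space UNIV (d s)" and ab: "a \<le> b" and T: "0 < T"
    and \<gamma>: "\<And>t. t \<in> {a..b} \<Longrightarrow> \<gamma> t = (s + T * t, x)"
  shows "timelike_curve d a b \<gamma>" and "causal_length d a b \<gamma> = ennreal (T * (b - a))"
proof -
  have deriv: "deriv (fst \<circ> \<gamma>) t = T" if t: "t \<in> {a<..<b}" for t
  proof (rule DERIV_imp_deriv)
    have "((\<lambda>t. s + T * t) has_real_derivative T) (at t)" by (auto intro!: derivative_eq_intros)
    then show "((fst \<circ> \<gamma>) has_real_derivative T) (at t)"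
      by (rule has_field_derivative_transform_within_open[of _ _ _ "{a<..<b}"]) (use t \<gamma> in auto)
  qed
  have vel: "vel d a b (snd \<circ> \<gamma>) s t = 0" if t: "t \<in> {a<..<b}" for s t
    by (rule vel_constant[OF M t, of _ x]) (simp add: \<gamma>)
  have ac1: "ac_curve dist a b (fst \<circ> \<gamma>)"
    unfolding ac_curve_def
  proof (intro exI[of _ "\<lambda>_. T"] conjI allI impI)
    have "integrable lebesgue (indicator {a..b} :: real \<Rightarrow> real)" by (rule integrable_real_indicator) (use ab in auto)
    then show "set_integrable lebesgue {a..b} (\<lambda>_. T)" by (simp add: set_integrable_def)
    fix t u assume tu: "a \<le> t \<and> t \<le> u \<and> u \<le> b"
    have "dist ((fst \<circ> \<gamma>) t) ((fst \<circ> \<gamma>) u) = T * (u - t)"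
      using tu T by (simp add: \<gamma> dist_real_def abs_mult flip: right_diff_distrib)
    also have "\<dots> = (LINT w:{t..u}|lebesgue. T)" using tu by (simp add: set_lebesgue_integral_def)
    finally show "dist ((fst \<circ> \<gamma>) t) ((fst \<circ> \<gamma>) u) \<le> (LINT w:{t..u}|lebesgue. T)" by simp
  qed
  have ac2: "ac_curve (d s) a b (snd \<circ> \<gamma>)" for s
    unfolding ac_curve_def
    by (intro exI[of _ "\<lambda>_. 0"]) (auto simp: \<gamma> Metric_space.mdist_zero[OF M] set_integrable_def set_lebesgue_integral_def)
  have ae: "AE t in lborel. t \<in> {a..b} \<longrightarrow> t \<in> {a<..<b}"
    using AE_lborel_singleton[of a] AE_lborel_singleton[of b] by eventually_elim auto
  show "timelike_curve d a b \<gamma>"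
    unfolding timelike_curve_def ac_product_curve_def
  proof (intro conjI allI ab ac1 ac2)
    show "AE t in lborel. t \<in> {a..b} \<longrightarrow> 0 < deriv (fst \<circ> \<gamma>) t \<and> vel d a b (snd \<circ> \<gamma>) (fst (\<gamma> t)) t < ereal (deriv (fst \<circ> \<gamma>) t)"
      using ae by eventually_elim (use T in \<open>auto simp: deriv vel\<close>)
  qed
  have "causal_length d a b \<gamma> = (\<integral>\<^sup>+t. ennreal T * indicator {a..b} t \<partial>lborel)"
    unfolding causal_length_def nn_integral_completion
  proof (rule nn_integral_cong_AE)
    show "AE t in lborel. ennreal (sqrt ((deriv (fst \<circ> \<gamma>) t)\<^sup>2 - (real_of_ereal (vel d a b (snd \<circ> \<gamma>) (fst (\<gamma> t)) t))\<^sup>2)) * indicator {a..b} t = ennreal T * indicator {a..b} t"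
      using ae by eventually_elim (use T in \<open>auto simp: deriv vel indicator_def\<close>)
  qed
  also have "\<dots> = ennreal (T * (b - a))"
    using ab T by (simp add: nn_integral_cmult_indicator ennreal_mult)
  finally show "causal_length d a b \<gamma> = ennreal (T * (b - a))" .
qed

lemma timelike_imp_causal: "timelike_curve d a b \<gamma> \<Longrightarrow> causal_curve d a b \<gamma>"
  unfolding timelike_curve_def causal_curve_def
  by (elim conjE, intro conjI, assumption, elim eventually_mono) (blast intro: less_imp_le)

lemma vertical_causal_le:
  assumes M: "\<And>s. Metric_space UNIV (d s)" and r: "0 \<le> r"
  shows "causal_le d (s, x) (s + r, x)"
proof -
  have "causal_curve d 0 r (\<lambda>t. (s + 1 * t, x))"
    by (intro timelike_imp_causal vertical_curve(1)[where d = d and T = 1]) (use M r in auto)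
  then show ?thesis unfolding causal_le_def by (intro exI[of _ 0] exI[of _ r] exI) auto
qed

lemma vertical_time_sep:
  assumes M: "\<And>s. Metric_space UNIV (d s)" and r: "0 \<le> r"
  shows "time_sep d (s, x) (s + r, x) = ennreal r"
proof (rule antisym)
  show "time_sep d (s, x) (s + r, x) \<le> ennreal r" using time_sep_le[of d "(s, x)" "(s + r, x)"] by simp
  let ?\<gamma> = "\<lambda>t. (s + 1 * t, x)"
  have "causal_curve d 0 r ?\<gamma>" "causal_length d 0 r ?\<gamma> = ennreal (1 * (r - 0))"
    by (intro timelike_imp_causal vertical_curve[where d = d and T = 1 and s = s and x = x]; use M r in auto)+
  then show "ennreal r \<le> time_sep d (s, x) (s + r, x)"
    unfolding time_sep_def
    by (intro Sup_upper CollectI exI[of _ 0] exI[of _ r] exI[of _ ?\<gamma>] conjI) simp_all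
qed

definition vertical :: "real \<Rightarrow> real \<times> 'a \<Rightarrow> real \<Rightarrow> real \<times> 'a" where
  "vertical T y = (\<lambda>t\<in>{0..1}. (fst y + T * t, snd y))"

lemma vertical_in_unit_curves: "vertical T (y :: real \<times> 'a::topological_space) \<in> unit_curves"
proof -
  have "continuous_on {0..1} (vertical T y) \<longleftrightarrow> continuous_on {0..1} (\<lambda>t. (fst y + T * t, snd y))"
    by (intro continuous_on_cong) (auto simp: vertical_def)
  moreover have "continuous_on {0..1} (\<lambda>t. (fst y + T * t, snd y))" by (intro continuous_intros)
  ultimately show ?thesis by (auto simp: unit_curves_def vertical_def)
qed

lemma vertical_opt_curve:
  fixes y :: "real \<times> 'a::topological_space"
  assumes M: "\<And>s. Metric_space UNIV (d s)" and T: "0 < T"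
  shows "vertical T y \<in> opt_curves d" and "causal_length d 0 1 (vertical T y) = ennreal T"
proof -
  have tl: "timelike_curve d 0 1 (vertical T y)" and L: "causal_length d 0 1 (vertical T y) = ennreal (T * (1 - 0))"
    by (rule vertical_curve[where T = T and s = "fst y" and x = "snd y" and d = d];
        use M T in \<open>simp add: vertical_def\<close>)+
  from L show L': "causal_length d 0 1 (vertical T y) = ennreal T" by simp
  have "time_sep d (vertical T y t) (vertical T y s) = ennreal (s - t) * ennreal T"
    if "0 \<le> t" "t \<le> s" "s \<le> 1" for t s
  proof -
    have "time_sep d (vertical T y t) (vertical T y s) = time_sep d (fst y + T * t, snd y) ((fst y + T * t) + T * (s - t), snd y)"
      using that by (simp add: vertical_def algebra_simps)
    also have "\<dots> = ennreal (T * (s - t))" using that T by (intro vertical_time_sep M) auto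
    finally show ?thesis using that T by (simp add: ennreal_mult mult.commute)
  qed
  then show "vertical T y \<in> opt_curves d" using tl by (simp add: opt_curves_def L' vertical_in_unit_curves)
qed

text \<open>Length equal to duration forces a constant spatial part. The time separations from \<open>\<gamma> 0\<close> to \<open>\<gamma> t\<close> and
  from \<open>\<gamma> t\<close> to \<open>\<gamma> 1\<close> bound the elapsed times from below by \<open>T t\<close> and \<open>T (1 - t)\<close>, which add up to the
  total time \<open>T\<close>; so the time component is affine.\<close>

lemma opt_curve_rigid:
  fixes \<gamma> :: "real \<Rightarrow> real \<times> 'a::topological_space"
  assumes mf: "metric_family d" and \<gamma>: "\<gamma> \<in> opt_curves d" and T0: "0 < T"
    and L: "causal_length d 0 1 \<gamma> = ennreal T" and T: "fst (\<gamma> 1) - fst (\<gamma> 0) = T"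
  shows "\<gamma> = vertical T (\<gamma> 0)"
proof -
  have tl: "timelike_curve d 0 1 \<gamma>" and uc: "\<gamma> \<in> unit_curves"
    and sep: "\<And>t s. 0 \<le> t \<Longrightarrow> t \<le> s \<Longrightarrow> s \<le> 1 \<Longrightarrow> time_sep d (\<gamma> t) (\<gamma> s) = ennreal (s - t) * ennreal T"
    using \<gamma> L by (auto simp: opt_curves_def)
  have cc: "causal_curve d 0 1 \<gamma>" using tl by (rule timelike_imp_causal)
  have "AE t in lborel. t \<in> {0<..<1} \<longrightarrow> vel d 0 1 (snd \<circ> \<gamma>) (fst (\<gamma> t)) t \<le> 0"
    by (rule causal_length_eq_imp_vel_le_0[OF cc]) (simp add: L T)
  then have const: "snd (\<gamma> t) = snd (\<gamma> 0)" if "t \<in> {0..1}" for t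
    using zero_velocity_imp_constant[OF mf, of 0 1 \<gamma> t] that cc uc
    by (auto simp: causal_curve_def unit_curves_def)
  have *: "T * (s - t) \<le> fst (\<gamma> s) - fst (\<gamma> t)" if "0 \<le> t" "t \<le> s" "s \<le> 1" for t s
  proof (cases "t = s")
    case False
    have "ennreal (T * (s - t)) \<le> ennreal (fst (\<gamma> s) - fst (\<gamma> t))"
      using time_sep_le[of d "\<gamma> t" "\<gamma> s"] sep[OF that] that T0 by (simp add: ennreal_mult mult.commute)
    moreover have "0 < T * (s - t)" using that False T0 by simp
    ultimately show ?thesis by (auto simp: ennreal_le_iff2)
  qed simp
  have aff: "fst (\<gamma> t) = fst (\<gamma> 0) + T * t" if "t \<in> {0..1}" for t
    using *[of 0 t] *[of t 1] that T by (simp add: algebra_simps)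
  show ?thesis
  proof
    fix t
    show "\<gamma> t = vertical T (\<gamma> 0) t"
    proof (cases "t \<in> {0..1}")
      case True
      then show ?thesis using aff[OF True] const[OF True] by (simp add: vertical_def prod_eq_iff)
    next
      case False
      then show ?thesis using uc by (auto simp: vertical_def unit_curves_def extensional_def restrict_def)
    qed
  qed
qed

section \<open>Curve space\<close>

definition time_shift :: "real \<Rightarrow> real \<times> 'a \<Rightarrow> real \<times> 'a" where
  "time_shift T y = (fst y + T, snd y)"

lemma time_shift_simps [simp]:
  "fst (time_shift T y) = fst y + T" "snd (time_shift T y) = snd y"
  "time_shift S (time_shift T y) = time_shift (T + S) y" "time_shift 0 y = y"
  by (simp_all add: time_shift_def)

lemma continuous_time_shift: "continuous_on S (time_shift T :: real \<times> 'a::topological_space \<Rightarrow> _)"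
  unfolding time_shift_def[abs_def] by (intro continuous_intros)

lemma measurable_time_shift [measurable]:
  "time_shift T \<in> borel \<rightarrow>\<^sub>M (borel :: (real \<times> 'a::topological_space) measure)"
  by (intro borel_measurable_continuous_onI continuous_time_shift)

lemma measurable_fst_borel [measurable]:
  "(fst :: 'a::topological_space \<times> 'b::topological_space \<Rightarrow> 'a) \<in> borel \<rightarrow>\<^sub>M borel"
  by (intro borel_measurable_continuous_onI continuous_intros)

lemma measurable_snd_borel [measurable]:
  "(snd :: 'a::topological_space \<times> 'b::topological_space \<Rightarrow> 'b) \<in> borel \<rightarrow>\<^sub>M borel"
  by (intro borel_measurable_continuous_onI continuous_intros)

lemma vertical_eval: "t \<in> {0..1} \<Longrightarrow> vertical T y t = time_shift (T * t) y"
  by (simp add: vertical_def time_shift_def)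

text \<open>The Hausdorff property. The topology of \<open>X\<close> comes from a bare topological space; the separation is
  provided by the metrics.\<close>

definition separates_points :: "'a::topological_space itself \<Rightarrow> bool" where
  "separates_points _ \<longleftrightarrow> (\<forall>x y :: 'a. x \<noteq> y \<longrightarrow> (\<exists>U V. open U \<and> open V \<and> x \<in> U \<and> y \<in> V \<and> U \<inter> V = {}))"

text \<open>The distance of the endpoints is the sum for the trivial partition.\<close>

lemma dist_le_length_metric:
  fixes \<delta> :: "'a \<Rightarrow> 'a \<Rightarrow> real"
  shows "ennreal (\<delta> x y) \<le> length_metric \<delta> x y"
  unfolding length_metric_def
proof (rule INF_greatest)
  fix c :: "real \<Rightarrow> 'a" assume c: "c \<in> {c. continuous_map (top_of_set {0..1}) (Metric_space.mtopology UNIV \<delta>) c \<and> c 0 = x \<and> c 1 = y}"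
  let ?t = "\<lambda>i::nat. if i = 0 then 0 else 1 :: real"
  have "ennreal (\<delta> x y) = (\<Sum>i<1. ennreal (\<delta> (c (?t i)) (c (?t (Suc i)))))" using c by simp
  also have "\<dots> \<le> curve_length \<delta> 0 1 c"
    unfolding curve_length_def
    by (rule SUP_upper2[of "(1, ?t)"]) (auto simp: mono_def)
  finally show "ennreal (\<delta> x y) \<le> curve_length \<delta> 0 1 c" .
qed

text \<open>A ball of the metric contains a ball of the larger length metric around each of its points.\<close>

lemma open_mball_of_metric_family:
  fixes d :: "real \<Rightarrow> 'a::topological_space \<Rightarrow> 'a \<Rightarrow> real"
  assumes "metric_family d"
  shows "open {y. d s x y < r}"
proof -
  have M: "Metric_space UNIV (d s)" and gen: "generates_topology (length_metric (d s))"
    using assms by (auto simp: metric_family_def)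
  interpret Metric_space UNIV "d s" by (rule M)
  show ?thesis
    unfolding gen[unfolded generates_topology_def, rule_format]
  proof
    fix y assume y: "y \<in> {y. d s x y < r}"
    show "\<exists>e>0. {z. length_metric (d s) y z < ennreal e} \<subseteq> {y. d s x y < r}"
    proof (intro exI[of _ "r - d s x y"] conjI subsetI CollectI)
      fix z assume "z \<in> {z. length_metric (d s) y z < ennreal (r - d s x y)}"
      then have "ennreal (d s y z) < ennreal (r - d s x y)"
        using dist_le_length_metric[of "d s" y z] by (auto intro: le_less_trans)
      then have "d s y z < r - d s x y" by (simp add: ennreal_less_iff)
      then show "d s x z < r" using triangle[of x y z] by simp
    qed (use y in auto)
  qed
qed

lemma separates_points_of_metric_family:
  fixes d :: "real \<Rightarrow> 'a::topological_space \<Rightarrow> 'a \<Rightarrow> real"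
  assumes "metric_family d"
  shows "separates_points TYPE('a)"
  unfolding separates_points_def
proof (intro allI impI)
  fix x y :: 'a assume "x \<noteq> y"
  interpret Metric_space UNIV "d 0" using assms by (auto simp: metric_family_def)
  let ?r = "d 0 x y / 2"
  have pos: "0 < d 0 x y" using \<open>x \<noteq> y\<close> by simp
  show "\<exists>U V. open U \<and> open V \<and> x \<in> U \<and> y \<in> V \<and> U \<inter> V = {}"
  proof (intro exI conjI)
    show "open {z. d 0 x z < ?r}" "open {z. d 0 y z < ?r}" by (rule open_mball_of_metric_family[OF assms])+
    show "{z. d 0 x z < ?r} \<inter> {z. d 0 y z < ?r} = {}"
    proof -
      have "\<not> (d 0 x z < ?r \<and> d 0 y z < ?r)" for z
        using triangle[of x z y, OF UNIV_I UNIV_I UNIV_I] commute[of y z] by linarith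
      then show ?thesis by blast
    qed
  qed (use pos in auto)
qed

lemma separatedI:
  "open U \<Longrightarrow> open V \<Longrightarrow> x \<in> U \<Longrightarrow> y \<in> V \<Longrightarrow> U \<inter> V = {} \<Longrightarrow>
    \<exists>U V. open U \<and> open V \<and> x \<in> U \<and> y \<in> V \<and> U \<inter> V = {}"
  by blast

lemma separates_pointsD:
  "separates_points TYPE('a::topological_space) \<Longrightarrow> (x :: 'a) \<noteq> y \<Longrightarrow>
    \<exists>U V. open U \<and> open V \<and> x \<in> U \<and> y \<in> V \<and> U \<inter> V = {}"
  by (simp add: separates_points_def)

lemma separates_points_product:
  assumes "separates_points TYPE('a::topological_space)" and ne: "(x :: real \<times> 'a) \<noteq> y"
  shows "\<exists>U V. open U \<and> open V \<and> x \<in> U \<and> y \<in> V \<and> U \<inter> V = {}"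
proof (cases "fst x = fst y")
  case True
  then have "snd x \<noteq> snd y" using ne by (auto simp: prod_eq_iff)
  from separates_pointsD[OF assms(1) this] obtain U V where
    UV: "open U" "open V" "snd x \<in> U" "snd y \<in> V" "U \<inter> V = {}" by (elim exE conjE)
  show ?thesis
  proof (rule separatedI)
    show "open (UNIV \<times> U :: (real \<times> 'a) set)" "open (UNIV \<times> V :: (real \<times> 'a) set)"
      using UV by (simp_all add: open_Times)
  qed (use UV in \<open>auto simp: mem_Times_iff\<close>)
next
  case False
  from hausdorff[OF this] obtain U V where
    UV: "open U" "open V" "fst x \<in> U" "fst y \<in> V" "U \<inter> V = {}" by (elim exE conjE)
  show ?thesis
  proof (rule separatedI)
    show "open (U \<times> UNIV :: (real \<times> 'a) set)" "open (V \<times> UNIV :: (real \<times> 'a) set)"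
      using UV by (simp_all add: open_Times)
  qed (use UV in \<open>auto simp: mem_Times_iff\<close>)
qed

text \<open>Needed to see that the graph is a Borel set: in a product of spaces without countable base,
  a Borel graph cannot be taken for granted.\<close>

lemma closed_shift_graph:
  assumes sep: "separates_points TYPE('a::topological_space)"
  shows "closed {z :: (real \<times> 'a) \<times> (real \<times> 'a). snd z = time_shift T (fst z)}"
  unfolding closed_def
proof (rule topological_space_class.openI)
  fix z :: "(real \<times> 'a) \<times> (real \<times> 'a)" assume "z \<in> - {z. snd z = time_shift T (fst z)}"
  then have "snd z \<noteq> time_shift T (fst z)" by simp
  from separates_points_product[OF sep this] obtain U V where UV: "open U" "open V" "snd z \<in> U" "time_shift T (fst z) \<in> V" "U \<inter> V = {}"
    by (elim exE conjE)
  have "open (time_shift T -` V)" by (rule open_vimage[OF UV(2) continuous_time_shift])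
  then have "open ((time_shift T -` V) \<times> U)" using UV(1) by (rule open_Times)
  moreover have "z \<in> (time_shift T -` V) \<times> U" using UV by (simp add: mem_Times_iff)
  moreover have "(time_shift T -` V) \<times> U \<subseteq> - {z. snd z = time_shift T (fst z)}" using UV(5) by auto
  ultimately show "\<exists>W. open W \<and> z \<in> W \<and> W \<subseteq> - {z. snd z = time_shift T (fst z)}" by blast
qed

lemma topspace_unit_curves: "topspace unit_curves_topology \<subseteq> unit_curves"
  unfolding unit_curves_topology_def topology_generated_by_topspace by auto

lemma openin_unit_curves_generator:
  "compact K \<Longrightarrow> K \<subseteq> {0..1} \<Longrightarrow> open U \<Longrightarrow> openin unit_curves_topology {\<gamma> \<in> unit_curves. \<gamma> ` K \<subseteq> U}"
  unfolding unit_curves_topology_def by (intro topology_generated_by_Basis) blast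

lemma open_subset_unit_curves: "{A. openin unit_curves_topology A} \<subseteq> Pow unit_curves"
  using topspace_unit_curves openin_subset by blast

lemma space_unit_curves_borel [simp]: "space unit_curves_borel = unit_curves"
  by (simp add: unit_curves_borel_def space_measure_of_conv)

lemma openin_imp_sets_unit_curves: "openin unit_curves_topology A \<Longrightarrow> A \<in> sets unit_curves_borel"
  unfolding unit_curves_borel_def by (intro in_measure_of[OF open_subset_unit_curves]) simp

lemma measurable_eval:
  assumes "t \<in> {0..1}"
  shows "(\<lambda>\<gamma>. \<gamma> t) \<in> unit_curves_borel \<rightarrow>\<^sub>M (borel :: 'b::topological_space measure)"
proof (rule borel_measurableI)
  fix U :: "'b set" assume U: "open U"
  have "(\<lambda>\<gamma>. \<gamma> t) -` U \<inter> space unit_curves_borel = {\<gamma> \<in> unit_curves. \<gamma> ` {t} \<subseteq> U}" by auto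
  then show "(\<lambda>\<gamma>. \<gamma> t) -` U \<inter> space unit_curves_borel \<in> sets unit_curves_borel"
    using openin_unit_curves_generator[of "{t}" U] assms U by (simp add: openin_imp_sets_unit_curves)
qed

text \<open>The tube lemma, applied to the compact set \<open>K\<close> of parameters.\<close>

lemma open_vertical_vimage:
  fixes U :: "(real \<times> 'a::topological_space) set"
  assumes K: "compact K" "K \<subseteq> {0..1}" and U: "open U"
  shows "open {y. vertical T y ` K \<subseteq> U}"
proof (rule topological_space_class.openI)
  fix y assume "y \<in> {y. vertical T y ` K \<subseteq> U}"
  then have "vertical T y t \<in> U" if "t \<in> K" for t using that by blast
  moreover have "vertical T y t = (fst y + T * t, snd y)" if "t \<in> K" for t
    using subsetD[OF K(2) that] by (simp add: vertical_def)
  ultimately have y: "(fst y + T * t, snd y) \<in> U" if "t \<in> K" for t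
    using that by metis
  let ?F = "\<lambda>(z :: (real \<times> 'a) \<times> real). (fst (fst z) + T * snd z, snd (fst z))"
  have "continuous_on UNIV ?F" by (intro continuous_intros)
  then have "open (?F -` U)" by (rule open_vimage[OF U])
  moreover have "{y} \<times> K \<subseteq> ?F -` U"
  proof
    fix z assume "z \<in> {y} \<times> K"
    then have "fst z = y" "snd z \<in> K" by (simp_all add: mem_Times_iff)
    then show "z \<in> ?F -` U" using y by simp
  qed
  ultimately have "\<exists>X0. y \<in> X0 \<and> open X0 \<and> X0 \<times> K \<subseteq> ?F -` U"
    by (intro Elementary_Topology.tube_lemma[OF K(1)])
  then obtain X0 where X0: "y \<in> X0" "open X0" "X0 \<times> K \<subseteq> ?F -` U" by blast
  have "X0 \<subseteq> {y. vertical T y ` K \<subseteq> U}"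
  proof (intro subsetI CollectI, elim imageE, hypsubst)
    fix z t assume "z \<in> X0" "t \<in> K"
    then have "(z, t) \<in> ?F -` U" using X0(3) by blast
    then show "vertical T z t \<in> U" using subsetD[OF K(2) \<open>t \<in> K\<close>] by (simp add: vertical_def)
  qed
  with X0 show "\<exists>W. open W \<and> y \<in> W \<and> W \<subseteq> {y. vertical T y ` K \<subseteq> U}" by blast
qed

lemma measurable_vertical: "vertical T \<in> borel \<rightarrow>\<^sub>M (unit_curves_borel :: (real \<Rightarrow> real \<times> 'a::topological_space) measure)"
proof -
  have "continuous_map euclidean unit_curves_topology (vertical T :: real \<times> 'a \<Rightarrow> _)"
    unfolding unit_curves_topology_def
  proof (rule continuous_on_generated_topo)
    fix A :: "(real \<Rightarrow> real \<times> 'a) set" assume "A \<in> {{\<gamma> \<in> unit_curves. \<gamma> ` K \<subseteq> U} |K U. compact K \<and> K \<subseteq> {0..1} \<and> open U}"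
    then obtain K U where A: "A = {\<gamma> \<in> unit_curves. \<gamma> ` K \<subseteq> U}" "compact K" "K \<subseteq> {0..1}" "open U" by blast
    have "vertical T -` A = {y. vertical T y ` K \<subseteq> U}" using A(1) vertical_in_unit_curves by auto
    then show "openin euclidean (vertical T -` A \<inter> topspace euclidean)"
      using open_vertical_vimage[OF A(2-4)] by simp
  next
    have "vertical T y \<in> {\<gamma> \<in> unit_curves. \<gamma> ` {} \<subseteq> UNIV}" for y :: "real \<times> 'a"
      by (simp add: vertical_in_unit_curves)
    then show "vertical T ` topspace euclidean \<subseteq> \<Union> {{\<gamma> \<in> unit_curves :: (real \<Rightarrow> real \<times> 'a) set. \<gamma> ` K \<subseteq> U} |K U. compact K \<and> K \<subseteq> {0..1} \<and> open U}"
      by blast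
  qed
  then have *: "open (vertical T -` A)" if "openin unit_curves_topology A" for A :: "(real \<Rightarrow> real \<times> 'a) set"
    using that openin_continuous_map_preimage[of euclidean unit_curves_topology "vertical T" A]
    by (simp add: vimage_def)
  show ?thesis
    unfolding unit_curves_borel_def
  proof (rule measurable_measure_of[OF open_subset_unit_curves])
    show "vertical T \<in> space borel \<rightarrow> unit_curves" using vertical_in_unit_curves by auto
  qed (use * in auto)
qed

text \<open>The vertical curves form a closed set: a curve that is not of this form violates \<open>\<gamma> t = time_shift (T t) (\<gamma> 0)\<close>
  at some \<open>t\<close>, and disjoint neighbourhoods of the two points give a neighbourhood of \<open>\<gamma>\<close> in which the
  equation fails.\<close>

lemma sets_range_vertical:
  assumes sep: "separates_points TYPE('a::topological_space)"
  shows "range (vertical T :: real \<times> 'a \<Rightarrow> _) \<in> sets unit_curves_borel"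
proof -
  let ?G = "\<lambda>t. {A. \<exists>U W. open U \<and> open W \<and> U \<inter> time_shift (T * t) ` W = {} \<and>
       A = {\<gamma> \<in> unit_curves. \<gamma> ` {t} \<subseteq> U} \<inter> {\<gamma> \<in> unit_curves. \<gamma> ` {0} \<subseteq> (W :: (real \<times> 'a) set)}}"
  let ?O = "\<Union>t\<in>{0..1}. \<Union>(?G t)"
  have "openin unit_curves_topology ?O"
  proof (intro openin_Union, elim imageE, hypsubst, intro openin_Union)
    fix t B assume t: "t \<in> {0..1 :: real}" and "B \<in> ?G t"
    then obtain U W where UW: "open U" "open W"
      "B = {\<gamma> \<in> unit_curves. \<gamma> ` {t} \<subseteq> U} \<inter> {\<gamma> \<in> unit_curves. \<gamma> ` {0} \<subseteq> W}" by blast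
    show "openin unit_curves_topology B"
      unfolding UW(3) using t UW(1,2) by (intro openin_Int openin_unit_curves_generator) simp_all
  qed
  moreover have "range (vertical T :: real \<times> 'a \<Rightarrow> _) = unit_curves - ?O"
  proof (intro equalityI subsetI)
    fix \<gamma> :: "real \<Rightarrow> real \<times> 'a" assume "\<gamma> \<in> range (vertical T)"
    then obtain y where y: "\<gamma> = vertical T y" by blast
    have "\<gamma> \<notin> ?O"
    proof
      assume "\<gamma> \<in> ?O"
      then obtain t A where tA: "t \<in> {0..1}" "A \<in> ?G t" "\<gamma> \<in> A" by (elim UN_E UnionE)
      from tA(2) obtain U W where UW: "U \<inter> time_shift (T * t) ` W = {}"
        "A = {\<gamma> \<in> unit_curves. \<gamma> ` {t} \<subseteq> U} \<inter> {\<gamma> \<in> unit_curves. \<gamma> ` {0} \<subseteq> W}"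
        by (elim CollectE exE conjE)
      from tA(3) have "\<gamma> t \<in> U" "\<gamma> 0 \<in> W" unfolding UW(2) by simp_all
      note t = tA(1) UW(1) this
      have "\<gamma> t = time_shift (T * t) (\<gamma> 0)" using t(1) by (simp add: y vertical_eval)
      with t show False by blast
    qed
    then show "\<gamma> \<in> unit_curves - ?O"
    proof (rule DiffI[rotated])
      show "\<gamma> \<in> unit_curves" by (simp add: y vertical_in_unit_curves)
    qed
  next
    fix \<gamma> :: "real \<Rightarrow> real \<times> 'a" assume g: "\<gamma> \<in> unit_curves - ?O"
    have eq: "\<gamma> t = time_shift (T * t) (\<gamma> 0)" if t: "t \<in> {0..1}" for t
    proof (rule ccontr)
      assume "\<gamma> t \<noteq> time_shift (T * t) (\<gamma> 0)"
      from separates_points_product[OF sep this] obtain U V where UV: "open U" "open V" "\<gamma> t \<in> U" "time_shift (T * t) (\<gamma> 0) \<in> V" "U \<inter> V = {}"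
        by (elim exE conjE)
      have "open (time_shift (T * t) -` V)" by (rule open_vimage[OF UV(2) continuous_time_shift])
      moreover have "U \<inter> time_shift (T * t) ` (time_shift (T * t) -` V) = {}" using UV(5) by blast
      ultimately have "{\<gamma> \<in> unit_curves. \<gamma> ` {t} \<subseteq> U} \<inter> {\<gamma> \<in> unit_curves. \<gamma> ` {0} \<subseteq> time_shift (T * t) -` V} \<in> ?G t"
        using UV(1)
        by - (rule CollectI, rule exI[of _ U], rule exI[of _ "time_shift (T * t) -` V"], intro conjI refl)
      then have "{\<gamma> \<in> unit_curves. \<gamma> ` {t} \<subseteq> U} \<inter> {\<gamma> \<in> unit_curves. \<gamma> ` {0} \<subseteq> time_shift (T * t) -` V} \<subseteq> ?O"
        by (intro Union_upper order_trans[OF Union_upper UN_upper[OF t]])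
      moreover have "\<gamma> \<in> {\<gamma> \<in> unit_curves. \<gamma> ` {t} \<subseteq> U} \<inter> {\<gamma> \<in> unit_curves. \<gamma> ` {0} \<subseteq> time_shift (T * t) -` V}"
        using DiffD1[OF g] UV(3,4) by simp
      ultimately have "\<gamma> \<in> ?O" by (rule subsetD)
      from DiffD2[OF g this] show False .
    qed
    have "\<gamma> = vertical T (\<gamma> 0)"
    proof
      fix t show "\<gamma> t = vertical T (\<gamma> 0) t"
      proof (cases "t \<in> {0..1}")
        case True
        then show ?thesis using eq[OF True] by (simp add: vertical_eval)
      next
        case False
        then show ?thesis using g by (auto simp: vertical_def unit_curves_def extensional_def)
      qed
    qed
    then show "\<gamma> \<in> range (vertical T)" by blast
  qed
  moreover have "(unit_curves :: (real \<Rightarrow> real \<times> 'a) set) \<in> sets unit_curves_borel"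
    using sets.top[of unit_curves_borel] by simp
  ultimately show ?thesis using openin_imp_sets_unit_curves[of ?O] by auto
qed

section \<open>Optimal transport along the time axis\<close>

lemma ennpow_ennreal: "0 \<le> r \<Longrightarrow> ennpow (ennreal r) p = ennreal (r powr p)"
  by (simp add: ennpow_def)

lemma ennpow_mono:
  assumes "x \<le> y" "0 \<le> p"
  shows "ennpow x p \<le> ennpow y p"
proof (cases "y = \<infinity>")
  case False
  then have "x \<noteq> \<infinity>" using assms(1) by (auto simp: top_unique)
  moreover have "enn2real x \<le> enn2real y" using assms(1) False by (intro enn2real_mono) (auto simp: less_top)
  ultimately show ?thesis using False assms(2) by (auto simp: ennpow_def intro!: ennreal_leI powr_mono2)
qed (simp add: ennpow_def)

text \<open>With \<open>L = ln x\<close> this is the strict weighted inequality of arithmetic and geometric means for \<open>x\<close> and \<open>1\<close>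
  with weights \<open>p\<close> and \<open>1 - p\<close>. Both terms are divided by \<open>exp (p L)\<close>, after which it follows from
  \<open>1 + u < exp u\<close> for \<open>u \<noteq> 0\<close>.\<close>

lemma powr_less_tangent:
  fixes x p :: real
  assumes p: "0 < p" "p < 1" and x: "0 \<le> x" "x \<noteq> 1"
  shows "x powr p < 1 + p * (x - 1)"
proof (cases "x = 0")
  case False
  with x have x0: "x > 0" by simp
  define L where "L = ln x"
  have L: "L \<noteq> 0" using x0 x by (simp add: L_def)
  have strict: "1 + u < exp u" if "u \<noteq> 0" for u :: real
  proof -
    have "1 + u \<noteq> exp u" using that ln_eq_minus_one[of "exp u"] by auto
    with exp_ge_add_one_self[of u] show ?thesis by (rule le_neq_trans)
  qed
  have "p * (1 + (1 - p) * L) + (1 - p) * (1 + (- p * L)) < p * exp ((1 - p) * L) + (1 - p) * exp (- p * L)"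
    using p L by (intro add_strict_mono mult_strict_left_mono strict) auto
  then have "1 < p * exp ((1 - p) * L) + (1 - p) * exp (- p * L)" by (simp add: algebra_simps)
  then have "exp (p * L) * 1 < exp (p * L) * (p * exp ((1 - p) * L) + (1 - p) * exp (- p * L))"
    by (intro mult_strict_left_mono) auto
  also have "\<dots> = p * (exp (p * L) * exp ((1 - p) * L)) + (1 - p) * (exp (p * L) * exp (- p * L))"
    by (simp add: algebra_simps)
  also have "exp (p * L) * exp ((1 - p) * L) = x"
    using x0 by (simp add: exp_add[symmetric] L_def algebra_simps)
  also have "exp (p * L) * exp (- p * L) = 1" by (simp add: exp_add[symmetric])
  finally show ?thesis using x0 by (simp add: powr_def L_def algebra_simps)
qed (use p in simp)

text \<open>The function \<open>h\<close> is the tangent of \<open>r \<mapsto> r powr p\<close> at the mean \<open>T\<close>, composed with \<open>r\<close>. Strict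
  concavity identifies the case of equality.\<close>

lemma jensen_powr:
  fixes r :: "'b \<Rightarrow> real"
  assumes P: "prob_space P" and r: "integrable P r" "AE x in P. 0 \<le> r x" "(LINT x|P. r x) = T"
    and T: "0 < T" and p: "0 < p" "p < 1"
  shows "(\<integral>\<^sup>+x. ennreal (r x powr p) \<partial>P) \<le> ennreal (T powr p)"
    and "ennreal (T powr p) \<le> (\<integral>\<^sup>+x. ennreal (r x powr p) \<partial>P) \<Longrightarrow> AE x in P. r x = T"
proof -
  interpret prob_space P by fact
  \<comment> \<open>the mean of \<open>h\<close> is its value \<open>T powr p\<close> at the mean, since \<open>h\<close> is affine in \<open>r\<close>\<close>
  define h where "h x = T powr p * (1 + p * (r x / T - 1))" for x
  have [measurable]: "r \<in> borel_measurable P" using r by auto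
  have h: "integrable P h" unfolding h_def using r by (intro integrable_mult_right integrable_add integrable_diff integrable_divide) auto
  have "(LINT x|P. h x) = T powr p * (1 + p * (T / T - 1))"
    unfolding h_def using r by (simp add: prob_space)
  then have hT: "(LINT x|P. h x) = T powr p" using T by simp
  have scale: "r x powr p = T powr p * (r x / T) powr p" if "0 \<le> r x" for x
    using that T by (simp add: powr_divide)
  have Tp: "0 < T powr p" using T by simp
  have le: "r x powr p \<le> h x" if "0 \<le> r x" for x
  proof (cases "r x / T = 1")
    case True
    then show ?thesis using T unfolding scale[OF that] h_def by simp
  next
    case False
    then have "(r x / T) powr p < 1 + p * (r x / T - 1)"
      using that T by (intro powr_less_tangent p) auto
    then show ?thesis unfolding scale[OF that] h_def using Tp by (intro mult_left_mono) auto
  qed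
  have hn: "AE x in P. 0 \<le> h x" using r(2) by eventually_elim (use le in \<open>meson order_trans powr_ge_zero\<close>)
  have nh: "(\<integral>\<^sup>+x. ennreal (h x) \<partial>P) = ennreal (T powr p)"
    using nn_integral_eq_integral[OF h hn] hT by simp
  have le_AE: "AE x in P. ennreal (r x powr p) \<le> ennreal (h x)"
    using r(2) by eventually_elim (intro ennreal_leI le)
  show "(\<integral>\<^sup>+x. ennreal (r x powr p) \<partial>P) \<le> ennreal (T powr p)"
    unfolding nh[symmetric] by (rule nn_integral_mono_AE[OF le_AE])
  assume ge: "ennreal (T powr p) \<le> (\<integral>\<^sup>+x. ennreal (r x powr p) \<partial>P)"
  have "AE x in P. ennreal (r x powr p) = ennreal (h x)"
    by (rule nn_integral_eq_imp_AE_eq[OF _ le_AE]) (use h ge in \<open>auto simp: nh\<close>)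
  with r(2) hn show "AE x in P. r x = T"
  proof eventually_elim
    case (elim x)
    then have eq: "r x powr p = h x" by simp
    show "r x = T"
    proof (rule ccontr)
      assume "r x \<noteq> T"
      then have "r x / T \<noteq> 1" using T by simp
      then have "(r x / T) powr p < 1 + p * (r x / T - 1)"
        using elim T by (intro powr_less_tangent p) auto
      then have "r x powr p < h x" unfolding scale[OF elim(1)] h_def using Tp by (intro mult_strict_left_mono)
      with eq show False by simp
    qed
  qed
qed

definition compactly_supported :: "'b::topological_space measure \<Rightarrow> bool" where
  "compactly_supported \<mu> \<longleftrightarrow> (\<exists>K. compact K \<and> (AE y in \<mu>. y \<in> K))"

lemma integrable_fst:
  fixes \<mu> :: "(real \<times> 'a::topological_space) measure"
  assumes \<mu>: "\<mu> \<in> prob_measures" "compactly_supported \<mu>"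
  shows "integrable \<mu> fst"
proof -
  interpret prob_space \<mu> using \<mu> by (simp add: prob_measures_def)
  have s: "sets \<mu> = sets borel" using \<mu> by (simp add: prob_measures_def)
  obtain K where K: "compact K" "AE y in \<mu>. y \<in> K" using \<mu>(2) by (auto simp: compactly_supported_def)
  have "compact (fst ` K)" using K(1) by (intro compact_continuous_image continuous_intros)
  then obtain B where B: "\<And>s. s \<in> fst ` K \<Longrightarrow> \<bar>s\<bar> \<le> B"
    using compact_imp_bounded by (fastforce simp: bounded_iff)
  show ?thesis
  proof (rule integrable_const_bound)
    show "AE y in \<mu>. norm (fst y) \<le> B" using K(2) by eventually_elim (use B in auto)
    show "fst \<in> borel_measurable \<mu>" using measurable_fst_borel by (simp add: measurable_cong_sets[OF s refl])
  qed
qed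

text \<open>The transport of a compactly supported probability measure to its translate by the time \<open>T\<close>.\<close>

locale vertical_transport =
  fixes d :: "real \<Rightarrow> 'a::topological_space \<Rightarrow> 'a \<Rightarrow> real" and \<mu> :: "(real \<times> 'a) measure" and T p :: real
  assumes mf: "metric_family d" and \<mu>: "\<mu> \<in> prob_measures" "compactly_supported \<mu>"
    and T: "0 < T" and p: "0 < p" "p < 1"
begin

abbreviation "\<nu> \<equiv> distr \<mu> borel (time_shift T)"

lemma M: "Metric_space UNIV (d s)" using mf by (simp add: metric_family_def)

lemma sets_mu [measurable_cong]: "sets \<mu> = sets borel" using \<mu> by (simp add: prob_measures_def)

lemma space_mu [simp]: "space \<mu> = UNIV" using sets_eq_imp_space_eq[OF sets_mu] by simp

text \<open>The mean elapsed time depends on the marginals only. Here \<open>P\<close> is either a coupling or a measure on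
  curves, with \<open>X\<close> and \<open>Y\<close> giving the initial and the final point.\<close>

lemma integral_fst_diff:
  assumes P: "prob_space P" and X: "X \<in> P \<rightarrow>\<^sub>M borel" "distr P borel X = \<mu>"
    and Y: "Y \<in> P \<rightarrow>\<^sub>M borel" "distr P borel Y = \<nu>"
  shows "integrable P (\<lambda>z. fst (Y z) - fst (X z))" and "(LINT z|P. fst (Y z) - fst (X z)) = T"
proof -
  interpret \<mu>: prob_space \<mu> using \<mu> by (simp add: prob_measures_def)
  have if\<mu>: "integrable \<mu> fst" using integrable_fst[OF \<mu>] .
  have "integrable \<mu> (\<lambda>y. fst y + T)" using if\<mu> by simp
  then have if\<nu>: "integrable \<nu> fst"
    by (subst integrable_distr_eq) auto
  have iX: "integrable P (\<lambda>z. fst (X z))"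
    using if\<mu> unfolding X(2)[symmetric] by (subst (asm) integrable_distr_eq[OF X(1)]) auto
  have iY: "integrable P (\<lambda>z. fst (Y z))"
    using if\<nu> unfolding Y(2)[symmetric] by (subst (asm) integrable_distr_eq[OF Y(1)]) auto
  show "integrable P (\<lambda>z. fst (Y z) - fst (X z))" using iX iY by simp
  have "(LINT z|P. fst (Y z)) = (LINT y|\<nu>. fst y)"
    unfolding Y(2)[symmetric] by (rule integral_distr[OF Y(1), symmetric]) simp
  also have "\<dots> = (LINT y|\<mu>. fst y + T)" by (subst integral_distr) auto
  also have "\<dots> = (LINT y|\<mu>. fst y) + T" using if\<mu> \<mu>.prob_space by simp
  also have "(LINT y|\<mu>. fst y) = (LINT z|P. fst (X z))"
    unfolding X(2)[symmetric] by (rule integral_distr[OF X(1)]) simp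
  finally show "(LINT z|P. fst (Y z) - fst (X z)) = T" using iX iY by simp
qed

text \<open>The cost is at most the mean of the \<open>p\<close>-th power of the elapsed time, whose mean is \<open>T\<close>.\<close>

lemma coupling_cost_le:
  assumes "\<pi> \<in> causal_couplings d \<mu> \<nu>"
  shows "(\<integral>\<^sup>+z. ennpow (time_sep d (fst z) (snd z)) p \<partial>\<pi>) \<le> ennreal (T powr p)"
proof -
  have s: "sets \<pi> = sets borel" and P: "prob_space \<pi>" and X: "distr \<pi> borel fst = \<mu>" "distr \<pi> borel snd = \<nu>"
    and c: "AE z in \<pi>. causal_le d (fst z) (snd z)"
    using assms by (auto simp: causal_couplings_def prob_measures_def case_prod_beta)
  have m: "fst \<in> \<pi> \<rightarrow>\<^sub>M borel" "snd \<in> \<pi> \<rightarrow>\<^sub>M borel"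
    using measurable_fst_borel measurable_snd_borel by (simp_all add: measurable_cong_sets[OF s refl])
  note I = integral_fst_diff[OF P m(1) X(1) m(2) X(2)]
  have nn: "AE z in \<pi>. 0 \<le> fst (snd z) - fst (fst z)"
    using c by eventually_elim (simp add: causal_le_fst)
  have "(\<integral>\<^sup>+z. ennpow (time_sep d (fst z) (snd z)) p \<partial>\<pi>) \<le> (\<integral>\<^sup>+z. ennreal ((fst (snd z) - fst (fst z)) powr p) \<partial>\<pi>)"
  proof (rule nn_integral_mono_AE)
    show "AE z in \<pi>. ennpow (time_sep d (fst z) (snd z)) p \<le> ennreal ((fst (snd z) - fst (fst z)) powr p)"
      using nn by eventually_elim (use ennpow_mono[OF time_sep_le] p ennpow_ennreal in \<open>metis less_imp_le\<close>)
  qed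
  also have "\<dots> \<le> ennreal (T powr p)" by (rule jensen_powr(1)[OF P I(1) nn I(2) T p])
  finally show ?thesis .
qed

lemma vertical_coupling:
  defines "\<pi> \<equiv> distr \<mu> borel (\<lambda>y. (y, time_shift T y))"
  shows "\<pi> \<in> causal_couplings d \<mu> \<nu>"
    and "(\<integral>\<^sup>+z. ennpow (time_sep d (fst z) (snd z)) p \<partial>\<pi>) = ennreal (T powr p)"
proof -
  interpret \<mu>: prob_space \<mu> using \<mu> by (simp add: prob_measures_def)
  have m: "(\<lambda>y. (y, time_shift T y)) \<in> \<mu> \<rightarrow>\<^sub>M borel"
    unfolding measurable_cong_sets[OF sets_mu refl] time_shift_def
    by (intro borel_measurable_continuous_onI continuous_intros)
  have sets: "sets \<pi> = sets borel" by (simp add: \<pi>_def)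
  have P: "prob_space \<pi>" unfolding \<pi>_def by (rule \<mu>.prob_space_distr[OF m])
  let ?G = "{z :: (real \<times> 'a) \<times> (real \<times> 'a). snd z = time_shift T (fst z)}"
  have G: "?G \<in> sets borel" by (intro borel_closed closed_shift_graph separates_points_of_metric_family[OF mf])
  have "AE z in \<pi>. z \<in> ?G"
    unfolding \<pi>_def by (subst AE_distr_iff[OF m]) (use G in auto)
  then have graph: "AE z in \<pi>. snd z = time_shift T (fst z)" by simp
  have d1: "distr \<pi> borel fst = \<mu>"
  proof -
    have "distr \<pi> borel fst = distr \<mu> borel (fst \<circ> (\<lambda>y. (y, time_shift T y)))"
      unfolding \<pi>_def by (rule distr_distr[OF _ m]) measurable
    also have "\<dots> = distr \<mu> \<mu> (\<lambda>y. y)" by (rule distr_cong) (auto simp: sets_mu)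
    finally show ?thesis by simp
  qed
  have d2: "distr \<pi> borel snd = \<nu>"
  proof -
    have "distr \<pi> borel snd = distr \<mu> borel (snd \<circ> (\<lambda>y. (y, time_shift T y)))"
      unfolding \<pi>_def by (rule distr_distr[OF _ m]) measurable
    then show ?thesis by (simp add: comp_def)
  qed
  have shape: "z = ((fst (fst z), snd (fst z)), (fst (fst z) + T, snd (fst z)))" if "snd z = time_shift T (fst z)" for z :: "(real \<times> 'a) \<times> (real \<times> 'a)"
    using that by (simp add: time_shift_def prod_eq_iff)
  have "AE z in \<pi>. causal_le d (fst z) (snd z)"
    using graph
  proof eventually_elim
    case (elim z)
    show ?case using vertical_causal_le[where d = d and r = T and s = "fst (fst z)" and x = "snd (fst z)", OF M] T shape[OF elim] by (metis fst_conv less_imp_le snd_conv)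
  qed
  then show "\<pi> \<in> causal_couplings d \<mu> \<nu>"
    using d1 d2 P sets by (simp add: causal_couplings_def prob_measures_def case_prod_beta)
  have "(\<integral>\<^sup>+z. ennpow (time_sep d (fst z) (snd z)) p \<partial>\<pi>) = (\<integral>\<^sup>+z. ennreal (T powr p) \<partial>\<pi>)"
  proof (rule nn_integral_cong_AE)
    show "AE z in \<pi>. ennpow (time_sep d (fst z) (snd z)) p = ennreal (T powr p)"
      using graph
    proof eventually_elim
      case (elim z)
      have "time_sep d (fst z) (snd z) = ennreal T"
        using vertical_time_sep[where d = d and r = T and s = "fst (fst z)" and x = "snd (fst z)", OF M] T shape[OF elim] by (metis fst_conv less_imp_le snd_conv)
      then show ?case using T by (simp add: ennpow_ennreal)
    qed
  qed
  also have "\<dots> = ennreal (T powr p)" using prob_space.emeasure_space_1[OF P] by simp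
  finally show "(\<integral>\<^sup>+z. ennpow (time_sep d (fst z) (snd z)) p \<partial>\<pi>) = ennreal (T powr p)" .
qed

lemma powr_inverse: "ennpow (ennreal (T powr p)) (1 / p) = ennreal T"
  using T p by (simp add: ennpow_ennreal powr_powr)

lemma lorentz_wasserstein_vertical: "lorentz_wasserstein d p \<mu> \<nu> = ennreal T"
proof (rule antisym)
  show "lorentz_wasserstein d p \<mu> \<nu> \<le> ennreal T"
    unfolding lorentz_wasserstein_def powr_inverse[symmetric]
    by (intro SUP_least ennpow_mono coupling_cost_le) (use p in auto)
  show "ennreal T \<le> lorentz_wasserstein d p \<mu> \<nu>"
    unfolding lorentz_wasserstein_def
    by (rule SUP_upper2[OF vertical_coupling(1)]) (simp add: vertical_coupling(2) powr_inverse)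
qed

lemma cost_eq: "ennpow (lorentz_wasserstein d p \<mu> \<nu>) p = ennreal (T powr p)"
  using T by (simp add: lorentz_wasserstein_vertical ennpow_ennreal)

lemma vertical_plan_optimal: "distr \<mu> unit_curves_borel (vertical T) \<in> opt_plans d p \<mu> \<nu>"
proof -
  interpret \<mu>: prob_space \<mu> using \<mu> by (simp add: prob_measures_def)
  let ?\<eta> = "distr \<mu> unit_curves_borel (vertical T)"
  have m: "vertical T \<in> \<mu> \<rightarrow>\<^sub>M unit_curves_borel"
    unfolding measurable_cong_sets[OF sets_mu refl] by (rule measurable_vertical)
  have P: "prob_space ?\<eta>" by (rule \<mu>.prob_space_distr[OF m])
  have R: "range (vertical T :: real \<times> 'a \<Rightarrow> _) \<in> sets unit_curves_borel"
    by (rule sets_range_vertical[OF separates_points_of_metric_family[OF mf]])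
  have "{\<gamma> \<in> space unit_curves_borel. \<gamma> \<in> range (vertical T :: real \<times> 'a \<Rightarrow> _)} = range (vertical T)"
    using sets.sets_into_space[OF R] by auto
  then have ae: "AE \<gamma> in ?\<eta>. \<gamma> \<in> range (vertical T)"
    by (subst AE_distr_iff[OF m]) (use R in auto)
  have e: "distr ?\<eta> borel (\<lambda>\<gamma>. \<gamma> t) = distr \<mu> borel (time_shift (T * t))" if t: "t \<in> {0..1}" for t
  proof -
    have "distr ?\<eta> borel (\<lambda>\<gamma>. \<gamma> t) = distr \<mu> borel ((\<lambda>\<gamma>. \<gamma> t) \<circ> vertical T)"
      by (rule distr_distr[OF measurable_eval[OF t] m])
    also have "(\<lambda>\<gamma>. \<gamma> t) \<circ> vertical T = time_shift (T * t)" using vertical_eval[OF t] by (auto simp: fun_eq_iff)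
    finally show ?thesis .
  qed
  have "distr \<mu> borel (time_shift 0) = distr \<mu> \<mu> (\<lambda>y. y)" by (rule distr_cong) (auto simp: sets_mu)
  then have e0: "distr ?\<eta> borel (\<lambda>\<gamma>. \<gamma> 0) = \<mu>" using e[of 0] by simp
  have e1: "distr ?\<eta> borel (\<lambda>\<gamma>. \<gamma> 1) = \<nu>" using e[of 1] by simp
  have "(\<integral>\<^sup>+\<gamma>. ennpow (causal_length d 0 1 \<gamma>) p \<partial>?\<eta>) = (\<integral>\<^sup>+\<gamma>. ennreal (T powr p) \<partial>?\<eta>)"
    by (rule nn_integral_cong_AE, rule eventually_mono[OF ae])
      (use vertical_opt_curve(2)[OF M T] T in \<open>auto simp: ennpow_ennreal\<close>)
  also have "\<dots> = ennreal (T powr p)" using prob_space.emeasure_space_1[OF P] by simp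
  finally have c: "ennpow (lorentz_wasserstein d p \<mu> \<nu>) p = (\<integral>\<^sup>+\<gamma>. ennpow (causal_length d 0 1 \<gamma>) p \<partial>?\<eta>)"
    by (simp add: cost_eq)
  have "AE \<gamma> in ?\<eta>. \<gamma> \<in> opt_curves d"
    using ae by eventually_elim (use vertical_opt_curve(1)[OF M T] in auto)
  then show ?thesis using P e0 e1 c by (simp add: opt_plans_def)
qed

text \<open>Optimality says that the mean of the \<open>p\<close>-th power of the length is \<open>T powr p\<close>. The length is at most the
  duration, so Jensen's inequality is an equality for the duration, which is therefore \<open>T\<close> almost
  surely. Then the length is at most \<open>T\<close> with mean \<open>p\<close>-th power \<open>T powr p\<close>, so it is also \<open>T\<close>. Rigidity
  applies to almost every curve.\<close>

lemma optimal_plan_marginal: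
  assumes \<eta>: "\<eta> \<in> opt_plans d p \<mu> \<nu>" and t: "t \<in> {0..1}"
  shows "distr \<eta> borel (\<lambda>\<gamma>. \<gamma> t) = distr \<mu> borel (time_shift (T * t))"
proof -
  have s: "sets \<eta> = sets unit_curves_borel" and P: "prob_space \<eta>"
    and opt: "AE \<gamma> in \<eta>. \<gamma> \<in> opt_curves d"
    and e0: "distr \<eta> borel (\<lambda>\<gamma>. \<gamma> 0) = \<mu>" and e1: "distr \<eta> borel (\<lambda>\<gamma>. \<gamma> 1) = \<nu>"
    and c: "ennreal (T powr p) = (\<integral>\<^sup>+\<gamma>. ennpow (causal_length d 0 1 \<gamma>) p \<partial>\<eta>)"
    using \<eta> by (auto simp: opt_plans_def cost_eq)
  have m: "(\<lambda>\<gamma>. \<gamma> t) \<in> \<eta> \<rightarrow>\<^sub>M borel" if "t \<in> {0..1}" for t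
    using measurable_eval[OF that] by (simp add: measurable_cong_sets[OF s refl])
  let ?r = "\<lambda>\<gamma> :: real \<Rightarrow> real \<times> 'a. fst (\<gamma> 1) - fst (\<gamma> 0)"
  have I: "integrable \<eta> ?r" "(LINT \<gamma>|\<eta>. ?r \<gamma>) = T"
    using integral_fst_diff[OF P m e0 m e1] by simp_all
  have len: "AE \<gamma> in \<eta>. causal_length d 0 1 \<gamma> \<le> ennreal (?r \<gamma>) \<and> 0 \<le> ?r \<gamma>"
    using opt
  proof eventually_elim
    case (elim \<gamma>)
    then have "causal_curve d 0 1 \<gamma>" by (auto simp: opt_curves_def intro: timelike_imp_causal)
    then show ?case using causal_length_le[of d 0 1 \<gamma>] by simp
  qed
  then have nn: "AE \<gamma> in \<eta>. 0 \<le> ?r \<gamma>" by eventually_elim simp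
  have "ennreal (T powr p) \<le> (\<integral>\<^sup>+\<gamma>. ennreal (?r \<gamma> powr p) \<partial>\<eta>)"
    unfolding c
  proof (rule nn_integral_mono_AE)
    show "AE \<gamma> in \<eta>. ennpow (causal_length d 0 1 \<gamma>) p \<le> ennreal (?r \<gamma> powr p)"
      using len
    proof eventually_elim
      case (elim \<gamma>)
      then show ?case using ennpow_mono[of "causal_length d 0 1 \<gamma>" "ennreal (?r \<gamma>)" p] p by (simp add: ennpow_ennreal)
    qed
  qed
  then have rT: "AE \<gamma> in \<eta>. ?r \<gamma> = T" by (rule jensen_powr(2)[OF P I(1) nn I(2) T p])
  have "AE \<gamma> in \<eta>. ennpow (causal_length d 0 1 \<gamma>) p = ennreal (T powr p)"
  proof (rule nn_integral_eq_imp_AE_eq)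
    show "AE \<gamma> in \<eta>. ennpow (causal_length d 0 1 \<gamma>) p \<le> ennreal (T powr p)"
      using len rT
    proof eventually_elim
      case (elim \<gamma>)
      then show ?case using ennpow_mono[of "causal_length d 0 1 \<gamma>" "ennreal T" p] p T by (simp add: ennpow_ennreal)
    qed
  qed (simp_all add: c[symmetric] prob_space.emeasure_space_1[OF P])
  then have "AE \<gamma> in \<eta>. causal_length d 0 1 \<gamma> = ennreal T"
    using len
  proof eventually_elim
    case (elim \<gamma>)
    then obtain l where l: "causal_length d 0 1 \<gamma> = ennreal l" "0 \<le> l"
      by (metis ennreal_cases ennreal_less_top not_le)
    then have "l powr p = T powr p" using elim(1) by (simp add: ennpow_ennreal)
    moreover have "l = (l powr p) powr (1 / p)" "T = (T powr p) powr (1 / p)"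
      using l(2) T p by (simp_all add: powr_powr)
    ultimately have "l = T" by simp
    then show ?case using l by simp
  qed
  with opt rT have "AE \<gamma> in \<eta>. \<gamma> t = time_shift (T * t) (\<gamma> 0)"
  proof eventually_elim
    case (elim \<gamma>)
    have "\<gamma> = vertical T (\<gamma> 0)" using elim by (intro opt_curve_rigid[OF mf _ T]) auto
    then show ?case by (metis vertical_eval[OF t])
  qed
  then have "distr \<eta> borel (\<lambda>\<gamma>. \<gamma> t) = distr \<eta> borel (\<lambda>\<gamma>. time_shift (T * t) (\<gamma> 0))"
    by (intro distr_cong_AE refl) (auto intro!: m t measurable_compose[OF m measurable_time_shift])
  also have "\<dots> = distr (distr \<eta> borel (\<lambda>\<gamma>. \<gamma> 0)) borel (time_shift (T * t))"
    by (subst distr_distr) (auto intro!: m simp: comp_def)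
  finally show ?thesis by (simp add: e0)
qed

end

section \<open>Entropy\<close>

lemma ereal_exp_ereal [simp]: "ereal_exp (ereal r) = ennreal (exp r)"
  by (simp add: ereal_exp_def)

lemma ereal_exp_minf [simp]: "ereal_exp (- \<infinity>) = 0"
  by (simp add: ereal_exp_def uminus_ereal.simps flip: uminus_ereal.simps) 

lemma Ent_eq_integral:
  fixes m \<mu> :: "'b measure"
  defines "\<rho> \<equiv> \<lambda>y. enn2real (RN_deriv m \<mu> y)"
  assumes d: "density m (\<lambda>y. ennreal (\<rho> y)) = \<mu>" and i: "integrable m (\<lambda>y. \<rho> y * ln (\<rho> y))"
  shows "Ent m \<mu> = ereal (LINT y|m. \<rho> y * ln (\<rho> y))"
proof -
  let ?f = "\<lambda>y. \<rho> y * ln (\<rho> y)"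
  let ?pos = "\<integral>\<^sup>+y. ennreal (?f y) \<partial>m" and ?neg = "\<integral>\<^sup>+y. ennreal (- ?f y) \<partial>m"
  have le: "?pos \<le> (\<integral>\<^sup>+y. ennreal (norm (?f y)) \<partial>m)" "?neg \<le> (\<integral>\<^sup>+y. ennreal (norm (?f y)) \<partial>m)"
    by (intro nn_integral_mono ennreal_leI; simp)+
  moreover have "(\<integral>\<^sup>+y. ennreal (norm (?f y)) \<partial>m) < \<infinity>" using i by (simp add: integrable_iff_bounded)
  ultimately have fin: "?pos < \<infinity>" "?neg < \<infinity>" by (blast intro: le_less_trans)+
  have "Ent m \<mu> = enn2ereal ?pos - enn2ereal ?neg"
    unfolding Ent_def Let_def using d fin(1) unfolding \<rho>_def by simp
  also have "enn2ereal ?pos = ereal (enn2real ?pos)" using fin(1) by (cases ?pos) (auto simp: enn2ereal_ennreal)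
  also have "enn2ereal ?neg = ereal (enn2real ?neg)" using fin(2) by (cases ?neg) (auto simp: enn2ereal_ennreal)
  also have "ereal (enn2real ?pos) - ereal (enn2real ?neg) = ereal (LINT y|m. ?f y)"
    by (simp add: real_lebesgue_integral_def[OF i])
  finally show ?thesis .
qed

text \<open>The graph of \<open>x ln x\<close> lies above its tangent at \<open>c\<close>.\<close>

lemma x_ln_x_ge:
  fixes x c :: real
  assumes "0 \<le> x" "0 < c"
  shows "x * ln c + x - c \<le> x * ln x"
proof (cases "x = 0")
  case False
  then have x: "0 < x" using assms by simp
  have "ln (c / x) \<le> c / x - 1" using x assms by (intro ln_le_minus_one) simp
  then have "x * ln (c / x) \<le> x * (c / x - 1)" using x by (intro mult_left_mono) auto
  also have "\<dots> = c - x" using x by (simp add: right_diff_distrib)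
  also have "ln (c / x) = ln c - ln x" using x assms by (simp add: ln_div)
  finally show ?thesis by (simp add: algebra_simps)
qed (use assms in simp)

text \<open>Jensen's inequality for \<open>x ln x\<close>: among the probability measures carried by \<open>B\<close> the uniform
  distribution has the smallest entropy. The tangent at the value \<open>1 / k\<close> of the uniform density is integrated
  over \<open>B\<close>; the tangent at \<open>1\<close> shows that the negative part of \<open>\<rho> ln \<rho>\<close> is integrable.\<close>

lemma exp_entropy_le:
  fixes m \<mu> :: "'b measure"
  assumes s: "sets \<mu> = sets m" and P: "prob_space \<mu>" and B: "B \<in> sets m" "AE y in \<mu>. y \<in> B"
    and fin: "emeasure m B = ennreal k" "0 \<le> k" and N: "1 \<le> N"
  shows "ereal_exp (- Ent m \<mu> / ereal N) \<le> ennreal (k powr (1 / N))"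
proof -
  interpret prob_space \<mu> by fact
  define \<rho> where "\<rho> y = enn2real (RN_deriv m \<mu> y)" for y
  let ?f = "\<lambda>y. \<rho> y * ln (\<rho> y)"
  have [measurable]: "\<rho> \<in> borel_measurable m" unfolding \<rho>_def by measurable
  have \<rho>0: "0 \<le> \<rho> y" for y by (simp add: \<rho>_def)
  show ?thesis
  proof (cases "density m (\<lambda>y. ennreal (\<rho> y)) = \<mu> \<and> (\<integral>\<^sup>+y. ennreal (?f y) \<partial>m) < \<infinity>")
    case False
    then have "Ent m \<mu> = \<infinity>" unfolding Ent_def Let_def \<rho>_def by (simp only: if_not_P if_False)
    then have "- Ent m \<mu> / ereal N = - \<infinity>" using N by (simp add: divide_ereal_def)
    then show ?thesis by simp
  next
    case True
    then have d: "density m (\<lambda>y. ennreal (\<rho> y)) = \<mu>" and pos: "(\<integral>\<^sup>+y. ennreal (?f y) \<partial>m) < \<infinity>" by auto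
    have "AE y in m. 0 < ennreal (\<rho> y) \<longrightarrow> y \<in> B"
      using B(2) unfolding d[symmetric] by (subst (asm) AE_density) auto
    then have out: "AE y in m. y \<notin> B \<longrightarrow> \<rho> y = 0"
      by eventually_elim (use \<rho>0 in \<open>auto simp: less_le\<close>)
    have one: "(\<integral>\<^sup>+y. ennreal (\<rho> y) \<partial>m) = 1"
      using emeasure_space_1 unfolding d[symmetric] by (simp add: emeasure_density)
    have i\<rho>: "integrable m \<rho>"
      using one \<rho>0 by (intro integrableI_nonneg) auto
    have I\<rho>: "(LINT y|m. \<rho> y) = 1"
      using integral_eq_nn_integral[of \<rho> m] one \<rho>0 by simp
    have iB: "integrable m (indicator B :: _ \<Rightarrow> real)"
      using B(1) fin by (intro integrable_real_indicator) auto
    have IB: "(LINT y|m. indicator B y) = k"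
      using B(1) fin sets.sets_into_space[OF B(1)] by (simp add: measure_def Int_absorb2)
    have k: "k > 0"
    proof (rule ccontr)
      assume "\<not> k > 0"
      then have "emeasure m B = 0" using fin by simp
      then have "B \<in> null_sets m" using B(1) by auto
      from AE_not_in[OF this] out have "AE y in m. ennreal (\<rho> y) = 0" by eventually_elim auto
      then have "(\<integral>\<^sup>+y. ennreal (\<rho> y) \<partial>m) = 0" by (subst nn_integral_0_iff_AE) auto
      with one show False by simp
    qed
    have neg: "- ?f y \<le> indicator B y" if "y \<notin> B \<longrightarrow> \<rho> y = 0" for y
    proof (cases "y \<in> B")
      case True
      then show ?thesis using x_ln_x_ge[OF \<rho>0, of 1 y] \<rho>0[of y] by simp
    qed (use that in simp)
    have "(\<integral>\<^sup>+y. ennreal (- ?f y) \<partial>m) \<le> (\<integral>\<^sup>+y. ennreal (indicator B y) \<partial>m)"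
      by (rule nn_integral_mono_AE, rule eventually_mono[OF out]) (intro ennreal_leI neg)
    also have "\<dots> = emeasure m B" using B(1) by (simp add: nn_integral_indicator ennreal_indicator)
    also have "\<dots> < \<infinity>" using fin by simp
    finally have iF: "integrable m ?f"
      unfolding real_integrable_def using pos by auto
    \<comment> \<open>the integral of the tangent of \<open>x ln x\<close> at \<open>1 / k\<close>, extended by \<open>0\<close> outside \<open>B\<close>\<close>
    have "ln (1 / k) = (ln (1 / k) + 1) * (LINT y|m. \<rho> y) - 1 / k * (LINT y|m. indicator B y)"
      unfolding I\<rho> IB using k by simp
    also have "\<dots> = (LINT y|m. (ln (1 / k) + 1) * \<rho> y - 1 / k * indicator B y)"
      using i\<rho> iB by simp
    also have "\<dots> \<le> (LINT y|m. ?f y)"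
    proof (rule integral_mono_AE)
      show "AE y in m. (ln (1 / k) + 1) * \<rho> y - 1 / k * indicator B y \<le> ?f y"
        using out
      proof eventually_elim
        case (elim y)
        show ?case
        proof (cases "y \<in> B")
          case True
          then show ?thesis using x_ln_x_ge[OF \<rho>0[of y], of "1 / k"] k by (simp add: algebra_simps)
        qed (use elim in simp)
      qed
    qed (use i\<rho> iB iF in auto)
    finally have "- (LINT y|m. ?f y) \<le> ln k" using k by (simp add: ln_div)
    then have "- (LINT y|m. ?f y) / N \<le> ln k / N" using N by (intro divide_right_mono) auto
    then have "exp (- (LINT y|m. ?f y) / N) \<le> k powr (1 / N)" using k by (simp add: powr_def)
    moreover have "- Ent m \<mu> / ereal N = ereal (- (LINT y|m. ?f y) / N)"
      using Ent_eq_integral[of m \<mu>] d iF N unfolding \<rho>_def by simp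
    ultimately show ?thesis by (simp add: ennreal_leI)
  qed
qed

text \<open>The product measure need not be \<open>\<sigma>\<close>-finite, so the Radon--Nikodym density is identified by its
  uniqueness for finite measures.\<close>

lemma exp_entropy_uniform:
  fixes m :: "'b measure"
  assumes A: "A \<in> sets m" and k: "emeasure m A = ennreal k" "0 < k" and N: "1 \<le> N"
  shows "ereal_exp (- Ent m (uniform_measure m A) / ereal N) = ennreal (k powr (1 / N))"
proof -
  let ?\<mu> = "uniform_measure m A"
  define \<rho> where "\<rho> y = enn2real (RN_deriv m ?\<mu> y)" for y
  let ?u = "\<lambda>y. indicator A y / emeasure m A"
  have [measurable]: "A \<in> sets m" by (rule A)
  have u: "?u \<in> borel_measurable m" by measurable
  have du: "density m ?u = ?\<mu>" by (simp add: uniform_measure_def)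
  have dR: "density m (RN_deriv m ?\<mu>) = ?\<mu>" by (rule RN_derivI[OF u du])
  have "(\<integral>\<^sup>+y. ?u y \<partial>m) = emeasure m A / emeasure m A"
    by (simp add: nn_integral_divide)
  also have "\<dots> = 1" using k by (simp add: divide_ennreal)
  finally have "(\<integral>\<^sup>+y. ?u y \<partial>m) \<noteq> \<infinity>" by simp
  then have "AE y in m. ?u y = RN_deriv m ?\<mu> y"
    by (subst finite_density_unique[symmetric]) (use u du dR in auto)
  then have ae: "AE y in m. RN_deriv m ?\<mu> y = ennreal (\<rho> y) \<and> \<rho> y = indicator A y / k"
  proof eventually_elim
    case (elim y)
    have "?u y = ennreal (indicator A y / k)" using k divide_ennreal[of 1 k] by (simp add: indicator_def)
    with elim show ?case using k by (simp add: \<rho>_def)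
  qed
  have [measurable]: "\<rho> \<in> borel_measurable m" unfolding \<rho>_def by measurable
  have "density m (\<lambda>y. ennreal (\<rho> y)) = density m (RN_deriv m ?\<mu>)"
    by (rule density_cong) (use ae in auto)
  then have d: "density m (\<lambda>y. ennreal (\<rho> y)) = ?\<mu>" using dR by simp
  let ?f = "\<lambda>y. \<rho> y * ln (\<rho> y)"
  have iB: "integrable m (\<lambda>y. indicator A y * (1 / k * ln (1 / k)) :: real)"
    using A k by (intro integrable_mult_left integrable_real_indicator) auto
  have fe: "AE y in m. ?f y = indicator A y * (1 / k * ln (1 / k))"
    using ae by eventually_elim (auto simp: indicator_def)
  have iF: "integrable m ?f"
    using iB fe by (subst integrable_cong_AE[OF _ _ fe]) auto
  have "(LINT y|m. ?f y) = (LINT y|m. indicator A y * (1 / k * ln (1 / k)))"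
    by (rule integral_cong_AE[OF _ _ fe]) (use iB in auto)
  also have "\<dots> = measure m A * (1 / k * ln (1 / k))"
    using A sets.sets_into_space[OF A] by (simp add: Int_absorb2)
  also have "measure m A = k" using k by (simp add: measure_def)
  finally have "(LINT y|m. ?f y) = - ln k" using k by (simp add: ln_div)
  then have "Ent m ?\<mu> = ereal (- ln k)" using Ent_eq_integral[of m ?\<mu>] d iF unfolding \<rho>_def by simp
  then have "- Ent m ?\<mu> / ereal N = ereal (1 / N * ln k)" using N by simp
  then show ?thesis using k by (simp add: powr_def)
qed

section \<open>Disintegration of the product measure\<close>

lemma compact_imp_closed_separated:
  assumes sep: "\<And>x y :: 'b::topological_space. x \<noteq> y \<Longrightarrow> \<exists>U V. open U \<and> open V \<and> x \<in> U \<and> y \<in> V \<and> U \<inter> V = {}"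
    and K: "compact (K :: 'b set)"
  shows "closed K"
proof -
  have "Hausdorff_space (euclidean :: 'b topology)"
    unfolding Hausdorff_space_def disjnt_def using sep by simp
  moreover have "compactin euclidean K" using K by simp
  ultimately show ?thesis by (metis compactin_imp_closedin closed_closedin)
qed

lemma open_tube:
  fixes U :: "(real \<times> 'a::topological_space) set"
  assumes K: "compact K" and U: "open U"
  shows "open {x. \<forall>s\<in>K. (s, x) \<in> U}"
proof (rule topological_space_class.openI)
  fix x assume "x \<in> {x. \<forall>s\<in>K. (s, x) \<in> U}"
  then have x: "(s, x) \<in> U" if "s \<in> K" for s using that by blast
  let ?F = "\<lambda>z :: 'a \<times> real. (snd z, fst z)"
  have "continuous_on UNIV ?F" by (intro continuous_intros)
  then have W: "open (?F -` U)" by (rule open_vimage[OF U])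
  have "{x} \<times> K \<subseteq> ?F -` U"
  proof
    fix z assume "z \<in> {x} \<times> K"
    then have "fst z = x" "snd z \<in> K" by (simp_all add: mem_Times_iff)
    then show "z \<in> ?F -` U" using x by simp
  qed
  then have "\<exists>X0. x \<in> X0 \<and> open X0 \<and> X0 \<times> K \<subseteq> ?F -` U"
    by (intro Elementary_Topology.tube_lemma[OF K W])
  then obtain X0 where X0: "x \<in> X0" "open X0" "X0 \<times> K \<subseteq> ?F -` U" by (elim exE conjE)
  have "X0 \<subseteq> {x. \<forall>s\<in>K. (s, x) \<in> U}"
  proof (intro subsetI CollectI ballI)
    fix z s assume "z \<in> X0" "s \<in> K"
    then have "(z, s) \<in> ?F -` U" using X0(3) by blast
    then show "(s, z) \<in> U" by simp
  qed
  with X0 show "\<exists>T. open T \<and> x \<in> T \<and> T \<subseteq> {x. \<forall>s\<in>K. (s, x) \<in> U}" by blast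
qed

text \<open>The line has a countable base of intervals with compact closure, so an open set of the product is a
  countable union of rectangles, whatever the topology of the second factor.\<close>

lemma open_in_product_sigma:
  fixes U :: "(real \<times> 'a::topological_space) set"
  assumes U: "open U"
  shows "U \<in> sets (borel \<Otimes>\<^sub>M borel)"
proof -
  let ?V = "\<lambda>q r. {x. \<forall>s\<in>{q..r}. (s, x) \<in> U}"
  have "U = (\<Union>q\<in>\<rat>. \<Union>r\<in>\<rat>. {q<..<r} \<times> ?V q r)"
  proof (intro equalityI subsetI)
    fix z assume "z \<in> U"
    obtain s x where z: "z = (s, x)" by (cases z)
    from open_prod_elim[OF U \<open>z \<in> U\<close>] obtain A B where AB: "open A" "open B" "z \<in> A \<times> B" "A \<times> B \<subseteq> U" .
    then have "s \<in> A" "x \<in> B" by (simp_all add: z)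
    then obtain e where e: "e > 0" "ball s e \<subseteq> A" using AB(1) open_contains_ball by blast
    obtain q where q: "q \<in> \<rat>" "s - e < q" "q < s" using Rats_dense_in_real[of "s - e" s] e by auto
    obtain r where r: "r \<in> \<rat>" "s < r" "r < s + e" using Rats_dense_in_real[of s "s + e"] e by auto
    have "{q..r} \<subseteq> ball s e" using q r by (auto simp: dist_real_def)
    then have "{q..r} \<subseteq> A" using e(2) by (rule order_trans)
    then have "x \<in> ?V q r" using AB(4) \<open>x \<in> B\<close> by blast
    then have "z \<in> {q<..<r} \<times> ?V q r" using q r by (simp add: z)
    then show "z \<in> (\<Union>q\<in>\<rat>. \<Union>r\<in>\<rat>. {q<..<r} \<times> ?V q r)" using q(1) r(1) by blast
  qed auto
  also have "\<dots> \<in> sets (borel \<Otimes>\<^sub>M borel)"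
    by (intro sets.countable_UN' countable_rat image_subsetI pair_measureI borel_open open_tube U) auto
  finally show ?thesis .
qed

lemma sets_borel_subset_product:
  "sets (borel :: (real \<times> 'a::topological_space) measure) \<subseteq> sets (borel \<Otimes>\<^sub>M borel)"
proof -
  have "sigma_sets UNIV {U :: (real \<times> 'a) set. open U} \<subseteq> sets (borel \<Otimes>\<^sub>M borel)"
    using open_in_product_sigma by (intro sets.sigma_sets_subset') (auto simp: space_pair_measure intro: sets.top)
  then show ?thesis by (simp add: borel_def)
qed

lemma sets_section:
  fixes E :: "(real \<times> 'a::topological_space) set"
  assumes "E \<in> sets borel"
  shows "Pair s -` E \<in> sets borel"
proof -
  have "Pair s \<in> borel \<rightarrow>\<^sub>M (borel :: (real \<times> 'a) measure)"
    by (intro borel_measurable_continuous_onI continuous_intros)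
  from measurable_sets[OF this assms] show ?thesis by simp
qed

lemma sets_rectangle:
  fixes E :: "'a::topological_space set"
  assumes "B \<in> sets borel" "E \<in> sets borel"
  shows "B \<times> E \<in> sets (borel :: (real \<times> 'a) measure)"
proof -
  have "B \<times> E = (fst -` B \<inter> space borel) \<inter> (snd -` E \<inter> space borel)" by auto
  also have "\<dots> \<in> sets (borel :: (real \<times> 'a) measure)"
    by (intro sets.Int measurable_sets[OF measurable_fst_borel] measurable_sets[OF measurable_snd_borel] assms)
  finally show ?thesis .
qed

text \<open>The sets with this property form a Dynkin system that contains the rectangles; intersecting with \<open>K\<close> makes
  the slices finite, as needed for complements.\<close>

lemma measurable_kernel_section:
  fixes M :: "real \<Rightarrow> 'a::topological_space measure" and E :: "(real \<times> 'a) set"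
  assumes s: "\<And>s. sets (M s) = sets borel"
    and meas: "\<And>B. B \<in> sets borel \<Longrightarrow> (\<lambda>s. emeasure (M s) B) \<in> borel_measurable borel"
    and K: "K \<in> sets borel" "\<And>s. emeasure (M s) K < \<infinity>"
    and E: "E \<in> sets borel"
  shows "(\<lambda>s. emeasure (M s) (Pair s -` E \<inter> K)) \<in> borel_measurable borel"
proof -
  let ?G = "{A \<times> B | A B. A \<in> sets (borel :: real measure) \<and> B \<in> sets (borel :: 'a measure)}"
  have gen: "sets ((borel :: real measure) \<Otimes>\<^sub>M (borel :: 'a measure)) = sigma_sets UNIV ?G"
    by (simp add: sets_pair_measure)
  have "Int_stable ?G" by (rule Int_stable_pair_measure_generator)
  moreover have "?G \<subseteq> Pow UNIV" by simp
  moreover have "E \<in> sigma_sets UNIV ?G" using subsetD[OF sets_borel_subset_product E] unfolding gen .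
  ultimately show ?thesis
  proof (induction rule: sigma_sets_induct_disjoint)
    case (basic X)
    then obtain A B where X: "X = A \<times> B" "A \<in> sets borel" "B \<in> sets borel" by blast
    have "emeasure (M s) (Pair s -` X \<inter> K) = indicator A s * emeasure (M s) (B \<inter> K)" for s
      by (cases "s \<in> A") (auto simp: X(1) vimage_def)
    moreover have "(\<lambda>s. emeasure (M s) (B \<inter> K)) \<in> borel_measurable borel"
      using X(3) K(1) by (intro meas) auto
    ultimately show ?case using X(2) by simp
  next
    case empty
    then show ?case by simp
  next
    case (compl X)
    then have X: "X \<in> sets (borel \<Otimes>\<^sub>M borel)" by (simp add: gen)
    have sX: "Pair s -` X \<in> sets borel" for s using sets_Pair1[OF X] by simp
    have "emeasure (M s) (Pair s -` (UNIV - X) \<inter> K) = emeasure (M s) K - emeasure (M s) (Pair s -` X \<inter> K)" for s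
    proof -
      have "Pair s -` (UNIV - X) \<inter> K = K - (Pair s -` X \<inter> K)" by auto
      moreover have "emeasure (M s) (Pair s -` X \<inter> K) \<noteq> \<infinity>"
        using K(2)[of s] K(1) emeasure_mono[of "Pair s -` X \<inter> K" K "M s"] by (auto simp: s top_unique)
      ultimately show ?thesis using sX[of s] K(1) by (simp add: emeasure_Diff s)
    qed
    then show ?case using compl meas[OF K(1)] by simp
  next
    case (union X)
    have sX: "Pair s -` X i \<in> sets borel" for s i
      using union(2) sets_Pair1[of "X i" borel borel s] by (auto simp: gen)
    have "emeasure (M s) (Pair s -` (\<Union>i. X i) \<inter> K) = (\<Sum>i. emeasure (M s) (Pair s -` X i \<inter> K))" for s
    proof -
      have "disjoint_family (\<lambda>i. Pair s -` X i \<inter> K)"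
        using union(1) unfolding disjoint_family_on_def by blast
      then have "(\<Sum>i. emeasure (M s) (Pair s -` X i \<inter> K)) = emeasure (M s) (\<Union>i. Pair s -` X i \<inter> K)"
        using sX K(1) by (intro suminf_emeasure) (auto simp: s)
      also have "(\<Union>i. Pair s -` X i \<inter> K) = Pair s -` (\<Union>i. X i) \<inter> K" by auto
      finally show ?thesis by simp
    qed
    then show ?case using union(3) by simp
  qed
qed

locale wTCD_product =
  fixes d :: "real \<Rightarrow> 'a::topological_space \<Rightarrow> 'a \<Rightarrow> real" and M :: "real \<Rightarrow> 'a measure"
    and m :: "(real \<times> 'a) measure" and p N :: real
  assumes mf: "metric_family d" and mM: "measure_family d M" and int: "integrated_measure M m"
    and radon: "radon_measure m" and p: "0 < p" "p < 1" and N: "1 \<le> N" and wTCD: "wTCD d p N m"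
begin

lemma sets_M: "sets (M s) = sets borel" using mM by (simp add: measure_family_def)
lemma sets_m: "sets m = sets borel" using radon by (simp add: radon_measure_def)
lemma space_M [simp]: "space (M s) = UNIV" using sets_eq_imp_space_eq[OF sets_M] by simp
lemma space_m [simp]: "space m = UNIV" using sets_eq_imp_space_eq[OF sets_m] by simp

lemma outer_regular_m:
  "E \<in> sets borel \<Longrightarrow> emeasure m E = (INF W \<in> {W. open W \<and> E \<subseteq> W}. emeasure m W)"
  using radon unfolding radon_measure_def by blast

lemma inner_regular_m:
  "open W \<Longrightarrow> emeasure m W = (SUP C \<in> {C. compact C \<and> C \<subseteq> W}. emeasure m C)"
  using radon unfolding radon_measure_def by blast

lemma measurable_M: "E \<in> sets borel \<Longrightarrow> (\<lambda>s. emeasure (M s) E) \<in> borel_measurable borel"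
  using mM by (simp add: measure_family_def)

lemma comparable:
  assumes "compact J" "compact K"
  obtains C :: real where "C > 0"
    "\<And>s s' E. s \<in> J \<Longrightarrow> s' \<in> J \<Longrightarrow> E \<in> sets borel \<Longrightarrow> E \<subseteq> K \<Longrightarrow> emeasure (M s') E \<le> ennreal C * emeasure (M s) E"
proof -
  have "\<exists>C>0::real. \<forall>s\<in>J. \<forall>s'\<in>J. \<forall>E\<in>sets borel. E \<subseteq> K \<longrightarrow> emeasure (M s') E \<le> ennreal C * emeasure (M s) E"
    using mM assms unfolding measure_family_def by blast
  then show thesis using that by auto
qed

lemma closed_compact: "compact (K :: 'a set) \<Longrightarrow> closed K"
  using separates_points_of_metric_family[OF mf] by (intro compact_imp_closed_separated separates_pointsD)

lemma closed_compact_product: "compact (K :: (real \<times> 'a) set) \<Longrightarrow> closed K"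
  by (rule compact_imp_closed_separated[OF separates_points_product[OF separates_points_of_metric_family[OF mf]]])

lemma compact_borel: "compact (K :: 'a set) \<Longrightarrow> K \<in> sets borel"
  by (intro borel_closed closed_compact)

lemma compact_borel_product: "compact (K :: (real \<times> 'a) set) \<Longrightarrow> K \<in> sets borel"
  by (intro borel_closed closed_compact_product)

lemma emeasure_m:
  assumes E: "E \<in> sets borel"
  shows "emeasure m E = (\<integral>\<^sup>+s. emeasure (M s) (Pair s -` E) \<partial>lborel)"
proof -
  have "emeasure m E = (\<integral>\<^sup>+y. indicator E y \<partial>m)" using E by (simp add: sets_m)
  also have "\<dots> = (\<integral>\<^sup>+s. (\<integral>\<^sup>+x. indicator E (s, x) \<partial>M s) \<partial>lborel)"
    using int E unfolding integrated_measure_def by (elim conjE) (erule bspec, simp)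
  also have "\<dots> = (\<integral>\<^sup>+s. emeasure (M s) (Pair s -` E) \<partial>lborel)"
  proof (rule nn_integral_cong)
    fix s
    have "(\<integral>\<^sup>+x. indicator E (s, x) \<partial>M s) = (\<integral>\<^sup>+x. indicator (Pair s -` E) x \<partial>M s)"
      by (intro nn_integral_cong) (simp add: indicator_def)
    also have "\<dots> = emeasure (M s) (Pair s -` E)"
      using sets_section[OF E] by (intro nn_integral_indicator) (simp add: sets_M)
    finally show "(\<integral>\<^sup>+x. indicator E (s, x) \<partial>M s) = emeasure (M s) (Pair s -` E)" .
  qed
  finally show ?thesis .
qed

lemma finite_compact: "compact K \<Longrightarrow> emeasure m K < \<infinity>"
  using radon by (simp add: radon_measure_def)

text \<open>By Fubini some slice with parameter near \<open>s\<close> is finite on \<open>K\<close>, and local comparability transfers this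
  to \<open>s\<close>.\<close>

lemma finite_M:
  assumes K: "compact K"
  shows "emeasure (M s) K < \<infinity>"
proof -
  let ?J = "{s - 1..s + 1}"
  have JK: "compact (?J \<times> K)" using K by (intro compact_Times) auto
  have "(\<integral>\<^sup>+t. emeasure (M t) (Pair t -` (?J \<times> K)) \<partial>lborel) < \<infinity>"
    using finite_compact[OF JK] emeasure_m[OF compact_borel_product[OF JK]] by simp
  moreover have "emeasure (M t) (Pair t -` (?J \<times> K)) = emeasure (M t) K * indicator ?J t" for t
    by (cases "t \<in> ?J") (auto simp: vimage_def)
  ultimately have fin: "(\<integral>\<^sup>+t. emeasure (M t) K * indicator ?J t \<partial>lborel) < \<infinity>" by simp
  have "AE t in lborel. emeasure (M t) K * indicator ?J t \<noteq> \<infinity>"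
    using fin measurable_M[OF compact_borel[OF K]] by (intro nn_integral_noteq_infinite) auto
  moreover have "\<not> (AE t in lborel. t \<notin> ?J)"
  proof
    assume "AE t in lborel. t \<notin> ?J"
    then have "emeasure lborel ?J = 0" by (subst (asm) AE_iff_measurable[of ?J]) auto
    then show False by simp
  qed
  ultimately have "\<exists>t. t \<in> ?J \<and> emeasure (M t) K * indicator ?J t \<noteq> \<infinity>"
    by (metis (mono_tags, lifting) eventually_mono)
  then obtain t where t: "t \<in> ?J" "emeasure (M t) K \<noteq> \<infinity>" by (auto simp: indicator_def)
  obtain C where C: "\<And>s s' E. s \<in> ?J \<Longrightarrow> s' \<in> ?J \<Longrightarrow> E \<in> sets borel \<Longrightarrow> E \<subseteq> K \<Longrightarrow> emeasure (M s') E \<le> ennreal C * emeasure (M s) E"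
    using comparable[of ?J K] K by (metis compact_Icc)
  have "emeasure (M s) K \<le> ennreal C * emeasure (M t) K"
    using t by (intro C) (auto intro: compact_borel[OF K])
  also have "\<dots> < \<infinity>" using t by (simp add: ennreal_mult_less_top less_top)
  finally show ?thesis .
qed

text \<open>Almost every section of a null set is null for its slice. By local comparability it is also null for the
  slice with parameter moved by \<open>r\<close>.\<close>

lemma shift_null:
  assumes K: "compact K" and E: "E \<in> sets borel" "E \<subseteq> {a..b} \<times> K" and null: "emeasure m E = 0"
  shows "emeasure m (time_shift r -` E) = 0"
proof -
  have sE: "Pair s -` E \<subseteq> K" for s using E(2) by auto
  have "(\<lambda>s. emeasure (M s) (Pair s -` E \<inter> K)) \<in> borel_measurable borel"
    by (rule measurable_kernel_section[OF sets_M measurable_M compact_borel[OF K] finite_M[OF K] E(1)])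
  then have meas [measurable]: "(\<lambda>s. emeasure (M s) (Pair s -` E)) \<in> borel_measurable borel"
    using sE by (simp add: Int_absorb2)
  have "(\<integral>\<^sup>+s. emeasure (M s) (Pair s -` E) \<partial>lborel) = 0" using null emeasure_m[OF E(1)] by simp
  then have ae: "AE s in lborel. emeasure (M s) (Pair s -` E) = 0"
    by (subst (asm) nn_integral_0_iff_AE) auto
  have "AE s in distr lborel borel ((+) r). emeasure (M s) (Pair s -` E) = 0"
    using ae by (subst lborel_distr_plus)
  then have ae': "AE s in lborel. emeasure (M (r + s)) (Pair (r + s) -` E) = 0"
    by (subst (asm) AE_distr_iff) auto
  \<comment> \<open>contains all times of \<open>E\<close> and of its translate\<close>
  let ?J = "{min a (a - r)..max b (b - r)}"
  obtain C where C: "\<And>s s' E. s \<in> ?J \<Longrightarrow> s' \<in> ?J \<Longrightarrow> E \<in> sets borel \<Longrightarrow> E \<subseteq> K \<Longrightarrow> emeasure (M s') E \<le> ennreal C * emeasure (M s) E"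
    by (rule comparable[OF compact_Icc[of "min a (a - r)" "max b (b - r)"] K]) (rule that)
  have "time_shift r -` E \<in> sets borel" using measurable_sets[OF measurable_time_shift E(1)] by simp
  then have "emeasure m (time_shift r -` E) = (\<integral>\<^sup>+s. emeasure (M s) (Pair s -` (time_shift r -` E)) \<partial>lborel)"
    by (rule emeasure_m)
  also have "\<dots> = (\<integral>\<^sup>+s. 0 \<partial>(lborel :: real measure))"
  proof (rule nn_integral_cong_AE)
    show "AE s in lborel. emeasure (M s) (Pair s -` (time_shift r -` E)) = 0"
      using ae'
    proof eventually_elim
      case (elim s)
      have eq: "Pair s -` (time_shift r -` E) = Pair (r + s) -` E"
        by (auto simp: time_shift_def add.commute)
      show ?case
      proof (cases "r + s \<in> {a..b}")
        case True
        then have "emeasure (M s) (Pair (r + s) -` E) \<le> ennreal C * emeasure (M (r + s)) (Pair (r + s) -` E)"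
          using sE sets_section[OF E(1)] by (intro C) auto
        then show ?thesis using elim eq by simp
      next
        case False
        then have "Pair (r + s) -` E = {}" using E(2) by auto
        then show ?thesis using eq by simp
      qed
    qed
  qed
  finally show ?thesis by simp
qed

end

lemma AE_lborel_ex: "AE x in lborel. P x \<Longrightarrow> \<exists>x :: real. P x"
  by (rule eventually_happens') (simp_all add: ae_filter_eq_bot_iff)

section \<open>Invariance under time translations\<close>

lemma distr_time_shift_shift:
  fixes \<mu> :: "(real \<times> 'a::topological_space) measure"
  assumes "sets \<mu> = sets borel"
  shows "distr (distr \<mu> borel (time_shift S)) borel (time_shift T) = distr \<mu> borel (time_shift (S + T))"
proof -
  have "time_shift S \<in> \<mu> \<rightarrow>\<^sub>M borel" unfolding measurable_cong_sets[OF assms refl] by measurable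
  from distr_distr[OF measurable_time_shift this, of T]
  show ?thesis by (simp add: comp_def)
qed

lemma distr_time_shift_0:
  fixes \<mu> :: "(real \<times> 'a::topological_space) measure"
  assumes "sets \<mu> = sets borel"
  shows "distr \<mu> borel (time_shift 0) = \<mu>"
proof -
  have "distr \<mu> borel (time_shift 0) = distr \<mu> \<mu> (\<lambda>y. y)"
    by (rule distr_cong) (auto simp: assms)
  then show ?thesis by simp
qed

context wTCD_product
begin

lemma sets_shift: "A \<in> sets borel \<Longrightarrow> time_shift r -` A \<in> sets (borel :: (real \<times> 'a) measure)"
  using measurable_sets[OF measurable_time_shift, of A r] by simp

lemma finite_bounded:
  assumes K: "compact K" and A: "A \<subseteq> {a..b} \<times> K"
  shows "emeasure m A < \<infinity>"
proof -
  have box: "compact ({a..b} \<times> K)" using K by (intro compact_Times) auto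
  have "emeasure m A \<le> emeasure m ({a..b} \<times> K)"
    using A compact_borel_product[OF box] by (intro emeasure_mono) (simp_all add: sets_m)
  also have "\<dots> < \<infinity>" by (rule finite_compact[OF box])
  finally show ?thesis .
qed

lemma shift_bounded: "A \<subseteq> {a..b} \<times> K \<Longrightarrow> time_shift r -` A \<subseteq> {a - r..b - r} \<times> K"
  by (auto simp: time_shift_def)

context
  fixes A :: "(real \<times> 'a) set" and a b :: real and K :: "'a set"
  assumes K: "compact K" and A: "A \<in> sets borel" "A \<subseteq> {a..b} \<times> K" and pos: "0 < emeasure m A"
begin

abbreviation "U \<equiv> uniform_measure m A"

lemma sets_U: "sets U = sets borel" by (simp add: sets_m)

lemma measurable_shift_U: "time_shift r \<in> U \<rightarrow>\<^sub>M borel"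
  unfolding measurable_cong_sets[OF sets_U refl] by measurable

lemma A_nontrivial: "emeasure m A \<noteq> 0" "emeasure m A \<noteq> \<infinity>"
  using pos finite_bounded[OF K A(2)] by auto

lemma prob_shift_U: "prob_space (distr U borel (time_shift r))"
proof -
  interpret prob_space U using A_nontrivial by (rule prob_space_uniform_measure)
  show ?thesis by (rule prob_space_distr[OF measurable_shift_U])
qed

text \<open>The translate \<open>A + r\<close> of a set is written throughout as a preimage under the inverse translation, so that it
  is visibly a Borel set.\<close>

lemma AE_shift_U: "AE y in distr U borel (time_shift r). y \<in> time_shift (- r) -` A"
proof -
  have "AE y in U. y \<in> A" using A(1) by (intro AE_uniform_measureI) (auto simp: sets_m)
  then have "AE y in U. time_shift r y \<in> time_shift (- r) -` A" by eventually_elim simp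
  then show ?thesis
    by (subst AE_distr_iff[OF measurable_shift_U]) (use sets_shift[OF A(1), of "- r"] in \<open>simp_all add: vimage_def\<close>)
qed

text \<open>Translates of the uniform distribution are admissible in the curvature condition. They are absolutely
  continuous because the slices at different times are comparable: a translate by \<open>- r\<close> of a null set is null.\<close>

lemma shift_U_ac: "distr U borel (time_shift r) \<in> ac_prob_measures m"
proof -
  let ?\<mu> = "distr U borel (time_shift r)"
  have box: "compact ({a + r..b + r} \<times> K)" using K by (intro compact_Times) auto
  have sub: "time_shift (- r) -` A \<subseteq> {a + r..b + r} \<times> K" using shift_bounded[OF A(2), of "- r"] by simp
  have "AE y in ?\<mu>. y \<in> {a + r..b + r} \<times> K" using AE_shift_U by eventually_elim (use sub in blast)
  moreover have "absolutely_continuous m ?\<mu>"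
    unfolding absolutely_continuous_def
  proof
    fix N assume N: "N \<in> null_sets m"
    then have N': "N \<in> sets borel" by (auto simp: sets_m)
    let ?E = "N \<inter> {a + r..b + r} \<times> K"
    have bs: "{a + r..b + r} \<times> K \<in> sets borel" by (rule compact_borel_product[OF box])
    have E: "?E \<in> sets borel" using N' bs by (rule sets.Int)
    have "emeasure m ?E \<le> emeasure m N" using N' by (intro emeasure_mono) (simp_all add: sets_m)
    then have "emeasure m ?E = 0" using N by (simp add: null_sets_def)
    then have "emeasure m (time_shift r -` ?E) = 0" using K E by (intro shift_null) auto
    moreover have "A \<inter> time_shift r -` N \<subseteq> time_shift r -` ?E"
    proof
      fix y assume y: "y \<in> A \<inter> time_shift r -` N"
      then have "y \<in> {a..b} \<times> K" using A(2) by blast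
      then have "time_shift r y \<in> {a + r..b + r} \<times> K" by (cases y) (simp add: time_shift_def)
      with y show "y \<in> time_shift r -` ?E" by simp
    qed
    ultimately have "emeasure m (A \<inter> time_shift r -` N) = 0"
      using emeasure_mono[of "A \<inter> time_shift r -` N" "time_shift r -` ?E" m] sets_shift[OF E] by (simp add: sets_m)
    then have "emeasure ?\<mu> N = 0"
      using N' sets_shift[OF N'] A(1) by (simp add: emeasure_distr[OF measurable_shift_U] emeasure_uniform_measure sets_m)
    then show "N \<in> null_sets ?\<mu>" using N' by (simp add: null_sets_def)
  qed
  ultimately show ?thesis
    using prob_shift_U box unfolding ac_prob_measures_def prob_measures_def by auto
qed

lemma vertical_transport_shift_U:
  assumes "0 < T"
  shows "vertical_transport d (distr U borel (time_shift r)) T p"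
  using shift_U_ac[of r] mf assms p
  by (auto simp: vertical_transport_def ac_prob_measures_def compactly_supported_def)

text \<open>The curvature condition for the transport of total length \<open>T\<close> that starts with the uniform distribution
  (\<open>c = 0\<close>) or ends with it (\<open>c = T\<close>). Of the two terms of the lower bound only the one of the uniform
  distribution is kept, with its weight \<open>w\<close>.\<close>

lemma entropy_inequality:
  assumes T: "0 < T" and t: "t \<in> {0..1}" and c: "c = 0 \<and> w = 1 - t \<or> c = T \<and> w = t"
    and kA: "emeasure m A = ennreal kA" "0 < kA"
    and kB: "emeasure m (time_shift (c - T * t) -` A) = ennreal kB" "0 \<le> kB"
  shows "w * kA powr (1 / N) \<le> kB powr (1 / N)"
proof -
  let ?D = "\<lambda>r. distr U borel (time_shift r)"
  interpret vertical_transport d "?D (- c)" T p by (rule vertical_transport_shift_U[OF T])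
  have comp: "distr (?D (- c)) borel (time_shift r) = ?D (r - c)" for r
    using distr_time_shift_shift[OF sets_U, of "- c" r] by simp
  have "distr (?D (- c)) borel (time_shift T) \<in> ac_prob_measures m" unfolding comp by (rule shift_U_ac)
  with wTCD[unfolded wTCD_def, rule_format, OF shift_U_ac[of "- c"], of "distr (?D (- c)) borel (time_shift T)"] vertical_plan_optimal
  obtain \<eta> where \<eta>: "\<eta> \<in> opt_plans d p (?D (- c)) (distr (?D (- c)) borel (time_shift T))"
    and conc: "\<forall>t\<in>{0..1}. ereal_exp (- Ent m (distr \<eta> borel (\<lambda>\<gamma>. \<gamma> t)) / ereal N) \<ge>
      ennreal (1 - t) * ereal_exp (- Ent m (distr \<eta> borel (\<lambda>\<gamma>. \<gamma> 0)) / ereal N)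
      + ennreal t * ereal_exp (- Ent m (distr \<eta> borel (\<lambda>\<gamma>. \<gamma> 1)) / ereal N)"
    unfolding Let_def by blast
  define u where "u r = ereal_exp (- Ent m (?D r) / ereal N)" for r
  have ev: "distr \<eta> borel (\<lambda>\<gamma>. \<gamma> t) = ?D (T * t - c)" if "t \<in> {0..1}" for t
    using optimal_plan_marginal[OF \<eta> that] comp by simp
  have ineq: "ennreal (1 - t) * u (- c) + ennreal t * u (T - c) \<le> u (T * t - c)"
    using bspec[OF conc t] ev[OF t] ev[of 0] ev[of 1] by (simp add: u_def)
  have u0: "u 0 = ennreal (kA powr (1 / N))"
    unfolding u_def distr_time_shift_0[OF sets_U]
    using A(1) kA N by (intro exp_entropy_uniform) (simp_all add: sets_m)
  have "ennreal w * ennreal (kA powr (1 / N)) \<le> ennreal (1 - t) * u (- c) + ennreal t * u (T - c)"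
    using c u0 by auto
  also note ineq
  also have "u (T * t - c) \<le> ennreal (kB powr (1 / N))"
    unfolding u_def
  proof (rule exp_entropy_le)
    show "AE y in ?D (T * t - c). y \<in> time_shift (c - T * t) -` A" using AE_shift_U[of "T * t - c"] by simp
  qed (use kB N A(1) sets_shift prob_shift_U in \<open>simp_all add: sets_m\<close>)
  finally have "ennreal w * ennreal (kA powr (1 / N)) \<le> ennreal (kB powr (1 / N))" .
  moreover have "0 \<le> w" using c t by auto
  ultimately have "ennreal (w * kA powr (1 / N)) \<le> ennreal (kB powr (1 / N))"
    by (subst ennreal_mult) simp_all
  then show ?thesis by (simp add: ennreal_le_iff)
qed

text \<open>The displacement \<open>r\<close> is kept fixed while the weight \<open>z\<close> of the uniform distribution tends to \<open>1\<close>, so the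
  length \<open>\<bar>r\<bar> / (1 - z)\<close> of the whole transport tends to infinity. The sign of \<open>r\<close> decides at which end the
  uniform distribution sits.\<close>

lemma emeasure_le_shift:
  assumes r: "r \<noteq> 0"
  shows "emeasure m A \<le> emeasure m (time_shift (- r) -` A)"
proof -
  let ?B = "time_shift (- r) -` A"
  have "emeasure m ?B < \<infinity>" by (rule finite_bounded[OF K shift_bounded[OF A(2)]])
  then obtain kB where kB: "emeasure m ?B = ennreal kB" "0 \<le> kB" by (cases "emeasure m ?B") auto
  obtain kA where kA: "emeasure m A = ennreal kA" "0 < kA"
    using A_nontrivial by (cases "emeasure m A") (auto simp: less_le)
  \<comment> \<open>it suffices to prove the inequality with every factor \<open>z < 1\<close> on the left\<close>
  have "kA powr (1 / N) \<le> kB powr (1 / N)"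
  proof (rule field_le_mult_one_interval)
    fix z :: real assume z: "0 < z" "z < 1"
    show "z * kA powr (1 / N) \<le> kB powr (1 / N)"
    proof (cases "0 < r")
      case True
      show ?thesis
      proof (rule entropy_inequality[where T = "r / (1 - z)" and t = "1 - z" and c = 0, OF _ _ _ kA _ kB(2)])
        show "emeasure m (time_shift (0 - r / (1 - z) * (1 - z)) -` A) = ennreal kB" using kB z by simp
      qed (use True z in auto)
    next
      case False
      let ?T = "- r / (1 - z)"
      have "?T - ?T * z = ?T * (1 - z)" by (simp add: right_diff_distrib)
      also have "\<dots> = - r" using z by simp
      finally have eq: "?T - ?T * z = - r" .
      show ?thesis
      proof (rule entropy_inequality[where T = ?T and t = z and c = ?T, OF _ _ _ kA _ kB(2)])
        show "emeasure m (time_shift (?T - ?T * z) -` A) = ennreal kB" unfolding eq by (rule kB)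
        show "0 < ?T" using False r z by (intro divide_pos_pos) auto
      qed (use z in auto)
    qed
  qed
  then have "kA \<le> kB"
    using powr_less_mono2[of "1 / N" kB kA] kB(2) N by (meson linorder_not_le zero_less_divide_1_iff less_le_trans zero_less_one)
  then show ?thesis using kA kB by (simp add: ennreal_leI)
qed

end

lemma emeasure_shift_bounded:
  assumes K: "compact K" and A: "A \<in> sets borel" "A \<subseteq> {a..b} \<times> K"
  shows "emeasure m A \<le> emeasure m (time_shift r -` A)"
proof (cases "emeasure m A = 0 \<or> r = 0")
  case True
  then show ?thesis by (auto simp: vimage_def)
next
  case False
  then show ?thesis using emeasure_le_shift[OF K A, of "- r"] by (simp add: zero_less_iff_neq_zero)
qed

text \<open>Inner regularity reduces the claim to compact sets, which are bounded.\<close>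

lemma emeasure_shift_open_le:
  assumes W: "open W"
  shows "emeasure m (time_shift r -` W) \<le> emeasure m W"
proof -
  have oW: "open (time_shift r -` W)" by (rule open_vimage[OF W continuous_time_shift])
  then have "emeasure m (time_shift r -` W) = (SUP C \<in> {C. compact C \<and> C \<subseteq> time_shift r -` W}. emeasure m C)"
    by (rule inner_regular_m)
  also have "\<dots> \<le> emeasure m W"
  proof (rule SUP_least)
    fix C assume "C \<in> {C. compact C \<and> C \<subseteq> time_shift r -` W}"
    then have C: "compact C" "C \<subseteq> time_shift r -` W" by auto
    have cs: "compact (snd ` C)" and cf: "compact (fst ` C)"
      using C(1) by (auto intro!: compact_continuous_image continuous_intros)
    obtain B where B: "\<And>s. s \<in> fst ` C \<Longrightarrow> \<bar>s\<bar> \<le> B"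
      using compact_imp_bounded[OF cf] by (auto simp: bounded_iff)
    have "C \<subseteq> {- B..B} \<times> snd ` C"
    proof
      fix y assume "y \<in> C"
      then show "y \<in> {- B..B} \<times> snd ` C" using B[of "fst y"] by (auto simp: mem_Times_iff abs_le_iff)
    qed
    then have "emeasure m C \<le> emeasure m (time_shift (- r) -` C)"
      by (rule emeasure_shift_bounded[OF cs compact_borel_product[OF C(1)]])
    also have "time_shift (- r) -` C \<subseteq> W"
    proof
      fix y assume "y \<in> time_shift (- r) -` C"
      then have "time_shift r (time_shift (- r) y) \<in> W" using C(2) by blast
      then show "y \<in> W" by simp
    qed
    then have "emeasure m (time_shift (- r) -` C) \<le> emeasure m W"
      using W by (intro emeasure_mono) (simp_all add: sets_m)
    finally show "emeasure m C \<le> emeasure m W" .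
  qed
  finally show ?thesis .
qed

lemma emeasure_shift_le:
  assumes E: "E \<in> sets borel"
  shows "emeasure m (time_shift r -` E) \<le> emeasure m E"
proof -
  have "emeasure m E = (INF W \<in> {W. open W \<and> E \<subseteq> W}. emeasure m W)"
    by (rule outer_regular_m[OF E])
  moreover have "emeasure m (time_shift r -` E) \<le> (INF W \<in> {W. open W \<and> E \<subseteq> W}. emeasure m W)"
  proof (rule INF_greatest)
    fix W assume "W \<in> {W. open W \<and> E \<subseteq> W}"
    then have W: "open W" "E \<subseteq> W" by auto
    have "open (time_shift r -` W)" by (rule open_vimage[OF W(1) continuous_time_shift])
    then have "emeasure m (time_shift r -` E) \<le> emeasure m (time_shift r -` W)"
      using W(2) by (intro emeasure_mono) (auto simp: sets_m)
    also have "\<dots> \<le> emeasure m W" by (rule emeasure_shift_open_le[OF W(1)])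
    finally show "emeasure m (time_shift r -` E) \<le> emeasure m W" .
  qed
  ultimately show ?thesis by simp
qed

theorem emeasure_shift:
  assumes E: "E \<in> sets borel"
  shows "emeasure m (time_shift r -` E) = emeasure m E"
proof (rule antisym)
  have "E = time_shift (- r) -` (time_shift r -` E)" by (auto simp: vimage_def)
  then show "emeasure m E \<le> emeasure m (time_shift r -` E)"
    using emeasure_shift_le[OF sets_shift[OF E], of "- r" r] by simp
qed (rule emeasure_shift_le[OF E])

lemma emeasure_m_Times:
  assumes "B \<in> sets borel" "E \<in> sets borel"
  shows "emeasure m (B \<times> E) = (\<integral>\<^sup>+s. emeasure (M s) E * indicator B s \<partial>lborel)"
proof -
  have "emeasure m (B \<times> E) = (\<integral>\<^sup>+s. emeasure (M s) (Pair s -` (B \<times> E)) \<partial>lborel)"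
    by (rule emeasure_m[OF sets_rectangle[OF assms]])
  also have "\<dots> = (\<integral>\<^sup>+s. emeasure (M s) E * indicator B s \<partial>lborel)"
  proof (rule nn_integral_cong)
    fix s show "emeasure (M s) (Pair s -` (B \<times> E)) = emeasure (M s) E * indicator B s"
      by (cases "s \<in> B") (auto simp: vimage_def)
  qed
  finally show ?thesis .
qed

text \<open>The functions \<open>s \<mapsto> M s E\<close> and \<open>s \<mapsto> M (s + r) E\<close> are densities of the same measure on the line.\<close>

lemma kernel_shift_AE:
  assumes E: "E \<in> sets borel"
  shows "AE s in lborel. emeasure (M (s + r)) E = emeasure (M s) E"
proof -
  define f where "f s = emeasure (M s) E" for s
  have f [measurable]: "f \<in> borel_measurable borel" unfolding f_def by (rule measurable_M[OF E])
  have "density lborel (\<lambda>s. f (s + r)) = density lborel f"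
  proof (rule measure_eqI)
    fix B assume "B \<in> sets (density lborel (\<lambda>s. f (s + r)))"
    then have B [measurable]: "B \<in> sets borel" by simp
    let ?B' = "(\<lambda>s. s - r) -` B"
    have "(\<lambda>s. s - r) \<in> borel \<rightarrow>\<^sub>M (borel :: real measure)" by measurable
    from measurable_sets[OF this B] have B' [measurable]: "?B' \<in> sets borel" by simp
    have "emeasure (density lborel (\<lambda>s. f (s + r))) B = (\<integral>\<^sup>+s. f (s + r) * indicator B s \<partial>lborel)"
      by (intro emeasure_density) auto
    also have "\<dots> = (\<integral>\<^sup>+s. f (r + s) * indicator ?B' (r + s) \<partial>lborel)"
      by (intro nn_integral_cong) (simp add: indicator_def add.commute)
    also have "\<dots> = (\<integral>\<^sup>+s. f s * indicator ?B' s \<partial>distr lborel borel ((+) r))"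
      by (subst nn_integral_distr) auto
    also have "\<dots> = (\<integral>\<^sup>+s. f s * indicator ?B' s \<partial>lborel)" by (subst lborel_distr_plus) (rule refl)
    also have "\<dots> = emeasure m (?B' \<times> E)" unfolding f_def by (rule emeasure_m_Times[OF B' E, symmetric])
    also have "?B' \<times> E = time_shift (- r) -` (B \<times> E)" by (auto simp: time_shift_def)
    also have "emeasure m (time_shift (- r) -` (B \<times> E)) = emeasure m (B \<times> E)"
      by (rule emeasure_shift[OF sets_rectangle[OF B E]])
    also have "\<dots> = (\<integral>\<^sup>+s. f s * indicator B s \<partial>lborel)" unfolding f_def by (rule emeasure_m_Times[OF B E])
    also have "\<dots> = emeasure (density lborel f) B" by (intro emeasure_density[symmetric]) auto
    finally show "emeasure (density lborel (\<lambda>s. f (s + r))) B = emeasure (density lborel f) B" .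
  qed simp
  then have "AE s in lborel. f (s + r) = f s"
    by (subst (asm) sigma_finite_measure.density_unique_iff[OF sigma_finite_lborel]) auto
  then show ?thesis by (simp add: f_def)
qed

text \<open>By Fubini there is one \<open>s\<close> with \<open>M (s + r) E = M s E\<close> for almost every \<open>r\<close>.\<close>

lemma kernel_AE_constant:
  assumes E: "E \<in> sets borel"
  shows "\<exists>c. AE s in lborel. emeasure (M s) E = c"
proof -
  define f where "f s = emeasure (M s) E" for s
  have f [measurable]: "f \<in> borel_measurable borel" unfolding f_def by (rule measurable_M[OF E])
  have "AE r in lborel. AE s in lborel. f (s + r) = f s"
    unfolding f_def by (intro AE_I2 kernel_shift_AE[OF E])
  then have "AE s in lborel. AE r in lborel. f (s + r) = f s"
  proof (subst lborel_pair.AE_commute)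
    show "{x \<in> space (lborel \<Otimes>\<^sub>M lborel). f (fst x + snd x) = f (fst x)} \<in> sets (lborel \<Otimes>\<^sub>M lborel)"
      by measurable
  qed
  then obtain s where s: "AE r in lborel. f (s + r) = f s" using AE_lborel_ex by blast
  \<comment> \<open>for this \<open>s\<close> the shift by \<open>- s\<close> turns \<open>M (s + r)\<close> into \<open>M r\<close>\<close>
  have "AE r in distr lborel borel ((+) (- s)). f (s + r) = f s"
    using s by (subst lborel_distr_plus)
  then have "AE r in lborel. f (s + (- s + r)) = f s" by (subst (asm) AE_distr_iff) auto
  then show ?thesis unfolding f_def by (intro exI[of _ "emeasure (M s) E"]) simp
qed

end

section \<open>Almost every slice is the same measure\<close>

text \<open>Countably many translates of the strip cover the whole product.\<close>

lemma (in wTCD_product) null_of_vertical_strip_null: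
  assumes h: "0 < h" and E: "E \<in> sets borel" and null: "emeasure m ({- h..h} \<times> E) = 0"
  shows "emeasure m (UNIV \<times> E) = 0"
proof -
  let ?S = "\<lambda>j :: int. time_shift (- (of_int j * h)) -` ({- h..h} \<times> E)"
  have bs: "{- h..h} \<times> E \<in> sets borel" using E by (intro sets_rectangle) auto
  have "?S j \<in> null_sets m" for j
    using sets_shift[OF bs] emeasure_shift[OF bs] null by (intro null_setsI) (simp_all add: sets_m)
  then have "(\<Union>j. ?S j) \<in> null_sets m" by (intro null_sets_UN') auto
  moreover have "UNIV \<times> E \<subseteq> (\<Union>j. ?S j)"
  proof
    fix y :: "real \<times> 'a" assume y: "y \<in> UNIV \<times> E"
    let ?j = "\<lfloor>fst y / h\<rfloor>"
    have "of_int ?j \<le> fst y / h" "fst y / h < of_int ?j + 1" by linarith+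
    then have "of_int ?j * h \<le> fst y" "fst y < (of_int ?j + 1) * h"
      using pos_le_divide_eq[OF h] pos_divide_less_eq[OF h] by blast+
    then have "of_int ?j * h \<le> fst y" "fst y < of_int ?j * h + h"
      by (simp_all add: distrib_right)
    then have "y \<in> ?S ?j" using y h by (simp add: time_shift_def mem_Times_iff)
    then show "y \<in> (\<Union>j. ?S j)" by blast
  qed
  ultimately show ?thesis
    by (metis emeasure_mono le_zero_eq null_setsD1 null_setsD2)
qed

text \<open>The slice \<open>{0} \<times> X\<close> is a null set, so by outer regularity it has an open neighbourhood \<open>U\<close> of finite
  measure. Inner regularity exhausts \<open>U\<close> by compact sets up to a null set; let \<open>L n\<close> be their projections
  to \<open>X\<close> and \<open>Z\<close> the complement of the union. The part of \<open>U\<close> above \<open>Z\<close> is null. Since \<open>U\<close> contains around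
  each \<open>(0, x)\<close> a vertical segment whose length is locally bounded below, \<open>Z\<close> is a countable union of
  sets above which a strip of positive height is null, and translation invariance finishes the proof.\<close>

lemma (in wTCD_product) sigma_compact_carrier:
  obtains L :: "nat \<Rightarrow> 'a set" where "\<And>n. compact (L n)" "incseq L"
    "AE s in lborel. emeasure (M s) (- (\<Union>n. L n)) = 0"
proof -
  let ?Z0 = "{0 :: real} \<times> (UNIV :: 'a set)"
  have "closed ?Z0" by (intro closed_Times) auto
  then have Z0: "?Z0 \<in> sets borel" by (rule borel_closed)
  have "emeasure m ?Z0 = (\<integral>\<^sup>+s. emeasure (M s) UNIV * indicator {0} s \<partial>lborel)"
    by (rule emeasure_m_Times) auto
  also have "\<dots> = (\<integral>\<^sup>+s. 0 \<partial>(lborel :: real measure))"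
    by (rule nn_integral_cong_AE, rule eventually_mono[OF AE_lborel_singleton[of 0]]) simp
  finally have "(INF W \<in> {W. open W \<and> ?Z0 \<subseteq> W}. emeasure m W) < 1"
    unfolding outer_regular_m[OF Z0, symmetric] by simp
  then obtain U where U: "open U" "?Z0 \<subseteq> U" "emeasure m U < 1"
    unfolding INF_less_iff by blast
  \<comment> \<open>a sequence of compact subsets of \<open>U\<close> whose measures approach that of \<open>U\<close>\<close>
  let ?C = "emeasure m ` {C. compact C \<and> C \<subseteq> U}"
  have SU: "emeasure m U = Sup ?C" by (rule inner_regular_m[OF U(1)])
  have "?C \<noteq> {}" by (auto intro: exI[of _ "{}"])
  from ennreal_Sup_countable_SUP[OF this] obtain F :: "nat \<Rightarrow> ennreal" where
    F: "range F \<subseteq> ?C" "Sup ?C = (SUP i. F i)" by auto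
  then have "\<forall>i. \<exists>D. compact D \<and> D \<subseteq> U \<and> F i = emeasure m D" by blast
  then obtain D where D: "\<And>i. compact (D i)" "\<And>i. D i \<subseteq> U" "\<And>i. F i = emeasure m (D i)" by metis
  define L where "L n = (\<Union>i\<le>n. snd ` D i)" for n
  have L: "compact (L n)" for n
    unfolding L_def using D(1) by (intro compact_UN compact_continuous_image continuous_intros) auto
  have inc: "incseq L" unfolding L_def by (intro monoI UN_mono) auto
  define Z where "Z = - (\<Union>n. L n)"
  have Z: "Z \<in> sets borel" unfolding Z_def using compact_borel[OF L] by auto
  let ?W = "U \<inter> (UNIV \<times> Z)"
  have W: "?W \<in> sets borel" by (rule sets.Int[OF borel_open[OF U(1)] sets_rectangle[OF _ Z]]) simp
  have "emeasure m (D i) + emeasure m ?W \<le> emeasure m U" for i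
  proof -
    have "snd ` D i \<subseteq> L i" unfolding L_def by auto
    then have "D i \<inter> ?W = {}" unfolding Z_def by (auto simp: mem_Times_iff)
    then have "emeasure m (D i) + emeasure m ?W = emeasure m (D i \<union> ?W)"
      using W compact_borel_product[OF D(1)] by (intro plus_emeasure) (auto simp: sets_m)
    also have "\<dots> \<le> emeasure m U" using D(2)[of i] U(1) by (intro emeasure_mono) (auto simp: sets_m)
    finally show ?thesis .
  qed
  then have "(SUP i. F i) + emeasure m ?W \<le> emeasure m U"
    unfolding D(3) by (subst ennreal_SUP_add_left[symmetric]) (auto intro!: SUP_least)
  then have "emeasure m U + emeasure m ?W \<le> emeasure m U" using F(2) SU by simp
  moreover have "emeasure m U \<noteq> \<infinity>" using U(3) by auto
  ultimately have W0: "emeasure m ?W = 0"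
    by (cases "emeasure m U"; cases "emeasure m ?W") (auto simp flip: ennreal_plus simp: top_unique)
  \<comment> \<open>\<open>V k\<close> consists of the points above which \<open>U\<close> contains the vertical segment over the times from \<open>- h k\<close> to \<open>h k\<close>\<close>
  define h where "h k = 1 / real (Suc k)" for k
  have h: "0 < h k" for k by (simp add: h_def)
  define V where "V k = {x. \<forall>s\<in>{- h k..h k}. (s, x) \<in> U}" for k
  have V: "open (V k)" for k unfolding V_def by (rule open_tube[OF compact_Icc U(1)])
  have "(UNIV \<times> (V k \<inter> Z)) \<in> null_sets m" for k
  proof -
    have VZ: "V k \<inter> Z \<in> sets borel" using V Z by auto
    have "{- h k..h k} \<times> (V k \<inter> Z) \<subseteq> ?W" by (auto simp: V_def)
    then have "emeasure m ({- h k..h k} \<times> (V k \<inter> Z)) \<le> emeasure m ?W"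
      using W by (intro emeasure_mono) (simp_all add: sets_m)
    then have "emeasure m (UNIV \<times> (V k \<inter> Z)) = 0"
      using W0 by (intro null_of_vertical_strip_null[OF h[of k] VZ]) simp
    moreover have "UNIV \<times> (V k \<inter> Z) \<in> sets m"
      unfolding sets_m using VZ by (intro sets_rectangle) auto
    ultimately show ?thesis by (intro null_setsI)
  qed
  then have "(\<Union>k. UNIV \<times> (V k \<inter> Z)) \<in> null_sets m" by (intro null_sets_UN') auto
  moreover have "(\<Union>k. UNIV \<times> (V k \<inter> Z)) = UNIV \<times> Z"
  proof -
    have "\<exists>k. x \<in> V k" for x
    proof -
      have "(0, x) \<in> U" using U(2) by auto
      from open_prod_elim[OF U(1) this] obtain A B where AB: "open A" "open B" "(0, x) \<in> A \<times> B" "A \<times> B \<subseteq> U" .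
      then obtain e where e: "e > 0" "ball 0 e \<subseteq> A" using open_contains_ball by blast
      obtain k where k: "h k < e" unfolding h_def using reals_Archimedean[OF e(1)] by (auto simp: inverse_eq_divide)
      have "{- h k..h k} \<subseteq> ball 0 e" using k by (auto simp: dist_real_def)
      then have "{- h k..h k} \<subseteq> A" using e(2) by (rule order_trans)
      then have "x \<in> V k" unfolding V_def using AB by blast
      then show ?thesis ..
    qed
    then show ?thesis by blast
  qed
  ultimately have "emeasure m (UNIV \<times> Z) = 0" by (metis null_setsD1)
  then have "(\<integral>\<^sup>+s. emeasure (M s) Z \<partial>lborel) = 0"
    using emeasure_m_Times[OF _ Z, of UNIV] by simp
  then have "AE s in lborel. emeasure (M s) Z = 0"
    using measurable_M[OF Z] by (subst (asm) nn_integral_0_iff_AE) auto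
  then show thesis using that[OF L inc] by (simp add: Z_def)
qed

text \<open>A compact subset of \<open>X\<close> has a countable base, consisting of the balls of radius \<open>1 / n\<close> around finite nets.
  The balls are taken for \<open>d 0\<close>, whose topology may be coarser than that of \<open>X\<close>. Nevertheless a point of
  \<open>K \<inter> U\<close> has positive \<open>d 0\<close>-distance \<open>e\<close> from \<open>K - U\<close>, because the latter set is compact.\<close>

lemma countable_base_of_compact:
  fixes d :: "real \<Rightarrow> 'a::topological_space \<Rightarrow> 'a \<Rightarrow> real" and K :: "'a set"
  assumes mf: "metric_family d" and K: "compact K"
  obtains \<B> where "countable \<B>" "\<And>B. B \<in> \<B> \<Longrightarrow> open B"
    "\<And>U x. open U \<Longrightarrow> x \<in> U \<Longrightarrow> x \<in> K \<Longrightarrow> \<exists>B\<in>\<B>. x \<in> B \<and> B \<inter> K \<subseteq> U"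
proof -
  interpret Metric_space UNIV "d 0" using mf by (simp add: metric_family_def)
  define b where "b x r = {y. d 0 x y < r}" for x r
  have b: "open (b x r)" for x r unfolding b_def by (rule open_mball_of_metric_family[OF mf])
  have tri: "d 0 x z \<le> d 0 x y + d 0 y z" for x y z by (rule triangle) simp_all
  have self: "0 < r \<Longrightarrow> x \<in> b x r" for x r by (simp add: b_def)
  have "\<exists>F. finite F \<and> F \<subseteq> K \<and> K \<subseteq> (\<Union>x\<in>F. b x (1 / real (Suc n)))" for n
  proof -
    have "K \<subseteq> (\<Union>x\<in>K. b x (1 / real (Suc n)))"
    proof
      fix x assume "x \<in> K"
      then show "x \<in> (\<Union>x\<in>K. b x (1 / real (Suc n)))" by (rule UN_I) (simp add: self)
    qed
    then obtain F where "F \<subseteq> K" "finite F" "K \<subseteq> (\<Union>x\<in>F. b x (1 / real (Suc n)))"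
      by (rule compactE_image[OF K b]) (rule that)
    then show ?thesis by (intro exI[of _ F] conjI)
  qed
  then have "\<forall>n. \<exists>F. finite F \<and> F \<subseteq> K \<and> K \<subseteq> (\<Union>x\<in>F. b x (1 / real (Suc n)))" by (rule allI)
  from choice[OF this] obtain F where
    "\<forall>n. finite (F n) \<and> F n \<subseteq> K \<and> K \<subseteq> (\<Union>x\<in>F n. b x (1 / real (Suc n)))" by (rule exE)
  then have F: "finite (F n)" "K \<subseteq> (\<Union>x\<in>F n. b x (1 / real (Suc n)))" for n by simp_all
  define \<B> where "\<B> = (\<Union>n. (\<lambda>x. b x (1 / real (Suc n))) ` F n)"
  show thesis
  proof (rule that[of \<B>])
    show "countable \<B>" unfolding \<B>_def using F(1) by (intro countable_UN countable_image) (auto intro: countable_finite)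
    show "open B" if "B \<in> \<B>" for B using that unfolding \<B>_def by (elim UN_E imageE) (simp only: b)
    show "\<exists>B\<in>\<B>. x \<in> B \<and> B \<inter> K \<subseteq> U" if U: "open U" "x \<in> U" "x \<in> K" for U x
    proof -
      have KU: "compact (K - U)" using K U(1) by (rule compact_diff)
      have pos: "0 < d 0 x y" if "y \<in> K - U" for y
      proof -
        have "x \<noteq> y" using that U(2) by (metis DiffD2)
        then show ?thesis by (rule mdist_pos_less) simp_all
      qed
      have "K - U \<subseteq> (\<Union>y\<in>K - U. b y (d 0 x y / 2))"
      proof
        fix y assume y: "y \<in> K - U"
        show "y \<in> (\<Union>y\<in>K - U. b y (d 0 x y / 2))"
          by (rule UN_I[OF y]) (rule self[OF half_gt_zero[OF pos[OF y]]])
      qed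
      then obtain G where
        G: "G \<subseteq> K - U" "finite G" "K - U \<subseteq> (\<Union>y\<in>G. b y (d 0 x y / 2))"
        by (rule compactE_image[OF KU b]) (rule that)
      define e where "e = Min (insert 1 ((\<lambda>y. d 0 x y / 2) ` G))"
      have fin: "finite (insert 1 ((\<lambda>y. d 0 x y / 2) ` G))" using G(2) by simp
      have "e \<in> insert 1 ((\<lambda>y. d 0 x y / 2) ` G)" unfolding e_def by (rule Min_in[OF fin]) simp
      then have e: "0 < e"
      proof (elim insertE imageE)
        fix y assume y: "e = d 0 x y / 2" "y \<in> G"
        show "0 < e" unfolding y(1) by (rule half_gt_zero[OF pos[OF subsetD[OF G(1) y(2)]]])
      qed simp
      have eG: "e \<le> d 0 x y / 2" if "y \<in> G" for y
        unfolding e_def using that by (intro Min_le[OF fin] insertI2 imageI)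
      have far: "e < d 0 x z" if "z \<in> K - U" for z
      proof -
        have "z \<in> (\<Union>y\<in>G. b y (d 0 x y / 2))" using G(3) that by (rule subsetD)
        then obtain y where y: "y \<in> G" "d 0 y z < d 0 x y / 2" unfolding b_def by (elim UN_E CollectE)
        have "d 0 x y \<le> d 0 x z + d 0 y z" using tri[of x y z] commute[of z y] by simp
        then show ?thesis using eG[OF y(1)] y(2) by simp
      qed
      obtain n where n: "1 / real (Suc n) < e / 2" using reals_Archimedean[of "e / 2"] e by (auto simp: inverse_eq_divide)
      have "x \<in> (\<Union>c\<in>F n. b c (1 / real (Suc n)))" using F(2) U(3) by (rule subsetD)
      then obtain c where c: "c \<in> F n" "x \<in> b c (1 / real (Suc n))" by (elim UN_E)
      have "b c (1 / real (Suc n)) \<inter> K \<subseteq> U"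
      proof
        fix z assume z: "z \<in> b c (1 / real (Suc n)) \<inter> K"
        have "d 0 x z \<le> d 0 c x + d 0 c z" using tri[of x z c] commute[of x c] by simp
        also have "\<dots> < e" using c(2) z n by (simp add: b_def)
        finally have "\<not> e < d 0 x z" by simp
        with far[of z] z show "z \<in> U" by (metis DiffI IntD2)
      qed
      moreover have "b c (1 / real (Suc n)) \<in> \<B>"
        unfolding \<B>_def using c(1) by (intro UN_I[of n] imageI) simp_all
      ultimately show ?thesis using c(2) by (intro bexI[of _ "b c (1 / real (Suc n))"] conjI)
    qed
  qed
qed

text \<open>Finite intersections of the base, restricted to \<open>K\<close>, are a countable \<open>\<inter>\<close>-stable generator.\<close>

lemma countable_generator_of_compact:
  fixes d :: "real \<Rightarrow> 'a::topological_space \<Rightarrow> 'a \<Rightarrow> real" and K :: "'a set"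
  assumes mf: "metric_family d" and K: "compact K" "K \<in> sets borel"
  obtains \<G> where "countable \<G>" "\<G> \<subseteq> sets borel" "\<G> \<subseteq> Pow K" "Int_stable \<G>" "K \<in> \<G>"
    "\<And>E. E \<in> sets borel \<Longrightarrow> K \<inter> E \<in> sigma_sets K \<G>"
proof -
  obtain \<B> where B: "countable \<B>" "\<And>B. B \<in> \<B> \<Longrightarrow> open B"
    "\<And>U x. open U \<Longrightarrow> x \<in> U \<Longrightarrow> x \<in> K \<Longrightarrow> \<exists>B\<in>\<B>. x \<in> B \<and> B \<inter> K \<subseteq> U"
    by (rule countable_base_of_compact[OF mf K(1)]) (rule that)
  define \<G> where "\<G> = (\<lambda>F. K \<inter> \<Inter>F) ` {F. finite F \<and> F \<subseteq> \<B>}"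
  have single: "K \<inter> B \<in> \<G>" if "B \<in> \<B>" for B
    unfolding \<G>_def using that by (intro image_eqI[of _ _ "{B}"]) auto
  have op: "K \<inter> U \<in> sigma_sets K \<G>" if U: "open U" for U
  proof -
    have "K \<inter> U = \<Union>((\<lambda>B. K \<inter> B) ` {B \<in> \<B>. B \<inter> K \<subseteq> U})"
    proof (intro equalityI subsetI)
      fix x assume "x \<in> K \<inter> U"
      then obtain B where "B \<in> \<B>" "x \<in> B" "B \<inter> K \<subseteq> U" using B(3)[OF U, of x] by (elim IntE) blast
      with \<open>x \<in> K \<inter> U\<close> show "x \<in> \<Union>((\<lambda>B. K \<inter> B) ` {B \<in> \<B>. B \<inter> K \<subseteq> U})" by auto
    qed auto
    also have "\<dots> \<in> sigma_sets K \<G>"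
      using B(1) single by (intro sigma_sets_UNION countable_image) (auto intro: countable_subset sigma_sets.Basic)
    finally show ?thesis .
  qed
  show thesis
  proof (rule that[of \<G>])
    show "countable \<G>" unfolding \<G>_def using B(1) by (intro countable_image countable_Collect_finite_subset)
    show "\<G> \<subseteq> sets borel"
      unfolding \<G>_def
    proof (rule image_subsetI)
      fix F assume "F \<in> {F. finite F \<and> F \<subseteq> \<B>}"
      then have "open (\<Inter>F)" using B(2) by (intro open_Inter) auto
      then show "K \<inter> \<Inter>F \<in> sets borel" by (rule sets.Int[OF K(2) borel_open])
    qed
    show "\<G> \<subseteq> Pow K" unfolding \<G>_def by auto
    show "K \<in> \<G>" unfolding \<G>_def by (intro image_eqI[of _ _ "{}"]) auto
    show "Int_stable \<G>"
    proof (rule Int_stableI)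
      fix a b assume "a \<in> \<G>" "b \<in> \<G>"
      then obtain F G where "a = K \<inter> \<Inter>F" "b = K \<inter> \<Inter>G" "finite F" "finite G" "F \<subseteq> \<B>" "G \<subseteq> \<B>"
        unfolding \<G>_def by blast
      then show "a \<inter> b \<in> \<G>" unfolding \<G>_def by (intro image_eqI[of _ _ "F \<union> G"]) auto
    qed
    show "K \<inter> E \<in> sigma_sets K \<G>" if "E \<in> sets borel" for E
    proof -
      have "E \<in> sigma_sets UNIV {U :: 'a set. open U}" using that by (simp add: borel_def)
      then show ?thesis
      proof induction
        case (Basic U)
        then show ?case using op by simp
      next
        case Empty
        then show ?case by (simp add: sigma_sets.Empty)
      next
        case (Compl a)
        have "K \<inter> (UNIV - a) = K - (K \<inter> a)" by auto
        then show ?case using sigma_sets.Compl[OF Compl.IH] by simp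
      next
        case (Union a)
        have "K \<inter> (\<Union>i. a i) = (\<Union>i. K \<inter> a i)" by auto
        then show ?case using sigma_sets.Union[of "\<lambda>i. K \<inter> a i"] Union.IH by simp
      qed
    qed
  qed
qed

lemma emeasure_eq_on_compact:
  fixes \<mu> \<nu> :: "'a::topological_space measure"
  assumes s: "sets \<mu> = sets borel" "sets \<nu> = sets borel" and K: "K \<in> sets borel" "emeasure \<mu> K < \<infinity>"
    and G: "\<G> \<subseteq> sets borel" "\<G> \<subseteq> Pow K" "Int_stable \<G>" "K \<in> \<G>"
      "\<And>E. E \<in> sets borel \<Longrightarrow> K \<inter> E \<in> sigma_sets K \<G>"
    and eq: "\<And>G. G \<in> \<G> \<Longrightarrow> emeasure \<mu> G = emeasure \<nu> G" and E: "E \<in> sets borel"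
  shows "emeasure \<mu> (K \<inter> E) = emeasure \<nu> (K \<inter> E)"
proof -
  have sp: "space \<mu> = UNIV" "space \<nu> = UNIV" using s[THEN sets_eq_imp_space_eq] by simp_all
  have restr: "emeasure (restrict_space \<mu> K) X = emeasure \<mu> X" "emeasure (restrict_space \<nu> K) X = emeasure \<nu> X"
    if "X \<subseteq> K" for X
    using that K(1) by (auto intro!: emeasure_restrict_space simp: s sp)
  have sets: "sets (restrict_space \<rho> K) = sigma_sets K \<G>" if \<rho>: "sets \<rho> = sets borel" for \<rho> :: "'a measure"
  proof
    have sr: "sets (restrict_space \<rho> K) = (\<inter>) K ` sets borel" by (simp add: sets_restrict_space \<rho>)
    show "sets (restrict_space \<rho> K) \<subseteq> sigma_sets K \<G>" unfolding sr using G(5) by auto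
    have "K \<in> sets (restrict_space \<rho> K)" unfolding sr by (intro image_eqI[of _ _ K]) (auto simp: K)
    moreover have "\<G> \<subseteq> sets (restrict_space \<rho> K)"
    proof
      fix g assume "g \<in> \<G>"
      then have "g \<in> sets borel" "g = K \<inter> g" using G(1,2) by auto
      then show "g \<in> sets (restrict_space \<rho> K)" unfolding sr by (rule image_eqI[rotated])
    qed
    ultimately show "sigma_sets K \<G> \<subseteq> sets (restrict_space \<rho> K)" by (intro sets.sigma_sets_subset')
  qed
  have "restrict_space \<mu> K = restrict_space \<nu> K"
  proof (rule measure_eqI_generator_eq[OF G(3,2) _ sets[OF s(1)] sets[OF s(2)], of "\<lambda>_. K"])
    fix X assume "X \<in> \<G>"
    then show "emeasure (restrict_space \<mu> K) X = emeasure (restrict_space \<nu> K) X"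
      using restr G(2) eq by auto
  qed (use G(4) K restr in auto)
  then show ?thesis using restr[of "K \<inter> E"] by simp
qed

theorem corollary1p7:
  fixes d :: "real \<Rightarrow> 'a::topological_space \<Rightarrow> 'a \<Rightarrow> real"
    and M :: "real \<Rightarrow> 'a measure"
    and m :: "(real \<times> 'a) measure"
    and p N :: real
  assumes "locally_compact_space (euclidean :: 'a topology)"
    and "metric_family d"
    and "measure_family d M"
    and "integrated_measure M m"
    and "radon_measure m"
    and "0 < p" and "p < 1" and "1 \<le> N"
    and "wTCD d p N m"
  shows "\<exists>m\<^sub>0. sets m\<^sub>0 = sets borel \<and> (AE s in lborel. M s = m\<^sub>0)"
proof -
  interpret wTCD_product d M m p N using assms by unfold_locales
  obtain L where L: "\<And>n. compact (L n)" "incseq L" and Z: "AE s in lborel. emeasure (M s) (- (\<Union>n. L n)) = 0"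
    by (rule sigma_compact_carrier) (rule that)
  have Lb: "L n \<in> sets borel" for n by (rule compact_borel[OF L(1)])
  define generates where "generates n \<G> \<longleftrightarrow> countable \<G> \<and> \<G> \<subseteq> sets borel \<and> \<G> \<subseteq> Pow (L n) \<and> Int_stable \<G> \<and>
    L n \<in> \<G> \<and> (\<forall>E\<in>sets borel. L n \<inter> E \<in> sigma_sets (L n) \<G>)" for n and \<G> :: "'a set set"
  have "\<exists>\<G>. generates n \<G>" for n
  proof -
    obtain \<G> where "countable \<G>" "\<G> \<subseteq> sets borel" "\<G> \<subseteq> Pow (L n)" "Int_stable \<G>" "L n \<in> \<G>"
      "\<And>E. E \<in> sets borel \<Longrightarrow> L n \<inter> E \<in> sigma_sets (L n) \<G>"
      by (rule countable_generator_of_compact[OF mf L(1) Lb, of n]) (rule that)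
    then have "generates n \<G>" by (simp add: generates_def)
    then show ?thesis ..
  qed
  then obtain \<G> where "\<And>n. generates n (\<G> n)" by metis
  then have G: "countable (\<G> n)" "\<G> n \<subseteq> sets borel" "\<G> n \<subseteq> Pow (L n)" "Int_stable (\<G> n)" "L n \<in> \<G> n"
    "\<And>E. E \<in> sets borel \<Longrightarrow> L n \<inter> E \<in> sigma_sets (L n) (\<G> n)" for n
    by (simp_all add: generates_def)
  define c where "c E = (SOME c. AE s in lborel. emeasure (M s) E = c)" for E
  have c: "AE s in lborel. emeasure (M s) E = c E" if "E \<in> sets borel" for E
    unfolding c_def using kernel_AE_constant[OF that] by (rule someI_ex)
  have "AE s in lborel. \<forall>g\<in>\<G> n. emeasure (M s) g = c g" for n
    using G(2)[of n] by (intro AE_ball_countable'[OF _ G(1)] c) auto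
  then have "AE s in lborel. \<forall>n. \<forall>g\<in>\<G> n. emeasure (M s) g = c g" unfolding AE_all_countable by blast
  then have good: "AE s in lborel. (\<forall>n. \<forall>g\<in>\<G> n. emeasure (M s) g = c g) \<and> emeasure (M s) (- (\<Union>n. L n)) = 0"
    using Z by eventually_elim simp
  then obtain s0 where s0: "\<forall>n. \<forall>g\<in>\<G> n. emeasure (M s0) g = c g" "emeasure (M s0) (- (\<Union>n. L n)) = 0"
    using AE_lborel_ex by blast
  have "AE s in lborel. M s = M s0"
    using good
  proof eventually_elim
    case (elim s)
    have on_L: "emeasure (M s) (L n \<inter> E) = emeasure (M s0) (L n \<inter> E)" if E: "E \<in> sets borel" for n E
      using elim s0 by (intro emeasure_eq_on_compact[OF sets_M sets_M Lb finite_M[OF L(1)] G(2-6) _ E]) auto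
    have SUP: "emeasure (M t) E = (SUP n. emeasure (M t) (L n \<inter> E))"
      if E: "E \<in> sets borel" and t: "emeasure (M t) (- (\<Union>n. L n)) = 0" for t E
    proof -
      have "- (\<Union>n. L n) \<in> sets borel" using Lb by auto
      then have "- (\<Union>n. L n) \<in> null_sets (M t)" using t by (intro null_setsI) (simp_all add: sets_M)
      from emeasure_Diff_null_set[OF this, of E] have "emeasure (M t) E = emeasure (M t) (E - - (\<Union>n. L n))"
        using E by (simp add: sets_M)
      also have "E - - (\<Union>n. L n) = (\<Union>n. L n \<inter> E)" by auto
      also have "emeasure (M t) \<dots> = (SUP n. emeasure (M t) (L n \<inter> E))"
      proof (rule SUP_emeasure_incseq[symmetric])
        show "range (\<lambda>n. L n \<inter> E) \<subseteq> sets (M t)" using Lb E by (auto simp: sets_M)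
        show "incseq (\<lambda>n. L n \<inter> E)" using L(2) by (auto simp: incseq_def)
      qed
      finally show ?thesis .
    qed
    show "M s = M s0"
    proof (rule measure_eqI)
      fix E assume "E \<in> sets (M s)"
      then have E: "E \<in> sets borel" by (simp add: sets_M)
      show "emeasure (M s) E = emeasure (M s0) E"
        using SUP[OF E, of s] SUP[OF E, of s0] elim s0(2) on_L[OF E] by simp
    qed (simp add: sets_M)
  qed
  then show ?thesis using sets_M by blast
qed

end
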